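(* Let $K$ be a field of characteristic zero and $n\ge 1$. Let $\widehat{\mathbb I}_n(\mathrm{weight})$ (resp. $\widehat{\mathbb I}_n(\mathrm{gen.\ weight})$) denote the set of isomorphism classes of simple weight (resp. simple generalized weight) left $\mathbb I_n$-modules. (1) $\widehat{\mathbb I}_n(\mathrm{gen.\ weight})=\widehat{\mathbb I}_n(\mathrm{weight})=\widehat{\mathbb I}_1(\mathrm{weight})^{\otimes n}$. That is: any simple generalized weight $\mathbb I_n$-module is a simple weight $\mathbb I_n$-module, and vice versa; the simple weight $\mathbb I_n$-modules are, up to isomorphism, exactly the tensor products $M_1\otimes\cdots\otimes M_n$ of simple weight $\mathbb I_1$-modules $M_1,\dots,M_n$; and two such modules are isomorphic over $\mathbb I_n$, $M_1\otimes\cdots\otimes M_n\simeq M_1'\otimes\cdots\otimes M_n'$, if and only if for each $i=1,\dots,n$ the $\mathbb I_1$-modules $M_i$ and $M_i'$ are isomorphic. (2) For each simple weight $\mathbb I_n$-module $M=\bigotimes_{i=1}^n M_i$ (with $M_i$ simple weight $\mathbb I_1$-modules), $\mathrm{Supp}(M)=\prod_{i=1}^n \mathrm{Supp}(M_i)$.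
   Context: $\otimes=\otimes_K$. $P_n=K[x_1,\dots,x_n]$. The algebra $\mathbb I_n$ of polynomial integro-differential operators is the $K$-subalgebra of $\mathrm{End}_K(P_n)$ generated by the multiplications by $x_i$, the partial derivatives $\partial_i=\partial/\partial x_i$, and the integrations $\int_i$ (the $K$-linear maps $x^\alpha\mapsto x_ix^\alpha/(\alpha_i+1)$), $i=1,\dots,n$. One has $\mathbb I_n=\mathbb I_1(1)\otimes\cdots\otimes\mathbb I_1(n)$ with $\mathbb I_1(i)=K\langle x_i,\partial_i,\int_i\rangle\simeq\mathbb I_1$, so a tensor product of $n$ $\mathbb I_1$-modules is an $\mathbb I_n$-module. Put $H_i=\partial_ix_i$; $D_n=K[H_1,\dots,H_n]\subset\mathbb I_n$ is a polynomial algebra. For $\lambda\in K^n$ let $\mathfrak m_\lambda=(H_1-\lambda_1,\dots,H_n-\lambda_n)$, a maximal ideal of $D_n$. For an $\mathbb I_n$-module $M$ put $M_\lambda=\{v\in M: \mathfrak m_\lambda v=0\}$ and $M^\lambda=\{v\in M:\mathfrak m_\lambda^i v=0\text{ for some } i\ge 0\}$. $M$ is a weight module if $M=\bigoplus_{\lambda\in K^n}M_\lambda$, and a generalized weight module if $M=\bigoplus_{\lambda\in K^n}M^\lambda$. The support is $\mathrm{Supp}(M)=\{\lambda\in K^n: M^\lambda\ne 0\}$ (for weight modules equivalently $M_\lambda\neq 0$). *)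

theory Defs
  imports "HOL-Algebra.Algebra" "HOL-Library.Poly_Mapping" "HOL-Library.FuncSet"
begin

section \<open>Free vector spaces and polynomials\<close>

text \<open>\<open>'a \<Rightarrow>\<^sub>0 'k\<close> is the \<open>'k\<close>-vector space with basis \<open>'a\<close>. For \<open>'a = 'n \<Rightarrow>\<^sub>0 nat\<close> (monomials
  in variables indexed by the finite type \<open>'n\<close>) it is the polynomial algebra \<open>P\<^sub>n\<close> with
  \<open>n = CARD('n)\<close>; \<open>P\<^sub>1\<close> is the instance \<open>'n = unit\<close>.\<close>

type_synonym ('n, 'k) mpol = "('n \<Rightarrow>\<^sub>0 nat) \<Rightarrow>\<^sub>0 'k"
type_synonym ('n, 'k) mpol_op = "('n, 'k) mpol \<Rightarrow> ('n, 'k) mpol"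

definition pm_scale :: "'k::field \<Rightarrow> ('a \<Rightarrow>\<^sub>0 'k) \<Rightarrow> ('a \<Rightarrow>\<^sub>0 'k)" where
  "pm_scale c p = Poly_Mapping.map ((*) c) p"

lemma lookup_pm_scale [simp]: "Poly_Mapping.lookup (pm_scale c p) a = c * Poly_Mapping.lookup p a"
  by (simp add: pm_scale_def Poly_Mapping.map.rep_eq when_def)

lemma vector_space_pm_scale: "vector_space pm_scale"
  by unfold_locales (auto intro!: poly_mapping_eqI simp: lookup_add algebra_simps)

definition lin_ext :: "('a \<Rightarrow> 'b \<Rightarrow>\<^sub>0 'k) \<Rightarrow> ('a \<Rightarrow>\<^sub>0 'k) \<Rightarrow> ('b \<Rightarrow>\<^sub>0 'k::field)" where
  "lin_ext g p = (\<Sum>a\<in>Poly_Mapping.keys p. pm_scale (Poly_Mapping.lookup p a) (g a))"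

lemma lin_ext_superset:
  assumes "finite A" "Poly_Mapping.keys p \<subseteq> A"
  shows "lin_ext g p = (\<Sum>a\<in>A. pm_scale (Poly_Mapping.lookup p a) (g a))"
  unfolding lin_ext_def
  by (rule sum.mono_neutral_left)
     (use assms in \<open>auto intro!: poly_mapping_eqI simp: in_keys_iff\<close>)

lemma lin_ext_single [simp]: "lin_ext g (Poly_Mapping.single a c) = pm_scale c (g a)"
  by (subst lin_ext_superset[of "{a}"]) auto

lemma linear_lin_ext: "Vector_Spaces.linear pm_scale pm_scale (lin_ext g)"
proof (intro Vector_Spaces.linear_iff[THEN iffD2] conjI vector_space_pm_scale allI)
  interpret vector_space "pm_scale :: 'a \<Rightarrow> ('c \<Rightarrow>\<^sub>0 'a) \<Rightarrow> _" by (rule vector_space_pm_scale)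
  show "lin_ext g (p + q) = lin_ext g p + lin_ext g q" for p q
    using keys_add[of p q]
    by (simp add: lin_ext_superset[of "Poly_Mapping.keys p \<union> Poly_Mapping.keys q"] lookup_add scale_left_distrib sum.distrib)
  show "lin_ext g (pm_scale c p) = pm_scale c (lin_ext g p)" for c p
    by (subst lin_ext_superset[of "Poly_Mapping.keys p"])
       (auto simp: lin_ext_def scale_sum_right in_keys_iff)
qed

section \<open>Polynomial integro-differential operators\<close>

definition mpol_End :: "('n::finite, 'k::field_char_0) mpol_op ring" where
  "mpol_End = \<lparr> carrier = {f. Vector_Spaces.linear pm_scale pm_scale f},
     monoid.mult = (\<circ>), monoid.one = id, ring.zero = (\<lambda>p. 0), ring.add = (\<lambda>f g p. f p + g p) \<rparr>"

definition op_x :: "'n \<Rightarrow> ('n::finite, 'k::field_char_0) mpol_op" where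
  "op_x i p = Poly_Mapping.single (Poly_Mapping.single i 1) 1 * p"

definition op_d :: "'n \<Rightarrow> ('n::finite, 'k::field_char_0) mpol_op" where
  "op_d i = lin_ext (\<lambda>\<alpha>. Poly_Mapping.single (\<alpha> - Poly_Mapping.single i 1) (of_nat (Poly_Mapping.lookup \<alpha> i)))"

definition op_int :: "'n \<Rightarrow> ('n::finite, 'k::field_char_0) mpol_op" where
  "op_int i = lin_ext (\<lambda>\<alpha>. Poly_Mapping.single (\<alpha> + Poly_Mapping.single i 1) (1 / of_nat (Poly_Mapping.lookup \<alpha> i + 1)))"

definition op_H :: "'n \<Rightarrow> ('n::finite, 'k::field_char_0) mpol_op" where
  "op_H i = op_d i \<circ> op_x i"

text \<open>The \<open>K\<close>-subalgebra generated by a set is the subring generated by the set together with the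
  scalar operators.\<close>

definition gen_subalg :: "('n::finite, 'k::field_char_0) mpol_op set \<Rightarrow> ('n, 'k) mpol_op ring" where
  "gen_subalg S = mpol_End\<lparr>carrier := generate_ring mpol_End (range pm_scale \<union> S)\<rparr>"

definition intdiff_alg :: "('n::finite, 'k::field_char_0) mpol_op ring" where
  "intdiff_alg = gen_subalg (range op_x \<union> range op_d \<union> range op_int)"

definition D_alg :: "('n::finite, 'k::field_char_0) mpol_op ring" where
  "D_alg = gen_subalg (range op_H)"

definition max_ideal :: "('n \<Rightarrow> 'k) \<Rightarrow> ('n::finite, 'k::field_char_0) mpol_op set" where
  "max_ideal w = genideal D_alg (range (\<lambda>i. op_H i \<ominus>\<^bsub>D_alg\<^esub> pm_scale (w i)))"

lemma linear_op_x:
  "Vector_Spaces.linear pm_scale pm_scale (op_x i :: ('n::finite, 'k::field_char_0) mpol_op)"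
proof (intro Vector_Spaces.linear_iff[THEN iffD2] conjI vector_space_pm_scale allI)
  have scale_mult: "pm_scale c p = Poly_Mapping.single 0 c * p" for c and p :: "('n, 'k) mpol"
    by (simp add: pm_scale_def mult_map_scale_conv_mult)
  show "op_x i (p + q) = op_x i p + op_x i q" for p q :: "('n, 'k) mpol"
    by (simp add: op_x_def algebra_simps)
  show "op_x i (pm_scale c p) = pm_scale c (op_x i p)" for c and p :: "('n, 'k) mpol"
    by (simp add: op_x_def scale_mult mult.left_commute)
qed

lemma linear_scale: "Vector_Spaces.linear pm_scale pm_scale (pm_scale c)"
  by (intro Vector_Spaces.linear_iff[THEN iffD2] conjI vector_space_pm_scale allI)
     (auto intro!: poly_mapping_eqI simp: lookup_add algebra_simps)

lemma ring_mpol_End: "ring (mpol_End :: ('n::finite, 'k::field_char_0) mpol_op ring)"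
proof -
  interpret vector_space "pm_scale :: 'k \<Rightarrow> ('n, 'k) mpol \<Rightarrow> _" by (rule vector_space_pm_scale)
  show ?thesis
  proof (intro ringI abelian_groupI monoidI)
    fix f assume "f \<in> carrier (mpol_End :: ('n, 'k) mpol_op ring)"
    then show "\<exists>g\<in>carrier mpol_End. g \<oplus>\<^bsub>mpol_End\<^esub> f = \<zero>\<^bsub>mpol_End\<^esub>"
      by (intro bexI[of _ "\<lambda>p. - f p"])
         (auto simp: mpol_End_def Vector_Spaces.linear_iff)
  qed (auto simp: mpol_End_def Vector_Spaces.linear_iff algebra_simps fun_eq_iff vector_space_pm_scale)
qed

lemma intdiff_gens_subset:
  "range pm_scale \<union> (range op_x \<union> range op_d \<union> range op_int)
     \<subseteq> carrier (mpol_End :: ('n::finite, 'k::field_char_0) mpol_op ring)"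
  by (auto simp: mpol_End_def linear_scale linear_op_x op_d_def op_int_def linear_lin_ext)

lemma ring_intdiff_alg: "ring (intdiff_alg :: ('n::finite, 'k::field_char_0) mpol_op ring)"
  unfolding intdiff_alg_def gen_subalg_def
  by (rule ring.subring_is_ring[OF ring_mpol_End
        ring.generate_ring_is_subring[OF ring_mpol_End intdiff_gens_subset]])

section \<open>Left modules\<close>

text \<open>The library's locale \<open>module\<close> is restricted to commutative rings; we reuse its record (whose
  fields \<open>mult\<close> and \<open>one\<close> play no role) and its notion of \<open>submodule\<close>.\<close>

locale left_module = R?: ring R + M?: abelian_group M
  for R :: "('r, 'c) ring_scheme" (structure) and M :: "('r, 'm, 'd) module_scheme" (structure) +
  assumes smult_closed: "\<lbrakk> a \<in> carrier R; x \<in> carrier M \<rbrakk> \<Longrightarrow> a \<odot>\<^bsub>M\<^esub> x \<in> carrier M"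
    and smult_l_distr: "\<lbrakk> a \<in> carrier R; b \<in> carrier R; x \<in> carrier M \<rbrakk> \<Longrightarrow>
      (a \<oplus> b) \<odot>\<^bsub>M\<^esub> x = a \<odot>\<^bsub>M\<^esub> x \<oplus>\<^bsub>M\<^esub> b \<odot>\<^bsub>M\<^esub> x"
    and smult_r_distr: "\<lbrakk> a \<in> carrier R; x \<in> carrier M; y \<in> carrier M \<rbrakk> \<Longrightarrow>
      a \<odot>\<^bsub>M\<^esub> (x \<oplus>\<^bsub>M\<^esub> y) = a \<odot>\<^bsub>M\<^esub> x \<oplus>\<^bsub>M\<^esub> a \<odot>\<^bsub>M\<^esub> y"
    and smult_assoc: "\<lbrakk> a \<in> carrier R; b \<in> carrier R; x \<in> carrier M \<rbrakk> \<Longrightarrow>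
      (a \<otimes> b) \<odot>\<^bsub>M\<^esub> x = a \<odot>\<^bsub>M\<^esub> (b \<odot>\<^bsub>M\<^esub> x)"
    and smult_one: "x \<in> carrier M \<Longrightarrow> \<one> \<odot>\<^bsub>M\<^esub> x = x"

definition simple_module :: "('r, 'c) ring_scheme \<Rightarrow> ('r, 'm, 'd) module_scheme \<Rightarrow> bool" where
  "simple_module R M \<longleftrightarrow> left_module R M \<and> carrier M \<noteq> {\<zero>\<^bsub>M\<^esub>} \<and>
     (\<forall>N. submodule N R M \<longrightarrow> N = {\<zero>\<^bsub>M\<^esub>} \<or> N = carrier M)"

definition module_isomorphic ::
    "('r, 'c) ring_scheme \<Rightarrow> ('r, 'm, 'd) module_scheme \<Rightarrow> ('r, 'l, 'e) module_scheme \<Rightarrow> bool" where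
  "module_isomorphic R M N \<longleftrightarrow> (\<exists>f \<in> iso (add_monoid M) (add_monoid N).
     \<forall>a\<in>carrier R. \<forall>x\<in>carrier M. f (a \<odot>\<^bsub>M\<^esub> x) = a \<odot>\<^bsub>N\<^esub> f x)"

definition internal_direct_sum :: "('m, 'd) ring_scheme \<Rightarrow> ('i \<Rightarrow> 'm set) \<Rightarrow> bool" where
  "internal_direct_sum M V \<longleftrightarrow> (\<forall>i. subgroup (V i) (add_monoid M)) \<and>
     (\<forall>v\<in>carrier M. \<exists>!f. (\<forall>i. f i \<in> V i) \<and> finite {i. f i \<noteq> \<zero>\<^bsub>M\<^esub>} \<and>
        v = (\<Oplus>\<^bsub>M\<^esub>i\<in>{i. f i \<noteq> \<zero>\<^bsub>M\<^esub>}. f i))"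

section \<open>Weight modules\<close>

definition weight_space ::
    "(('n::finite, 'k::field_char_0) mpol_op, 'm) module \<Rightarrow> ('n \<Rightarrow> 'k) \<Rightarrow> 'm set" where
  "weight_space M w = {v \<in> carrier M. \<forall>a\<in>max_ideal w. a \<odot>\<^bsub>M\<^esub> v = \<zero>\<^bsub>M\<^esub>}"

definition gen_weight_space ::
    "(('n::finite, 'k::field_char_0) mpol_op, 'm) module \<Rightarrow> ('n \<Rightarrow> 'k) \<Rightarrow> 'm set" where
  "gen_weight_space M w = {v \<in> carrier M. \<exists>i::nat.
     \<forall>a\<in>max_ideal w [^]\<^bsub>ideals_set D_alg\<^esub> i. a \<odot>\<^bsub>M\<^esub> v = \<zero>\<^bsub>M\<^esub>}"

definition weight_module :: "(('n::finite, 'k::field_char_0) mpol_op, 'm) module \<Rightarrow> bool" where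
  "weight_module M \<longleftrightarrow> left_module intdiff_alg M \<and> internal_direct_sum M (weight_space M)"

definition gen_weight_module :: "(('n::finite, 'k::field_char_0) mpol_op, 'm) module \<Rightarrow> bool" where
  "gen_weight_module M \<longleftrightarrow> left_module intdiff_alg M \<and> internal_direct_sum M (gen_weight_space M)"

definition simple_weight_module :: "(('n::finite, 'k::field_char_0) mpol_op, 'm) module \<Rightarrow> bool" where
  "simple_weight_module M \<longleftrightarrow> simple_module intdiff_alg M \<and> weight_module M"

definition simple_gen_weight_module ::
    "(('n::finite, 'k::field_char_0) mpol_op, 'm) module \<Rightarrow> bool" where
  "simple_gen_weight_module M \<longleftrightarrow> simple_module intdiff_alg M \<and> gen_weight_module M"

definition Supp :: "(('n::finite, 'k::field_char_0) mpol_op, 'm) module \<Rightarrow> ('n \<Rightarrow> 'k) set" where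
  "Supp M = {w. gen_weight_space M w \<noteq> {\<zero>\<^bsub>M\<^esub>}}"

text \<open>For \<open>n = 1\<close> the support lies in \<open>K\<^sup>1 = (unit \<Rightarrow> 'k)\<close>, which we identify with \<open>K\<close>.\<close>

definition Supp1 :: "((unit, 'k::field_char_0) mpol_op, 'm) module \<Rightarrow> 'k set" where
  "Supp1 M = {c. (\<lambda>_. c) \<in> Supp M}"

section \<open>Tensor products of modules over the one-variable algebra\<close>

text \<open>The tensor product over \<open>K\<close> of a family of modules indexed by \<open>'n\<close>: the free vector space on
  \<open>\<Prod>i. M i\<close> modulo the span of the multilinearity relations. A scalar \<open>c\<close> acts on an
  \<open>\<bbbI>\<^sub>1\<close>-module through the operator \<open>pm_scale c \<in> \<bbbI>\<^sub>1\<close>.\<close>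

definition tensor_free :: "('n \<Rightarrow> ('r, 'm) module) \<Rightarrow> (('n \<Rightarrow> 'm) \<Rightarrow>\<^sub>0 'k::field) set" where
  "tensor_free M = {f. Poly_Mapping.keys f \<subseteq> Pi UNIV (\<lambda>i. carrier (M i))}"

definition tensor_rels ::
    "('n \<Rightarrow> ((unit, 'k::field_char_0) mpol_op, 'm) module) \<Rightarrow> (('n \<Rightarrow> 'm) \<Rightarrow>\<^sub>0 'k) set" where
  "tensor_rels M = Modules.module.span pm_scale
     ({Poly_Mapping.single (m(i := x \<oplus>\<^bsub>M i\<^esub> y)) 1
         - Poly_Mapping.single (m(i := x)) 1 - Poly_Mapping.single (m(i := y)) 1 | m i x y.
         m \<in> Pi UNIV (\<lambda>j. carrier (M j)) \<and> x \<in> carrier (M i) \<and> y \<in> carrier (M i)} \<union>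
      {Poly_Mapping.single (m(i := pm_scale c \<odot>\<^bsub>M i\<^esub> x)) 1 - Poly_Mapping.single (m(i := x)) c | m i x c.
         m \<in> Pi UNIV (\<lambda>j. carrier (M j)) \<and> x \<in> carrier (M i)})"

definition tensor_class ::
    "('n \<Rightarrow> ((unit, 'k::field_char_0) mpol_op, 'm) module) \<Rightarrow> (('n \<Rightarrow> 'm) \<Rightarrow>\<^sub>0 'k)
       \<Rightarrow> (('n \<Rightarrow> 'm) \<Rightarrow>\<^sub>0 'k) set" where
  "tensor_class M f = {f + r | r. r \<in> tensor_rels M}"

text \<open>The identification \<open>\<bbbI>\<^sub>n = \<bbbI>\<^sub>1(1) \<otimes> \<dots> \<otimes> \<bbbI>\<^sub>1(n)\<close>: the pure tensor
  \<open>a\<^sub>1 \<otimes> \<dots> \<otimes> a\<^sub>n\<close> is the operator on \<open>P\<^sub>n\<close> that sends \<open>x\<^sup>\<alpha>\<close> to the product over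
  \<open>i\<close> of the one-variable polynomials \<open>a\<^sub>i\<close> applied to the power with exponent \<open>\<alpha>\<^sub>i\<close>, the \<open>i\<close>-th
  one written in the variable \<open>x\<^sub>i\<close>.\<close>

definition in_var :: "'n \<Rightarrow> (unit, 'k::field_char_0) mpol \<Rightarrow> ('n::finite, 'k) mpol" where
  "in_var i = lin_ext (\<lambda>\<beta>. Poly_Mapping.single (Poly_Mapping.single i (Poly_Mapping.lookup \<beta> ())) 1)"

definition tensor_op :: "('n \<Rightarrow> (unit, 'k) mpol_op) \<Rightarrow> ('n::finite, 'k::field_char_0) mpol_op" where
  "tensor_op a = lin_ext (\<lambda>\<alpha>. \<Prod>i\<in>UNIV.
     in_var i (a i (Poly_Mapping.single (Poly_Mapping.single () (Poly_Mapping.lookup \<alpha> i)) 1)))"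

text \<open>The ways to write an operator as a linear combination of pure tensors with components in
  \<open>\<bbbI>\<^sub>1\<close>.\<close>

definition tensor_reps ::
    "('n::finite, 'k::field_char_0) mpol_op \<Rightarrow> (('n \<Rightarrow> (unit, 'k) mpol_op) \<Rightarrow>\<^sub>0 'k) set" where
  "tensor_reps b = {r. Poly_Mapping.keys r \<subseteq> Pi UNIV (\<lambda>_. carrier intdiff_alg) \<and>
     b = (\<lambda>p. \<Sum>a\<in>Poly_Mapping.keys r. pm_scale (Poly_Mapping.lookup r a) (tensor_op a p))}"

text \<open>The bilinear extension of
  \<open>(a\<^sub>1 \<otimes> \<dots> \<otimes> a\<^sub>n) (m\<^sub>1 \<otimes> \<dots> \<otimes> m\<^sub>n) = a\<^sub>1 m\<^sub>1 \<otimes> \<dots> \<otimes> a\<^sub>n m\<^sub>n\<close>.\<close>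

definition tensor_act :: "('n \<Rightarrow> ('r, 'm) module) \<Rightarrow> (('n \<Rightarrow> 'r) \<Rightarrow>\<^sub>0 'k::field) \<Rightarrow>
    (('n \<Rightarrow> 'm) \<Rightarrow>\<^sub>0 'k) \<Rightarrow> (('n \<Rightarrow> 'm) \<Rightarrow>\<^sub>0 'k)" where
  "tensor_act M r f = lin_ext (\<lambda>a. lin_ext (\<lambda>m. Poly_Mapping.single (\<lambda>i. a i \<odot>\<^bsub>M i\<^esub> m i) 1) f) r"

text \<open>As for quotient rings in the library, operations on classes are defined on all
  representatives at once.\<close>

definition tensor_module :: "('n \<Rightarrow> ((unit, 'k) mpol_op, 'm) module) \<Rightarrow>
    (('n::finite, 'k::field_char_0) mpol_op, (('n \<Rightarrow> 'm) \<Rightarrow>\<^sub>0 'k) set) module" where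
  "tensor_module M = \<lparr> carrier = tensor_class M ` tensor_free M,
     monoid.mult = undefined, monoid.one = undefined,
     ring.zero = tensor_rels M,
     ring.add = (\<lambda>S T. \<Union>f\<in>S. \<Union>g\<in>T. tensor_class M (f + g)),
     smult = (\<lambda>b S. \<Union>r\<in>tensor_reps b. \<Union>f\<in>S. tensor_class M (tensor_act M r f)) \<rparr>"

end

theory Submission
  imports Defs "HOL-Computational_Algebra.Polynomial"
begin

text \<open>For a set \<open>S\<close> of variables and \<open>\<nu> \<in> K\<^sup>n\<close> vanishing on \<open>S\<close> there is a model module with basis
  indexed by the \<open>\<alpha> \<in> \<int>\<^sup>n\<close> with \<open>\<alpha>\<^sub>i \<ge> 0\<close> for \<open>i \<in> S\<close>, on which \<open>\<partial>\<^sub>i\<close> and \<open>\<integral>\<^sub>i\<close> act as shifts and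
  \<open>H\<^sub>i\<close> has the eigenvalue \<open>\<nu>\<^sub>i + \<alpha>\<^sub>i + 1\<close>; for \<open>S\<close> the set of all variables it is \<open>P\<^sub>n\<close> in the basis of
  divided powers. That an operator on \<open>P\<^sub>n\<close> determines its action on every model is seen by polynomial
  extrapolation in \<open>\<nu>\<close>: for large integral \<open>\<nu>\<close> the model looks locally like \<open>P\<^sub>n\<close>.

  Let a simple module have a generalized weight vector. As the \<open>H\<^sub>i\<close> commute, it has a weight vector.
  Put \<open>S = {i. ker \<partial>\<^sub>i \<noteq> 0}\<close>. For \<open>i \<in> S\<close> the vectors killed by a power of \<open>\<partial>\<^sub>i\<close> form a nonzero submodule,
  hence everything, so there is a weight vector killed by all these \<open>\<partial>\<^sub>i\<close>. For \<open>i \<notin> S\<close> the injectivity of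
  \<open>\<partial>\<^sub>i\<close> and \<open>\<partial>\<^sub>i\<integral>\<^sub>i = 1\<close> make \<open>\<integral>\<^sub>i\<close> the inverse of \<open>\<partial>\<^sub>i\<close>. Shifting the vector gives a nonzero homomorphism from
  a model, which is simple, so the module is isomorphic to a model. The tensor product of one-variable
  models is a model, and a model is determined up to isomorphism by its support.\<close>

section \<open>Linear maps between free vector spaces\<close>

text \<open>The algebra is given as concrete endomorphisms of polynomials, with no presentation by
  generators and relations. An action prescribed on generators therefore gives a module only once it
  is known to depend on the operator alone, and this shapes the proof: an operator carries a
  \<open>symbol\<close>, its action on basis vectors as a polynomial function of \<nu>, and
  \<open>symbol_unique\<close> shows that the symbol is determined on the orthant wherever \<nu>
  vanishes on \<open>S\<close>. The same uniqueness settles the tensor product, whose scalar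
  multiplication ranges over all ways to write an operator as a combination of pure tensors: every
  way leads to the same \<open>rep\<close>. The summand 1 in the eigenvalue comes from
  \<open>H_i = \<partial>_i x_i\<close>, which multiplies a monomial of exponent a in x_i by a + 1.
  Hence a weight vector killed by \<partial>_i has eigenvalue 1, and \<nu> must vanish on
  \<open>S\<close>. Weights, generalized weights, supports and simplicity are computed on models,
  where the \<open>H_i\<close> are diagonal with distinct joint eigenvalues in characteristic zero,
  and are carried along isomorphisms.\<close>

abbreviation "keys \<equiv> Poly_Mapping.keys"
abbreviation "lookup \<equiv> Poly_Mapping.lookup"
abbreviation "single \<equiv> Poly_Mapping.single"

interpretation PM: vector_space pm_scale
  by (rule vector_space_pm_scale)

abbreviation plin :: "(('a \<Rightarrow>\<^sub>0 'k::field) \<Rightarrow> ('b \<Rightarrow>\<^sub>0 'k)) \<Rightarrow> bool" where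
  "plin \<equiv> Vector_Spaces.linear pm_scale pm_scale"

lemma plinI:
  assumes "\<And>p q. f (p + q) = f p + f q" "\<And>c p. f (pm_scale c p) = pm_scale c (f p)"
  shows "plin f"
  using assms by (auto simp: Vector_Spaces.linear_iff vector_space_pm_scale)

lemma plin_add: "plin f \<Longrightarrow> f (p + q) = f p + f q"
  and plin_scale: "plin f \<Longrightarrow> f (pm_scale c p) = pm_scale c (f p)"
  by (auto simp: Vector_Spaces.linear_iff)

lemma plin_zero: "plin f \<Longrightarrow> f 0 = 0"
  using plin_scale[of f 0 0] by simp

lemma plin_minus: "plin f \<Longrightarrow> f (- p) = - f p"
  using plin_scale[of f "-1" p] by simp

lemma plin_diff: "plin f \<Longrightarrow> f (p - q) = f p - f q"
  using plin_add[of f p "- q"] by (simp add: plin_minus)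

lemma plin_sum: "plin f \<Longrightarrow> f (sum g A) = (\<Sum>a\<in>A. f (g a))"
  by (induction A rule: infinite_finite_induct) (auto simp: plin_zero plin_add)

lemma plin_comp: "plin f \<Longrightarrow> plin g \<Longrightarrow> plin (\<lambda>p. f (g p))"
  by (auto intro!: plinI simp: plin_add plin_scale)

lemmas plin_lin_ext = linear_lin_ext
lemmas lin_ext_add = plin_add[OF linear_lin_ext]
lemmas lin_ext_scale = plin_scale[OF linear_lin_ext]
lemmas lin_ext_zero [simp] = plin_zero[OF linear_lin_ext]
lemmas lin_ext_diff = plin_diff[OF linear_lin_ext]

lemma lookup_lin_ext:
  "lookup (lin_ext g p) b =
     (\<Sum>a\<in>keys p. lookup p a * lookup (g a) b)"
  by (simp add: lin_ext_def lookup_sum)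

lemma keys_lin_ext: "keys (lin_ext g p) \<subseteq> (\<Union>a\<in>keys p. keys (g a))"
proof
  fix b assume "b \<in> keys (lin_ext g p)"
  then have "(\<Sum>a\<in>keys p. lookup p a * lookup (g a) b) \<noteq> 0"
    by (simp add: in_keys_iff lookup_lin_ext)
  then obtain a where "a \<in> keys p" "lookup p a * lookup (g a) b \<noteq> 0"
    by (meson sum.neutral)
  then show "b \<in> (\<Union>a\<in>keys p. keys (g a))"
    by (auto simp: in_keys_iff)
qed

lemma lin_ext_cong: "(\<And>a. a \<in> keys p \<Longrightarrow> g a = h a) \<Longrightarrow> lin_ext g p = lin_ext h p"
  by (simp add: lin_ext_def)

lemma plin_lin_ext_comp: "plin f \<Longrightarrow> f (lin_ext g p) = lin_ext (\<lambda>a. f (g a)) p"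
  by (simp add: lin_ext_def plin_sum plin_scale)

lemma lin_ext_singles [simp]: "lin_ext (\<lambda>a. single a 1) p = p"
proof (rule poly_mapping_eqI)
  fix b
  have "(\<Sum>a\<in>keys p. lookup p a * lookup (single a 1) b)
      = (\<Sum>a\<in>keys p. if b = a then lookup p a else 0)"
    by (rule sum.cong) (auto simp: lookup_single when_def)
  also have "\<dots> = lookup p b"
    by (simp add: in_keys_iff)
  finally show "lookup (lin_ext (\<lambda>a. single a 1) p) b = lookup p b"
    by (simp add: lookup_lin_ext)
qed

lemma plin_eq_lin_ext: "plin f \<Longrightarrow> f p = lin_ext (\<lambda>a. f (single a 1)) p"
  using plin_lin_ext_comp[of f "\<lambda>a. single a 1" p] by simp

lemma plin_eqI:
  "plin f \<Longrightarrow> plin g \<Longrightarrow> (\<And>a. a \<in> keys p \<Longrightarrow> f (single a 1) = g (single a 1)) \<Longrightarrow> f p = g p"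
  by (subst plin_eq_lin_ext[of f], assumption, subst plin_eq_lin_ext[of g], assumption) (rule lin_ext_cong)

lemma lin_ext_fun_add: "lin_ext (\<lambda>a. g a + h a) p = lin_ext g p + lin_ext h p"
  and lin_ext_fun_diff: "lin_ext (\<lambda>a. g a - h a) p = lin_ext g p - lin_ext h p"
  and lin_ext_fun_scale: "lin_ext (\<lambda>a. pm_scale c (g a)) p = pm_scale c (lin_ext g p)"
  by (simp_all add: poly_mapping_eq_iff fun_eq_iff lookup_lin_ext lookup_add lookup_minus distrib_left
      right_diff_distrib sum.distrib sum_subtractf sum_distrib_left mult.left_commute)

lemma pm_scale_single: "pm_scale c (single a d) = single a (c * d)"
  by (rule poly_mapping_eqI) (simp add: lookup_single when_def)

lemma keys_pm_scale: "keys (pm_scale c p) \<subseteq> keys p"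
  by (auto simp: in_keys_iff)

section \<open>The basis of divided powers\<close>

text \<open>In terms of the divided powers all generators act by weighted shifts. A monomial with a
  negative exponent counts as zero, which makes the formula for the derivative uniform.\<close>

definition dpow :: "('n \<Rightarrow> int) \<Rightarrow> ('n::finite, 'k::field_char_0) mpol" where
  "dpow \<beta> = (if \<forall>i. 0 \<le> \<beta> i
     then single (Abs_poly_mapping (\<lambda>i. nat (\<beta> i))) (1 / (\<Prod>i\<in>UNIV. fact (nat (\<beta> i)))) else 0)"

lemma dpow_nonneg:
  "(\<And>i. 0 \<le> \<beta> i) \<Longrightarrow> dpow \<beta> = single (Abs_poly_mapping (\<lambda>i. nat (\<beta> i))) (1 / (\<Prod>i\<in>UNIV. fact (nat (\<beta> i))))"
  by (simp add: dpow_def)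

lemma dpow_neg: "\<beta> i < 0 \<Longrightarrow> dpow \<beta> = 0"
  by (metis dpow_def not_le)

lemma lookup_Abs_finite [simp]:
  "lookup (Abs_poly_mapping (f :: 'n::finite \<Rightarrow> 'b::zero)) = f"
  by simp

lemma single_eq_dpow:
  "single \<gamma> 1 =
    pm_scale (\<Prod>i\<in>UNIV. fact (lookup \<gamma> i))
      (dpow (\<lambda>i. int (lookup \<gamma> i)) :: ('n::finite, 'k::field_char_0) mpol)"
  by (simp add: dpow_def pm_scale_single)

lemma dpow_eqI:
  assumes "plin f" "plin g" "\<And>\<beta>. (\<And>i. 0 \<le> \<beta> i) \<Longrightarrow> f (dpow \<beta>) = g (dpow \<beta>)"
  shows "f p = g p"
  by (rule plin_eqI[OF assms(1,2)]) (simp add: single_eq_dpow plin_scale assms)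

lemma Abs_poly_mapping_plus_single:
  "Abs_poly_mapping (f :: 'n::finite \<Rightarrow> nat) + single i 1 = Abs_poly_mapping (f(i := f i + 1))"
  by (rule poly_mapping_eqI) (simp add: lookup_add lookup_single when_def)

lemma Abs_poly_mapping_minus_single:
  "Abs_poly_mapping (f :: 'n::finite \<Rightarrow> nat) - single i 1 = Abs_poly_mapping (f(i := f i - 1))"
  by (rule poly_mapping_eqI) (simp add: lookup_minus lookup_single when_def)

lemma prod_fun_upd:
  "(\<Prod>j\<in>UNIV. g ((f(i := c)) j)) = g c * (\<Prod>j\<in>UNIV - {i}. g (f j))" for i :: "'n::finite"
  by (subst prod.remove[of _ i]) (auto intro!: prod.cong)

lemma prod_split:
  "(\<Prod>j\<in>UNIV. g (f j)) = g (f i) * (\<Prod>j\<in>UNIV - {i}. g (f j))" for i :: "'n::finite"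
  by (subst prod.remove[of _ i]) auto

text \<open>The convention for negative exponents absorbs the case of exponent 0: the derivative
  kills the monomial, and the exponent -1 on the right counts as zero.\<close>

lemma op_d_dpow: "op_d i (dpow \<beta>) = dpow (\<beta>(i := \<beta> i - 1))"
proof (cases "\<forall>j. 0 \<le> \<beta> j")
  case True
  have e: "(\<lambda>j. nat (\<beta> j))(i := nat (\<beta> i) - 1) = (\<lambda>j. nat ((\<beta>(i := \<beta> i - 1)) j))"
    by (rule ext, simp) arith
  show ?thesis
  proof (cases "\<beta> i = 0")
    case True
    then show ?thesis
      using \<open>\<forall>j. 0 \<le> \<beta> j\<close> by (simp add: dpow_nonneg op_d_def dpow_neg[of _ i])
  next
    case False
    then have p: "\<beta> i > 0" using True by (simp add: order_less_le)
    then have f: "fact (nat (\<beta> i)) = (of_nat (nat (\<beta> i)) :: 'b) * fact (nat (\<beta> i - 1))"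
      by (metis fact_reduce nat_diff_distrib' nat_1 zero_less_nat_eq One_nat_def order_less_imp_le zero_le_one)
    have c: "(1 / (\<Prod>j\<in>UNIV. fact (nat (\<beta> j)))) * of_nat (nat (\<beta> i)) =
       (1 / (\<Prod>j\<in>UNIV. fact (nat ((\<beta>(i := \<beta> i - 1)) j))) :: 'b)"
      using p by (subst prod_fun_upd, subst prod_split[of _ _ i]) (simp add: f divide_simps)
    show ?thesis
      using True p
      apply (subst dpow_nonneg, simp)
      apply (subst dpow_nonneg, simp)
      apply (simp only: op_d_def lin_ext_single pm_scale_single Abs_poly_mapping_minus_single lookup_Abs_finite c e)
      done
  qed
next
  case False
  then obtain j where "\<beta> j < 0" by (auto simp: not_le)
  moreover then have "(\<beta>(i := \<beta> i - 1)) j < 0" by auto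
  ultimately show ?thesis
    by (simp only: dpow_neg[of _ j] op_d_def lin_ext_zero)
qed

text \<open>The sign condition excludes the exponent -1, where integrating the zero polynomial would
  not give the divided power with exponent 0.\<close>

lemma op_int_dpow:
  assumes "0 \<le> \<beta> i"
  shows "op_int i (dpow \<beta>) = dpow (\<beta>(i := \<beta> i + 1))"
proof (cases "\<forall>j. 0 \<le> \<beta> j")
  case True
  have e: "(\<lambda>j. nat (\<beta> j))(i := nat (\<beta> i) + 1) = (\<lambda>j. nat ((\<beta>(i := \<beta> i + 1)) j))"
    using assms by (auto simp: nat_add_distrib)
  have n: "nat (\<beta> i + 1) = Suc (nat (\<beta> i))" using assms by simp
  have c: "(1 / (\<Prod>j\<in>UNIV. fact (nat (\<beta> j)))) * (1 / of_nat (nat (\<beta> i) + 1)) =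
       (1 / (\<Prod>j\<in>UNIV. fact (nat ((\<beta>(i := \<beta> i + 1)) j))) :: 'b)"
    by (subst prod_fun_upd, subst prod_split[of _ _ i]) (simp add: n)
  show ?thesis
    using True assms
    apply (subst dpow_nonneg, simp)
    apply (subst dpow_nonneg, simp)
    apply (simp only: op_int_def lin_ext_single pm_scale_single Abs_poly_mapping_plus_single lookup_Abs_finite c e)
    done
next
  case False
  then obtain j where "\<beta> j < 0" by (auto simp: not_le)
  moreover then have "j \<noteq> i" using assms by auto
  ultimately show ?thesis
    by (simp add: dpow_neg[of \<beta> j] dpow_neg[of _ j] op_int_def)
qed

text \<open>Valid for every integer exponent: at exponent -1 in x_i the factor vanishes, and in all
  other cases with a negative exponent both divided powers are zero.\<close>

lemma op_x_dpow: "op_x i (dpow \<beta>) = pm_scale (of_int (\<beta> i + 1)) (dpow (\<beta>(i := \<beta> i + 1)))"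
proof (cases "\<forall>j. 0 \<le> \<beta> j")
  case True
  have e: "(\<lambda>j. nat (\<beta> j))(i := nat (\<beta> i) + 1) = (\<lambda>j. nat ((\<beta>(i := \<beta> i + 1)) j))"
    using True by (auto simp: nat_add_distrib)
  have n: "nat (\<beta> i + 1) = Suc (nat (\<beta> i))" using True by (simp add: nat_add_distrib)
  have o: "(of_int (\<beta> i + 1) :: 'b) = of_nat (Suc (nat (\<beta> i)))"
    using True by simp
  have "(of_nat (Suc (nat (\<beta> i))) :: 'b) \<noteq> 0" using of_nat_neq_0 by blast
  then have c: "of_int (\<beta> i + 1) * (1 / (\<Prod>j\<in>UNIV. fact (nat ((\<beta>(i := \<beta> i + 1)) j))) :: 'b)
      = 1 / (\<Prod>j\<in>UNIV. fact (nat (\<beta> j)))"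
    unfolding o by (subst prod_fun_upd, subst prod_split[of _ _ i]) (simp add: n)
  have s: "op_x i (single a d) = single (a + single i 1) d" 
    for a and d :: 'b
    by (simp add: op_x_def mult_single add.commute)
  show ?thesis
    using True
    apply (subst dpow_nonneg, simp)
    apply (subst dpow_nonneg, simp)
    apply (simp only: s pm_scale_single Abs_poly_mapping_plus_single lookup_Abs_finite c e)
    done
next
  case False
  then obtain j where j: "\<beta> j < 0" by (auto simp: not_le)
  show ?thesis
  proof (cases "\<beta> i = -1")
    case True
    then show ?thesis by (simp add: dpow_neg[of \<beta> i] op_x_def)
  next
    case False
    with j have "(\<beta>(i := \<beta> i + 1)) j < 0" by auto
    with j show ?thesis
      by (simp add: dpow_neg[of \<beta> j] dpow_neg[of _ j] op_x_def)
  qed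
qed

lemma plin_op_x: "plin (op_x i)" and plin_op_d: "plin (op_d i)" and plin_op_int: "plin (op_int i)"
  by (simp_all add: linear_op_x op_d_def op_int_def linear_lin_ext)

lemma op_H_dpow: "op_H i (dpow \<beta>) = pm_scale (of_int (\<beta> i + 1)) (dpow \<beta>)"
  by (simp add: op_H_def op_x_dpow op_d_dpow plin_scale[OF plin_op_d])

lemma plin_op_H: "plin (op_H i)"
  unfolding op_H_def comp_def by (rule plin_comp[OF plin_op_d plin_op_x])

section \<open>Polynomial functions\<close>

text \<open>Polynomial functions are built semantically, since the argument rests on their closure
  properties and on the vanishing criterion \<open>polyfun_eq_zero\<close>.\<close>

inductive polyfun :: "(('n \<Rightarrow> 'k::comm_ring_1) \<Rightarrow> 'k) \<Rightarrow> bool" where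
  const: "polyfun (\<lambda>z. c)"
| coord: "polyfun (\<lambda>z. z i)"
| add: "polyfun f \<Longrightarrow> polyfun g \<Longrightarrow> polyfun (\<lambda>z. f z + g z)"
| mult: "polyfun f \<Longrightarrow> polyfun g \<Longrightarrow> polyfun (\<lambda>z. f z * g z)"

lemma polyfun_sum: "(\<And>a. a \<in> A \<Longrightarrow> polyfun (f a)) \<Longrightarrow> polyfun (\<lambda>z. \<Sum>a\<in>A. f a z)"
proof (induction A rule: infinite_finite_induct)
  case (insert a A)
  then show ?case
    using polyfun.add[of "f a" "\<lambda>z. \<Sum>a\<in>A. f a z"] by simp
qed (simp_all add: polyfun.const)

lemma polyfun_prod: "(\<And>a. a \<in> A \<Longrightarrow> polyfun (f a)) \<Longrightarrow> polyfun (\<lambda>z. \<Prod>a\<in>A. f a z)"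
proof (induction A rule: infinite_finite_induct)
  case (insert a A)
  then show ?case
    using polyfun.mult[of "f a" "\<lambda>z. \<Prod>a\<in>A. f a z"] by simp
qed (simp_all add: polyfun.const)

lemma polyfun_diff: "polyfun f \<Longrightarrow> polyfun g \<Longrightarrow> polyfun (\<lambda>z. f z - g z)"
  using polyfun.add[OF _ polyfun.mult[OF polyfun.const[of "-1"]], of f g] by simp

text \<open>Feeds the coordinate \<open>\<nu> i\<close> into the symbol of a one-variable operator
  when pure tensors are formed.\<close>

lemma polyfun_restrict: "polyfun f \<Longrightarrow> polyfun (\<lambda>z. f (\<lambda>_. z i))"
proof (induction rule: polyfun.induct)
  case (add f g)
  then show ?case by (intro polyfun.add)
next
  case (mult f g)
  then show ?case by (intro polyfun.mult)
qed (rule polyfun.const, rule polyfun.coord)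

lemma polyfun_poly: "polyfun f \<Longrightarrow> \<exists>p. \<forall>t. f (w(u := t)) = poly p t"
proof (induction rule: polyfun.induct)
  case (const c)
  then show ?case by (intro exI[of _ "[:c:]"]) simp
next
  case (coord i)
  then show ?case by (intro exI[of _ "if i = u then [:0, 1:] else [:w i:]"]) simp
next
  case (add f g)
  then show ?case by (metis poly_add)
next
  case (mult f g)
  then show ?case by (metis poly_mult)
qed

text \<open>One coordinate in \<open>U\<close> is freed at a time: along that axis the function is a
  polynomial in one variable, and it vanishes at all large natural numbers, which are infinitely
  many distinct elements of a field of characteristic zero. Coordinates outside \<open>U\<close>
  stay frozen at \<open>w\<close>.\<close>

lemma polyfun_eq_zero:
  fixes f :: "('n \<Rightarrow> 'k::field_char_0) \<Rightarrow> 'k"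
  assumes "polyfun f" "finite U"
    and "\<And>z. (\<And>i. i \<in> U \<Longrightarrow> z i \<in> of_nat ` {N..}) \<Longrightarrow> (\<And>i. i \<notin> U \<Longrightarrow> z i = w i) \<Longrightarrow> f z = 0"
  shows "f w = 0"
  using assms(2,3)
proof (induction U arbitrary: w rule: finite_induct)
  case empty
  then show ?case by auto
next
  case (insert u U)
  obtain p where p: "\<And>t. f (w(u := t)) = poly p t"
    using polyfun_poly[OF assms(1)] by blast
  have "f (w(u := of_nat k)) = 0" if "k \<ge> N" for k
  proof (rule insert.IH)
    fix z assume "\<And>i. i \<in> U \<Longrightarrow> z i \<in> of_nat ` {N..}" "\<And>i. i \<notin> U \<Longrightarrow> z i = (w(u := of_nat k)) i"
    then show "f z = 0"
      using that insert.hyps by (intro insert.prems) (metis atLeast_iff fun_upd_same image_eqI insertE, metis fun_upd_other insert_iff)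
  qed
  then have "of_nat ` {N..} \<subseteq> {t. poly p t = 0}"
    by (auto simp: p)
  moreover have "infinite (of_nat ` {N..} :: 'k set)"
    by (meson finite_imageD inj_of_nat infinite_Ici inj_on_subset subset_UNIV)
  ultimately have "p = 0"
    using poly_roots_finite finite_subset by blast
  then show ?case using p[of "w u"] by simp
qed

section \<open>The algebra of integro-differential operators\<close>

lemma intdiff_alg_simps [simp]:
  "monoid.mult intdiff_alg = (\<circ>)" "monoid.one intdiff_alg = id"
  "ring.zero intdiff_alg = (\<lambda>p. 0)" "ring.add intdiff_alg = (\<lambda>f g p. f p + g p)"
  by (simp_all add: intdiff_alg_def gen_subalg_def mpol_End_def)

lemma D_alg_simps [simp]:
  "monoid.mult D_alg = (\<circ>)" "monoid.one D_alg = id"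
  "ring.zero D_alg = (\<lambda>p. 0)" "ring.add D_alg = (\<lambda>f g p. f p + g p)"
  by (simp_all add: D_alg_def gen_subalg_def mpol_End_def)

lemma a_inv_mpol_End:
  fixes f :: "('n::finite, 'k::field_char_0) mpol_op"
  assumes "plin f"
  shows "\<ominus>\<^bsub>mpol_End\<^esub> f = pm_scale (-1) \<circ> f"
proof -
  interpret E: ring "mpol_End :: ('n, 'k) mpol_op ring" by (rule ring_mpol_End)
  have "pm_scale (-1) \<circ> f \<in> carrier mpol_End"
    using assms by (auto simp: mpol_End_def intro!: plinI simp: plin_add plin_scale)
  then show ?thesis
    using assms by (intro E.minus_equality) (auto simp: mpol_End_def fun_eq_iff)
qed

text \<open>Neither the unit nor negation is a separate case: they are \<open>pm_scale 1\<close> and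
  composition with \<open>pm_scale (-1)\<close>.\<close>

lemma gen_subalg_induct [consumes 2, case_names gen scale add comp]:
  fixes S :: "('n::finite, 'k::field_char_0) mpol_op set"
  assumes "b \<in> carrier (gen_subalg S)" "\<And>s. s \<in> S \<Longrightarrow> plin s"
    and gen: "\<And>s. s \<in> S \<Longrightarrow> P s"
    and scale: "\<And>c. P (pm_scale c)"
    and add: "\<And>f g. f \<in> carrier (gen_subalg S) \<Longrightarrow> g \<in> carrier (gen_subalg S) \<Longrightarrow> P f \<Longrightarrow> P g \<Longrightarrow> P (\<lambda>p. f p + g p)"
    and comp: "\<And>f g. f \<in> carrier (gen_subalg S) \<Longrightarrow> g \<in> carrier (gen_subalg S) \<Longrightarrow> P f \<Longrightarrow> P g \<Longrightarrow> P (f \<circ> g)"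
  shows "P b"
proof -
  let ?G = "generate_ring mpol_End (range pm_scale \<union> S)"
  have car: "carrier (gen_subalg S) = ?G" by (simp add: gen_subalg_def)
  have sub: "range pm_scale \<union> S \<subseteq> carrier mpol_End"
    using assms(2) by (auto simp: mpol_End_def linear_scale)
  have pl: "plin f" if "f \<in> ?G" for f
    using ring.generate_ring_in_carrier[OF ring_mpol_End sub that] by (simp add: mpol_End_def)
  have sc: "pm_scale c \<in> ?G" for c by (rule generate_ring.incl) auto
  have "b \<in> ?G" using assms(1) car by simp
  then show ?thesis
  proof (induction rule: generate_ring.induct)
    case one
    have "\<one>\<^bsub>mpol_End\<^esub> = (pm_scale 1 :: ('n, 'k) mpol_op)"
      by (auto simp: mpol_End_def fun_eq_iff)
    then show ?case using scale by metis
  next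
    case (incl h)
    then show ?case using gen scale by auto
  next
    case (a_inv h)
    then show ?case
      using comp[of "pm_scale (-1)" h] sc scale by (metis car a_inv_mpol_End[OF pl])
  next
    case (eng_add f g)
    then show ?case using add[of f g] by (simp add: car mpol_End_def)
  next
    case (eng_mult f g)
    moreover have "monoid.mult mpol_End = ((\<circ>) :: ('n, 'k) mpol_op \<Rightarrow> _)" by (simp add: mpol_End_def)
    ultimately show ?case using comp[of f g] car by metis
  qed
qed

lemma intdiff_induct [consumes 1, case_names x d int scale add comp]:
  fixes b :: "('n::finite, 'k::field_char_0) mpol_op"
  assumes "b \<in> carrier intdiff_alg"
    and "\<And>i. P (op_x i)" "\<And>i. P (op_d i)" "\<And>i. P (op_int i)" "\<And>c. P (pm_scale c)"
    and "\<And>f g. f \<in> carrier intdiff_alg \<Longrightarrow> g \<in> carrier intdiff_alg \<Longrightarrow> P f \<Longrightarrow> P g \<Longrightarrow> P (\<lambda>p. f p + g p)"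
    and "\<And>f g. f \<in> carrier intdiff_alg \<Longrightarrow> g \<in> carrier intdiff_alg \<Longrightarrow> P f \<Longrightarrow> P g \<Longrightarrow> P (f \<circ> g)"
  shows "P b"
proof (rule gen_subalg_induct[of b "range op_x \<union> range op_d \<union> range op_int" P])
  show "b \<in> carrier (gen_subalg (range op_x \<union> range op_d \<union> range op_int))"
    using assms(1) by (simp add: intdiff_alg_def)
qed (use assms(2-) in \<open>auto simp: intdiff_alg_def plin_op_x plin_op_d plin_op_int\<close>)

lemma plin_intdiff: "b \<in> carrier intdiff_alg \<Longrightarrow> plin b"
proof (induction rule: intdiff_induct)
  case (add f g)
  then show ?case by (auto intro!: plinI simp: plin_add plin_scale PM.scale_right_distrib)
next
  case (comp f g)
  then show ?case by (auto intro!: plinI simp: plin_add plin_scale)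
qed (simp_all add: plin_op_x plin_op_d plin_op_int linear_scale)

lemma intdiff_gens [simp, intro]:
  "op_x i \<in> carrier intdiff_alg" "op_d i \<in> carrier intdiff_alg" "op_int i \<in> carrier intdiff_alg"
  "pm_scale c \<in> carrier intdiff_alg"
  by (auto simp: intdiff_alg_def gen_subalg_def intro!: generate_ring.incl)

lemma intdiff_closed [intro]:
  assumes "f \<in> carrier intdiff_alg" "g \<in> carrier intdiff_alg"
  shows "f \<circ> g \<in> carrier intdiff_alg" "(\<lambda>p. f p + g p) \<in> carrier intdiff_alg"
  using ring.ring_simprules(5)[OF ring_intdiff_alg assms] ring.ring_simprules(1)[OF ring_intdiff_alg assms]
  by (simp_all add: comp_def)

lemma id_intdiff [simp]: "id \<in> carrier intdiff_alg"
proof -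
  have "id = pm_scale 1" by (auto simp: fun_eq_iff)
  then show ?thesis by (metis intdiff_gens(4))
qed

lemma op_H_intdiff [simp, intro]: "op_H i \<in> carrier intdiff_alg"
  unfolding op_H_def by (rule intdiff_closed) auto

section \<open>Symbols\<close>

definition orthant :: "'n set \<Rightarrow> ('n \<Rightarrow> int) set" where
  "orthant S = {\<alpha>. \<forall>i\<in>S. 0 \<le> \<alpha> i}"

text \<open>The natural parameters at which the model is compared with polynomials: zero on
  \<open>S\<close>, as \<nu> is there, and beyond \<open>N\<close> elsewhere, so that a fixed finite
  part of the orthant is shifted to nonnegative exponents once \<open>N\<close> is large.\<close>

definition test_point :: "'n set \<Rightarrow> nat \<Rightarrow> ('n \<Rightarrow> nat) \<Rightarrow> bool" where
  "test_point S N m \<longleftrightarrow> (\<forall>i. if i \<in> S then m i = 0 else N \<le> m i)"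

abbreviation dpow_at :: "('n \<Rightarrow> nat) \<Rightarrow> ('n \<Rightarrow> int) \<Rightarrow> ('n::finite, 'k::field_char_0) mpol" where
  "dpow_at m \<alpha> \<equiv> dpow (\<lambda>i. \<alpha> i + int (m i))"

text \<open>The model module with parameter \<open>\<nu>\<close> has a basis indexed by \<open>orthant S\<close> on which the generators
  act by weighted shifts, with weights polynomial in \<open>\<nu>\<close>. For \<open>\<nu>\<close> a vector of large natural numbers
  it is, near a given index, the module of polynomials itself, with \<open>\<alpha>\<close> standing for the divided
  power with exponent \<open>\<alpha> + \<nu>\<close>. Hence the operator on polynomials determines the action on the
  model for every \<open>\<nu>\<close> by polynomial extrapolation; \<open>h \<nu> \<alpha>\<close> is the image of the basis vector \<open>\<alpha>\<close>.\<close>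

definition symbol :: "'n set \<Rightarrow> ('n::finite, 'k::field_char_0) mpol_op \<Rightarrow>
    (('n \<Rightarrow> 'k) \<Rightarrow> ('n \<Rightarrow> int) \<Rightarrow> (('n \<Rightarrow> int) \<Rightarrow>\<^sub>0 'k)) \<Rightarrow> bool" where
  "symbol S b h \<longleftrightarrow> plin b \<and> (\<forall>\<alpha>\<in>orthant S.
     (\<exists>Q. finite Q \<and> Q \<subseteq> orthant S \<and> (\<forall>\<nu>. keys (h \<nu> \<alpha>) \<subseteq> Q)) \<and>
     (\<forall>\<gamma>. polyfun (\<lambda>\<nu>. lookup (h \<nu> \<alpha>) \<gamma>)) \<and>
     (\<exists>N. \<forall>m. test_point S N m \<longrightarrow>
        b (dpow_at m \<alpha>) =
        lin_ext (dpow_at m) (h (\<lambda>i. of_nat (m i)) \<alpha>)))"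

lemma symbolI:
  assumes "plin b"
    and "\<And>\<alpha>. \<alpha> \<in> orthant S \<Longrightarrow> \<exists>Q. finite Q \<and> Q \<subseteq> orthant S \<and> (\<forall>\<nu>. keys (h \<nu> \<alpha>) \<subseteq> Q)"
    and "\<And>\<alpha> \<gamma>. \<alpha> \<in> orthant S \<Longrightarrow> polyfun (\<lambda>\<nu>. lookup (h \<nu> \<alpha>) \<gamma>)"
    and "\<And>\<alpha>. \<alpha> \<in> orthant S \<Longrightarrow> \<exists>N. \<forall>m. test_point S N m \<longrightarrow>
        b (dpow_at m \<alpha>) =
        lin_ext (dpow_at m) (h (\<lambda>i. of_nat (m i)) \<alpha>)"
  shows "symbol S b h"
  using assms by (simp add: symbol_def)

lemma symbolE:
  assumes "symbol S b h" "\<alpha> \<in> orthant S"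
  obtains Q N where "finite Q" "Q \<subseteq> orthant S" "\<And>\<nu>. keys (h \<nu> \<alpha>) \<subseteq> Q"
    "\<And>m. test_point S N m \<Longrightarrow> b (dpow_at m \<alpha>) =
        lin_ext (dpow_at m) (h (\<lambda>i. of_nat (m i)) \<alpha>)"
  using assms by (fastforce simp: symbol_def)

lemma symbol_plin: "symbol S b h \<Longrightarrow> plin b"
  and symbol_polyfun: "symbol S b h \<Longrightarrow> \<alpha> \<in> orthant S \<Longrightarrow> polyfun (\<lambda>\<nu>. lookup (h \<nu> \<alpha>) \<gamma>)"
  by (simp_all add: symbol_def)

lemma symbol_keys: "symbol S b h \<Longrightarrow> \<alpha> \<in> orthant S \<Longrightarrow> keys (h \<nu> \<alpha>) \<subseteq> orthant S"
  by (meson symbolE subset_trans)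

lemma test_point_mono: "test_point S N m \<Longrightarrow> N' \<le> N \<Longrightarrow> test_point S N' m"
  by (auto simp: test_point_def split: if_splits)

lemma keys_lin_ext_subset:
  "(\<And>a. a \<in> keys p \<Longrightarrow> keys (g a) \<subseteq> Q) \<Longrightarrow> keys (lin_ext g p) \<subseteq> Q"
  using keys_lin_ext[of g p] by blast

lemma keys_diff_subset: "keys (p - q) \<subseteq> keys p \<union> keys (q :: _ \<Rightarrow>\<^sub>0 'k::field)"
  by (auto simp: in_keys_iff lookup_minus)

lemma symbol_add:
  assumes "symbol S b h" "symbol S b' h'"
  shows "symbol S (\<lambda>p. b p + b' p) (\<lambda>\<nu> \<alpha>. h \<nu> \<alpha> + h' \<nu> \<alpha>)"
proof (rule symbolI)
  show "plin (\<lambda>p. b p + b' p)"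
    using assms[THEN symbol_plin] by (auto intro!: plinI simp: plin_add plin_scale PM.scale_right_distrib)
  fix \<alpha> assume a: "\<alpha> \<in> orthant S"
  obtain Q N where Q: "finite Q" "Q \<subseteq> orthant S" "\<And>\<nu>. keys (h \<nu> \<alpha>) \<subseteq> Q"
    "\<And>m. test_point S N m \<Longrightarrow> b (dpow_at m \<alpha>) =
        lin_ext (dpow_at m) (h (\<lambda>i. of_nat (m i)) \<alpha>)"
    by (rule symbolE[OF assms(1) a]) (rule that)
  obtain Q' N' where Q': "finite Q'" "Q' \<subseteq> orthant S" "\<And>\<nu>. keys (h' \<nu> \<alpha>) \<subseteq> Q'"
    "\<And>m. test_point S N' m \<Longrightarrow> b' (dpow_at m \<alpha>) =
        lin_ext (dpow_at m) (h' (\<lambda>i. of_nat (m i)) \<alpha>)"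
    by (rule symbolE[OF assms(2) a]) (rule that)
  have "keys (h \<nu> \<alpha> + h' \<nu> \<alpha>) \<subseteq> Q \<union> Q'" for \<nu>
    using Q(3)[of \<nu>] Q'(3)[of \<nu>] keys_add[of "h \<nu> \<alpha>" "h' \<nu> \<alpha>"] by blast
  with Q Q' show "\<exists>Q. finite Q \<and> Q \<subseteq> orthant S \<and> (\<forall>\<nu>. keys (h \<nu> \<alpha> + h' \<nu> \<alpha>) \<subseteq> Q)"
    by (intro exI[of _ "Q \<union> Q'"]) auto
  show "polyfun (\<lambda>\<nu>. lookup (h \<nu> \<alpha> + h' \<nu> \<alpha>) \<gamma>)" for \<gamma>
    unfolding lookup_add by (intro polyfun.add symbol_polyfun[OF assms(1) a] symbol_polyfun[OF assms(2) a])
  show "\<exists>N. \<forall>m. test_point S N m \<longrightarrow> b (dpow_at m \<alpha>) + b' (dpow_at m \<alpha>) =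
        lin_ext (dpow_at m) (h (\<lambda>i. of_nat (m i)) \<alpha> + h' (\<lambda>i. of_nat (m i)) \<alpha>)"
    by (intro exI[of _ "max N N'"] allI impI)
       (simp add: Q(4)[OF test_point_mono] Q'(4)[OF test_point_mono] lin_ext_add)
qed

text \<open>The support bound \<open>Q'\<close> of the inner symbol does not depend on \<nu>. So the
  composite is one finite sum over \<open>Q'\<close> for all \<nu>, which makes its coefficients
  polynomial, and the finitely many thresholds of the outer symbol on \<open>Q'\<close> have a
  maximum.\<close>

lemma symbol_comp:
  assumes "symbol S b h" "symbol S b' h'"
  shows "symbol S (b \<circ> b') (\<lambda>\<nu> \<alpha>. lin_ext (h \<nu>) (h' \<nu> \<alpha>))"
proof (rule symbolI)
  note pl = assms[THEN symbol_plin]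
  show "plin (b \<circ> b')"
    using pl by (auto intro!: plinI simp: plin_add plin_scale)
  fix \<alpha> assume a: "\<alpha> \<in> orthant S"
  obtain Q' N' where Q': "finite Q'" "Q' \<subseteq> orthant S" "\<And>\<nu>. keys (h' \<nu> \<alpha>) \<subseteq> Q'"
    "\<And>m. test_point S N' m \<Longrightarrow> b' (dpow_at m \<alpha>) =
        lin_ext (dpow_at m) (h' (\<lambda>i. of_nat (m i)) \<alpha>)"
    by (rule symbolE[OF assms(2) a]) (rule that)
  define P where "P \<beta> QN \<longleftrightarrow> finite (fst QN) \<and> fst QN \<subseteq> orthant S \<and> (\<forall>\<nu>. keys (h \<nu> \<beta>) \<subseteq> fst QN) \<and>
    (\<forall>m. test_point S (snd QN) m \<longrightarrow> b (dpow_at m \<beta>) =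
        lin_ext (dpow_at m) (h (\<lambda>i. of_nat (m i)) \<beta>))" for \<beta> QN
  have "\<forall>\<beta>\<in>Q'. \<exists>QN. P \<beta> QN"
  proof
    fix \<beta> assume "\<beta> \<in> Q'"
    then have "\<beta> \<in> orthant S" using Q'(2) by blast
    then show "\<exists>QN. P \<beta> QN"
    proof (rule symbolE[OF assms(1)])
      fix Q N
      assume "finite Q" "Q \<subseteq> orthant S" "\<And>\<nu>. keys (h \<nu> \<beta>) \<subseteq> Q"
        "\<And>m. test_point S N m \<Longrightarrow> b (dpow_at m \<beta>) =
          lin_ext (dpow_at m) (h (\<lambda>i. of_nat (m i)) \<beta>)"
      then show ?thesis by (intro exI[of _ "(Q, N)"]) (simp add: P_def)
    qed
  qed
  then obtain QN where QN: "\<forall>\<beta>\<in>Q'. P \<beta> (QN \<beta>)" using bchoice by metis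
  define Q where "Q = fst \<circ> QN"
  define N where "N = snd \<circ> QN"
  have Q: "\<And>\<beta>. \<beta> \<in> Q' \<Longrightarrow> finite (Q \<beta>)" "\<And>\<beta>. \<beta> \<in> Q' \<Longrightarrow> Q \<beta> \<subseteq> orthant S"
    "\<And>\<beta> \<nu>. \<beta> \<in> Q' \<Longrightarrow> keys (h \<nu> \<beta>) \<subseteq> Q \<beta>"
    "\<And>\<beta> m. \<beta> \<in> Q' \<Longrightarrow> test_point S (N \<beta>) m \<Longrightarrow> b (dpow_at m \<beta>) =
        lin_ext (dpow_at m) (h (\<lambda>i. of_nat (m i)) \<beta>)"
    using QN by (simp_all add: P_def Q_def N_def)
  have "keys (lin_ext (h \<nu>) (h' \<nu> \<alpha>)) \<subseteq> (\<Union>\<beta>\<in>Q'. Q \<beta>)" for \<nu>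
    using Q(3)[of _ \<nu>] Q'(3)[of \<nu>] by (intro keys_lin_ext_subset) blast
  then show "\<exists>Q. finite Q \<and> Q \<subseteq> orthant S \<and> (\<forall>\<nu>. keys (lin_ext (h \<nu>) (h' \<nu> \<alpha>)) \<subseteq> Q)"
    using Q(1,2) Q'(1) by (intro exI[of _ "\<Union>\<beta>\<in>Q'. Q \<beta>"] conjI UN_least finite_UN_I allI) auto
  have e: "lin_ext (h \<nu>) (h' \<nu> \<alpha>) = (\<Sum>\<beta>\<in>Q'. pm_scale (lookup (h' \<nu> \<alpha>) \<beta>) (h \<nu> \<beta>))" for \<nu>
    by (rule lin_ext_superset[OF Q'(1,3)])
  have "polyfun (\<lambda>\<nu>. \<Sum>\<beta>\<in>Q'. lookup (h' \<nu> \<alpha>) \<beta> * lookup (h \<nu> \<beta>) \<gamma>)" for \<gamma>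
    using Q'(2) by (intro polyfun_sum polyfun.mult symbol_polyfun[OF assms(1)] symbol_polyfun[OF assms(2) a]) auto
  then show "polyfun (\<lambda>\<nu>. lookup (lin_ext (h \<nu>) (h' \<nu> \<alpha>)) \<gamma>)" for \<gamma>
    by (simp add: e lookup_sum)
  define M where "M = Max (insert N' (N ` Q'))"
  have M: "N' \<le> M" "\<And>\<beta>. \<beta> \<in> Q' \<Longrightarrow> N \<beta> \<le> M"
    using Q'(1) by (simp_all add: M_def)
  show "\<exists>N. \<forall>m. test_point S N m \<longrightarrow> (b \<circ> b') (dpow_at m \<alpha>) =
        lin_ext (dpow_at m) (lin_ext (h (\<lambda>i. of_nat (m i))) (h' (\<lambda>i. of_nat (m i)) \<alpha>))"
  proof (intro exI allI impI)
    fix m assume m: "test_point S M m"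
    let ?\<nu> = "\<lambda>i. of_nat (m i)"
    have "(b \<circ> b') (dpow_at m \<alpha>) = lin_ext (\<lambda>\<gamma>. b (dpow_at m \<gamma>)) (h' ?\<nu> \<alpha>)"
      using Q'(4)[OF test_point_mono[OF m M(1)]] by (simp add: plin_lin_ext_comp[OF pl(1)])
    also have "\<dots> = lin_ext (\<lambda>\<gamma>. lin_ext (dpow_at m) (h ?\<nu> \<gamma>)) (h' ?\<nu> \<alpha>)"
    proof (rule lin_ext_cong)
      fix \<beta> assume "\<beta> \<in> keys (h' ?\<nu> \<alpha>)"
      then have "\<beta> \<in> Q'" using Q'(3) by blast
      then show "b (dpow_at m \<beta>) = lin_ext (dpow_at m) (h ?\<nu> \<beta>)"
        using Q(4) test_point_mono[OF m M(2)] by blast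
    qed
    finally show "(b \<circ> b') (dpow_at m \<alpha>) =
        lin_ext (dpow_at m) (lin_ext (h ?\<nu>) (h' ?\<nu> \<alpha>))"
      by (simp add: plin_lin_ext_comp[OF plin_lin_ext])
  qed
qed

text \<open>The alternative in the second hypothesis is for lowering operators: the target index may
  leave the orthant when the coefficient is identically zero.\<close>

lemma symbol_single:
  assumes "plin b"
    and "\<And>\<alpha>. \<alpha> \<in> orthant S \<Longrightarrow> (\<forall>\<nu>. f \<nu> \<alpha> = 0) \<or> g \<alpha> \<in> orthant S"
    and "\<And>\<alpha>. \<alpha> \<in> orthant S \<Longrightarrow> polyfun (\<lambda>\<nu>. f \<nu> \<alpha>)"
    and "\<And>\<alpha>. \<alpha> \<in> orthant S \<Longrightarrow> \<exists>N. \<forall>m. test_point S N m \<longrightarrow> b (dpow_at m \<alpha>) =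
      pm_scale (f (\<lambda>i. of_nat (m i)) \<alpha>) (dpow (\<lambda>i. g \<alpha> i + int (m i)))"
  shows "symbol S b (\<lambda>\<nu> \<alpha>. single (g \<alpha>) (f \<nu> \<alpha>))"
proof (rule symbolI)
  fix \<alpha> assume a: "\<alpha> \<in> orthant S"
  show "\<exists>Q. finite Q \<and> Q \<subseteq> orthant S \<and> (\<forall>\<nu>. keys (single (g \<alpha>) (f \<nu> \<alpha>)) \<subseteq> Q)"
    using assms(2)[OF a]
  proof
    assume "g \<alpha> \<in> orthant S"
    then show ?thesis by (intro exI[of _ "{g \<alpha>}"]) auto
  qed (intro exI[of _ "{}"], auto)
  show "polyfun (\<lambda>\<nu>. lookup (single (g \<alpha>) (f \<nu> \<alpha>)) \<gamma>)" for \<gamma>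
    using assms(3)[OF a] polyfun.const[of 0] by (cases "\<gamma> = g \<alpha>") (simp_all add: lookup_single when_def)
qed (use assms in simp_all)

lemma symbol_scale: "symbol S (pm_scale c) (\<lambda>\<nu> \<alpha>. single \<alpha> c)"
  by (rule symbol_single) (auto simp: linear_scale intro: polyfun.const)

lemma symbol_x: "symbol S (op_x i) (\<lambda>\<nu> \<alpha>. single (\<alpha>(i := \<alpha> i + 1)) (\<nu> i + of_int (\<alpha> i + 1)))"
proof (rule symbol_single)
  fix \<alpha>
  show "polyfun (\<lambda>\<nu>. \<nu> i + of_int (\<alpha> i + 1))"
    by (rule polyfun.add[OF polyfun.coord polyfun.const])
  have "(\<lambda>j. \<alpha> j + int (m j))(i := \<alpha> i + int (m i) + 1) = (\<lambda>j. (\<alpha>(i := \<alpha> i + 1)) j + int (m j))" for m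
    by auto
  then show "\<exists>N. \<forall>m. test_point S N m \<longrightarrow> op_x i (dpow_at m \<alpha>) =
      pm_scale (of_nat (m i) + of_int (\<alpha> i + 1)) (dpow (\<lambda>j. (\<alpha>(i := \<alpha> i + 1)) j + int (m j)))"
    by (simp add: op_x_dpow algebra_simps)
qed (auto simp: plin_op_x orthant_def)

lemma symbol_int: "symbol S (op_int i) (\<lambda>\<nu> \<alpha>. single (\<alpha>(i := \<alpha> i + 1)) 1)"
proof (rule symbol_single)
  fix \<alpha> assume a: "\<alpha> \<in> orthant S"
  \<comment> \<open>The threshold \<open>nat (- \<alpha> i)\<close> makes the exponent of x_i
    nonnegative if i is outside \<open>S\<close>; for i in \<open>S\<close> the orthant already
    does. This is what \<open>op_int_dpow\<close> requires.\<close>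
  have "op_int i (dpow_at m \<alpha>) = pm_scale 1 (dpow (\<lambda>j. (\<alpha>(i := \<alpha> i + 1)) j + int (m j)))"
    if "test_point S (nat (- \<alpha> i)) m" for m
  proof -
    have "0 \<le> \<alpha> i + int (m i)"
      using that a by (auto simp: test_point_def orthant_def split: if_splits elim!: allE[of _ i])
    moreover have "(\<lambda>j. \<alpha> j + int (m j))(i := \<alpha> i + int (m i) + 1) = (\<lambda>j. (\<alpha>(i := \<alpha> i + 1)) j + int (m j))"
      by auto
    ultimately show ?thesis by (simp add: op_int_dpow)
  qed
  then show "\<exists>N. \<forall>m. test_point S N m \<longrightarrow> op_int i (dpow_at m \<alpha>) =
      pm_scale 1 (dpow (\<lambda>j. (\<alpha>(i := \<alpha> i + 1)) j + int (m j)))"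
    by blast
qed (auto simp: plin_op_int orthant_def intro: polyfun.const)

text \<open>Only the step down from \<open>\<alpha> i = 0\<close> with i in \<open>S\<close> leaves
  the orthant. There the test point has \<open>m i = 0\<close>, so the exponent becomes -1 and the
  divided power is zero, in agreement with the coefficient 0.\<close>

lemma symbol_d:
  fixes S :: "'n::finite set"
  shows "symbol S (op_d i :: ('n, 'k::field_char_0) mpol_op)
     (\<lambda>\<nu> \<alpha>. single (\<alpha>(i := \<alpha> i - 1)) (if \<alpha>(i := \<alpha> i - 1) \<in> orthant S then 1 else 0))"
proof (rule symbol_single)
  fix \<alpha> assume a: "\<alpha> \<in> orthant S"
  have "op_d i (dpow_at m \<alpha> :: ('n, 'k) mpol) =
      pm_scale (if \<alpha>(i := \<alpha> i - 1) \<in> orthant S then 1 else 0) (dpow (\<lambda>j. (\<alpha>(i := \<alpha> i - 1)) j + int (m j)))"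
    if "test_point S 0 m" for m
  proof -
    have "(\<lambda>j. \<alpha> j + int (m j))(i := \<alpha> i + int (m i) - 1) = (\<lambda>j. (\<alpha>(i := \<alpha> i - 1)) j + int (m j))"
      by auto
    moreover have "dpow (\<lambda>j. (\<alpha>(i := \<alpha> i - 1)) j + int (m j)) = (0 :: ('n, 'k) mpol)" if "\<alpha>(i := \<alpha> i - 1) \<notin> orthant S"
    proof (rule dpow_neg[of _ i])
      show "(\<alpha>(i := \<alpha> i - 1)) i + int (m i) < 0"
        using that a \<open>test_point S 0 m\<close> by (auto simp: test_point_def orthant_def split: if_splits elim!: allE[of _ i])
    qed
    ultimately show ?thesis by (simp add: op_d_dpow del: fun_upd_apply)
  qed
  then show "\<exists>N. \<forall>m. test_point S N m \<longrightarrow> op_d i (dpow_at m \<alpha> :: ('n, 'k) mpol) =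
      pm_scale (if \<alpha>(i := \<alpha> i - 1) \<in> orthant S then 1 else 0) (dpow (\<lambda>j. (\<alpha>(i := \<alpha> i - 1)) j + int (m j)))"
    by (intro exI[of _ 0] allI impI)
qed (simp_all add: plin_op_d polyfun.const)

lemma symbol_exists:
  assumes "b \<in> carrier intdiff_alg"
  shows "\<exists>h. symbol S b h"
  using assms
proof (induction rule: intdiff_induct)
  case (x i)
  show ?case using symbol_x by blast
next
  case (d i)
  show ?case using symbol_d by blast
next
  case (int i)
  show ?case using symbol_int by blast
next
  case (scale c)
  show ?case using symbol_scale by blast
next
  case (add f g)
  then show ?case using symbol_add by blast
next
  case (comp f g)
  then show ?case using symbol_comp by blast
qed

text \<open>On nonnegative exponents \<open>nat\<close> is injective, so distinct indices give
  distinct monomials and each coefficient can be read off at its own monomial.\<close>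

lemma dpow_independent:
  fixes p :: "('n::finite \<Rightarrow> int) \<Rightarrow>\<^sub>0 'k::field_char_0"
  assumes "lin_ext (dpow_at m) p = 0"
    and nn: "\<And>\<gamma> i. \<gamma> \<in> keys p \<Longrightarrow> 0 \<le> \<gamma> i + int (m i)"
  shows "p = 0"
proof (rule ccontr)
  assume "p \<noteq> 0"
  then obtain \<delta> where d: "\<delta> \<in> keys p" by (auto simp: poly_mapping_eq_iff fun_eq_iff in_keys_iff)
  let ?e = "\<lambda>\<gamma>. Abs_poly_mapping (\<lambda>i. nat (\<gamma> i + int (m i)))"
  let ?c = "1 / (\<Prod>i\<in>UNIV. fact (nat (\<delta> i + int (m i)))) :: 'k"
  have "lookup (dpow_at m \<gamma>) (?e \<delta>) = (if \<delta> = \<gamma> then ?c else 0)"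
    if "\<gamma> \<in> keys p" for \<gamma>
  proof (cases "\<gamma> = \<delta>")
    case False
    then obtain i where "\<gamma> i \<noteq> \<delta> i" by auto
    then have "nat (\<gamma> i + int (m i)) \<noteq> nat (\<delta> i + int (m i))"
      using nn[OF that, of i] nn[OF d, of i] by simp
    then have "lookup (?e \<gamma>) i \<noteq> lookup (?e \<delta>) i"
      by simp
    then have "?e \<gamma> \<noteq> ?e \<delta>"
      by metis
    then show ?thesis using False nn[OF that] by (simp add: dpow_nonneg lookup_single_not_eq)
  qed (use nn[OF d] in \<open>simp add: dpow_nonneg\<close>)
  then have "lookup (lin_ext (dpow_at m) p) (?e \<delta>) =
      (\<Sum>\<gamma>\<in>keys p. if \<delta> = \<gamma> then lookup p \<gamma> * ?c else 0)"
    unfolding lookup_lin_ext by (intro sum.cong) auto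
  also have "\<dots> = lookup p \<delta> * ?c"
    using d by simp
  finally show False
    using assms(1) d by (simp add: in_keys_iff)
qed

text \<open>At test points beyond all thresholds both symbols expand the same polynomial in
  independent divided powers, so they agree there; polynomiality carries this to every \<nu> that
  vanishes on \<open>S\<close>. Consequently an operator, however it is written, acts on a model in
  one way.\<close>

lemma symbol_unique:
  fixes b :: "('n::finite, 'k::field_char_0) mpol_op"
  assumes "symbol S b h" "symbol S b h'" "\<alpha> \<in> orthant S" "\<forall>i\<in>S. \<nu> i = 0"
  shows "h \<nu> \<alpha> = h' \<nu> \<alpha>"
proof (rule poly_mapping_eqI)
  fix \<gamma>
  obtain Q N where Q: "finite Q" "Q \<subseteq> orthant S" "\<And>\<nu>. keys (h \<nu> \<alpha>) \<subseteq> Q"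
    "\<And>m. test_point S N m \<Longrightarrow> b (dpow_at m \<alpha>) =
        lin_ext (dpow_at m) (h (\<lambda>i. of_nat (m i)) \<alpha>)"
    by (rule symbolE[OF assms(1,3)]) (rule that)
  obtain Q' N' where Q': "finite Q'" "Q' \<subseteq> orthant S" "\<And>\<nu>. keys (h' \<nu> \<alpha>) \<subseteq> Q'"
    "\<And>m. test_point S N' m \<Longrightarrow> b (dpow_at m \<alpha>) =
        lin_ext (dpow_at m) (h' (\<lambda>i. of_nat (m i)) \<alpha>)"
    by (rule symbolE[OF assms(2,3)]) (rule that)
  \<comment> \<open>\<open>B\<close> bounds the negative parts of all coordinates of the indices in
    both supports; a threshold of at least \<open>B\<close> makes every exponent nonnegative, as
    \<open>dpow_independent\<close> requires.\<close>
  have "\<exists>B. \<forall>\<gamma>\<in>Q \<union> Q'. \<forall>i. nat (- \<gamma> i) \<le> B"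
  proof -
    have "finite ((\<lambda>(\<gamma>, i). nat (- \<gamma> i)) ` ((Q \<union> Q') \<times> UNIV))" using Q(1) Q'(1) by simp
    then show ?thesis by (intro exI[of _ "Max ((\<lambda>(\<gamma>, i). nat (- \<gamma> i)) ` ((Q \<union> Q') \<times> UNIV))"]) (auto intro!: Max_ge)
  qed
  then obtain B where B: "\<And>\<gamma> i. \<gamma> \<in> Q \<union> Q' \<Longrightarrow> nat (- \<gamma> i) \<le> B" by blast
  define M where "M = Max {N, N', B}"
  have M: "N \<le> M" "N' \<le> M" "B \<le> M" by (simp_all add: M_def)
  have eq: "h (\<lambda>i. of_nat (m i)) \<alpha> = h' (\<lambda>i. of_nat (m i)) \<alpha>" if m: "test_point S M m" for m
  proof -
    let ?p = "h (\<lambda>i. of_nat (m i)) \<alpha> - h' (\<lambda>i. of_nat (m i)) \<alpha>"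
    have "lin_ext (dpow_at m) ?p = (0 :: ('n, 'k) mpol)"
      by (simp only: lin_ext_diff Q(4)[OF test_point_mono[OF m M(1)], symmetric]
          Q'(4)[OF test_point_mono[OF m M(2)], symmetric] diff_self)
    moreover have "0 \<le> \<gamma> i + int (m i)" if "\<gamma> \<in> keys ?p" for \<gamma> i
    proof -
      have g: "\<gamma> \<in> Q \<union> Q'" using subsetD[OF keys_diff_subset that] Q(3) Q'(3) by blast
      show ?thesis
      proof (cases "i \<in> S")
        case True
        then show ?thesis using g Q(2) Q'(2) by (auto simp: orthant_def)
      next
        case False
        then have "M \<le> m i" using m by (auto simp: test_point_def)
        then show ?thesis using B[OF g, of i] M(3) by linarith
      qed
    qed
    ultimately have "?p = 0" by (rule dpow_independent)
    then show ?thesis by simp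
  qed
  let ?f = "\<lambda>\<nu>. lookup (h \<nu> \<alpha>) \<gamma> - lookup (h' \<nu> \<alpha>) \<gamma>"
  \<comment> \<open>Only the coordinates outside \<open>S\<close> are extrapolated, since the test
    points and \<nu> are both zero on \<open>S\<close>.\<close>
  have "?f \<nu> = 0"
  proof (rule polyfun_eq_zero[where f = ?f and U = "- S" and N = M and w = \<nu>])
    show "polyfun ?f"
      by (intro polyfun_diff symbol_polyfun[OF assms(1,3)] symbol_polyfun[OF assms(2,3)])
    fix z :: "'n \<Rightarrow> 'k"
    assume z: "\<And>i. i \<in> - S \<Longrightarrow> z i \<in> of_nat ` {M..}" "\<And>i. i \<notin> - S \<Longrightarrow> z i = \<nu> i"
    have "\<exists>k. z i = of_nat k \<and> (if i \<in> S then k = 0 else M \<le> k)" for i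
    proof (cases "i \<in> S")
      case True
      then show ?thesis using z(2)[of i] assms(4) by (intro exI[of _ 0]) auto
    next
      case False
      then show ?thesis using z(1)[of i] by auto
    qed
    then obtain m where "\<forall>i. z i = of_nat (m i) \<and> (if i \<in> S then m i = 0 else M \<le> m i)"
      using choice[of "\<lambda>i k. z i = of_nat k \<and> (if i \<in> S then k = 0 else M \<le> k)"] by blast
    then have m: "\<And>i. z i = of_nat (m i)" "test_point S M m"
      by (simp_all add: test_point_def)
    have "z = (\<lambda>i. of_nat (m i))" using m(1) by auto
    then show "?f z = 0" using eq[OF m(2)] by simp
  qed simp
  then show "lookup (h \<nu> \<alpha>) \<gamma> = lookup (h' \<nu> \<alpha>) \<gamma>" by simp
qed

section \<open>The model modules\<close>

text \<open>The choice of a symbol is harmless: by \<open>symbol_unique\<close> two symbols agree on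
  the orthant as soon as \<nu> vanishes on \<open>S\<close>.\<close>

definition rep :: "'n set \<Rightarrow> ('n \<Rightarrow> 'k) \<Rightarrow> ('n::finite, 'k::field_char_0) mpol_op \<Rightarrow>
    (('n \<Rightarrow> int) \<Rightarrow>\<^sub>0 'k) \<Rightarrow> (('n \<Rightarrow> int) \<Rightarrow>\<^sub>0 'k)" where
  "rep S \<nu> b = lin_ext ((SOME h. symbol S b h) \<nu>)"

definition std_module :: "'n set \<Rightarrow> ('n \<Rightarrow> 'k) \<Rightarrow>
    (('n::finite, 'k::field_char_0) mpol_op, ('n \<Rightarrow> int) \<Rightarrow>\<^sub>0 'k) module" where
  "std_module S \<nu> = \<lparr> carrier = {p. keys p \<subseteq> orthant S}, monoid.mult = undefined,
     monoid.one = undefined, ring.zero = 0, ring.add = (+), module.smult = rep S \<nu> \<rparr>"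

lemma std_module_simps [simp]:
  "carrier (std_module S \<nu>) = {p. keys p \<subseteq> orthant S}"
  "ring.zero (std_module S \<nu>) = 0" "ring.add (std_module S \<nu>) = (+)" "module.smult (std_module S \<nu>) = rep S \<nu>"
  by (simp_all add: std_module_def)

lemma plin_rep: "plin (rep S \<nu> b)"
  by (simp add: rep_def plin_lin_ext)

text \<open>Lets every later computation in a model use whichever symbol is at hand.\<close>

lemma rep_symbol:
  assumes "symbol S b h" "\<forall>i\<in>S. \<nu> i = 0" "keys p \<subseteq> orthant S"
  shows "rep S \<nu> b p = lin_ext (h \<nu>) p"
  unfolding rep_def
  using assms symbol_unique[OF someI[of "symbol S b", OF assms(1)] assms(1)]
  by (intro lin_ext_cong) auto

lemma rep_keys:
  assumes "b \<in> carrier intdiff_alg" "keys p \<subseteq> orthant S"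
  shows "keys (rep S \<nu> b p) \<subseteq> orthant S"
  unfolding rep_def
  using symbol_keys[OF someI_ex[OF symbol_exists[OF assms(1)]]] assms(2)
  by (intro keys_lin_ext_subset) blast

context
  fixes S :: "'n::finite set" and \<nu> :: "'n \<Rightarrow> 'k::field_char_0" and p :: "('n \<Rightarrow> int) \<Rightarrow>\<^sub>0 'k"
  assumes nu: "\<forall>i\<in>S. \<nu> i = 0" and p: "keys p \<subseteq> orthant S"
begin

lemma rep_scale: "rep S \<nu> (pm_scale c) p = pm_scale c p"
  using rep_symbol[OF symbol_scale[of S c] nu p] plin_eq_lin_ext[OF linear_scale, of c p]
  by (simp add: pm_scale_single)

lemma rep_id: "rep S \<nu> id p = p"
proof -
  have "id = (pm_scale 1 :: ('n, 'k) mpol_op)" by (auto simp: fun_eq_iff)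
  then show ?thesis using rep_scale[of 1] by simp
qed

lemma rep_add:
  assumes "f \<in> carrier intdiff_alg" "g \<in> carrier intdiff_alg"
  shows "rep S \<nu> (\<lambda>q. f q + g q) p = rep S \<nu> f p + rep S \<nu> g p"
proof -
  obtain h h' where h: "symbol S f h" "symbol S g h'"
    using symbol_exists[of _ S] assms by metis
  show ?thesis
    using rep_symbol[OF symbol_add[OF h] nu p] rep_symbol[OF h(1) nu p] rep_symbol[OF h(2) nu p]
    by (simp add: lin_ext_fun_add)
qed

text \<open>\<open>symbol_comp\<close> makes a symbol of the composite from chosen symbols of the
  factors, and by \<open>rep_symbol\<close> it computes the action. This takes the place of
  verifying defining relations.\<close>

lemma rep_comp:
  assumes "f \<in> carrier intdiff_alg" "g \<in> carrier intdiff_alg"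
  shows "rep S \<nu> (f \<circ> g) p = rep S \<nu> f (rep S \<nu> g p)"
proof -
  obtain h h' where h: "symbol S f h" "symbol S g h'"
    using symbol_exists[of _ S] assms by metis
  show ?thesis
    using rep_symbol[OF symbol_comp[OF h] nu p] rep_symbol[OF h(2) nu p]
      rep_symbol[OF h(1) nu rep_keys[OF assms(2) p, of \<nu>]]
    by (simp add: plin_lin_ext_comp[OF plin_lin_ext])
qed

end

lemma left_module_std:
  assumes nu: "\<forall>i\<in>S. \<nu> i = 0"
  shows "left_module intdiff_alg (std_module S \<nu>)"
proof -
  have ag: "abelian_group (std_module S \<nu>)"
  proof (rule abelian_groupI)
    fix p assume "p \<in> carrier (std_module S \<nu>)"
    then show "\<exists>q\<in>carrier (std_module S \<nu>). q \<oplus>\<^bsub>std_module S \<nu>\<^esub> p = \<zero>\<^bsub>std_module S \<nu>\<^esub>"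
      by (intro bexI[of _ "- p"]) (auto simp: in_keys_iff)
  qed (use keys_add in \<open>fastforce simp: algebra_simps\<close>)+
  show ?thesis
    by (intro left_module.intro ring_intdiff_alg ag left_module_axioms.intro)
       (use nu in \<open>simp_all add: rep_keys rep_add rep_comp rep_id plin_add[OF plin_rep]\<close>)
qed

section \<open>Isomorphisms of left modules\<close>

text \<open>Unlike \<open>module_isomorphic\<close>, this names the map, so that it can be inverted,
  composed and used to carry subspaces across.\<close>

definition mod_iso :: "('r, 'c) ring_scheme \<Rightarrow> ('r, 'm, 'd) module_scheme \<Rightarrow> ('r, 'l, 'e) module_scheme \<Rightarrow>
    ('m \<Rightarrow> 'l) \<Rightarrow> bool" where
  "mod_iso R M N f \<longleftrightarrow> bij_betw f (carrier M) (carrier N) \<and>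
     (\<forall>x\<in>carrier M. \<forall>y\<in>carrier M. f (x \<oplus>\<^bsub>M\<^esub> y) = f x \<oplus>\<^bsub>N\<^esub> f y) \<and>
     (\<forall>a\<in>carrier R. \<forall>x\<in>carrier M. f (a \<odot>\<^bsub>M\<^esub> x) = a \<odot>\<^bsub>N\<^esub> f x)"

lemma module_isomorphic_iff: "module_isomorphic R M N \<longleftrightarrow> (\<exists>f. mod_iso R M N f)"
proof -
  have "mod_iso R M N f \<longleftrightarrow> f \<in> iso (add_monoid M) (add_monoid N) \<and>
      (\<forall>a\<in>carrier R. \<forall>x\<in>carrier M. f (a \<odot>\<^bsub>M\<^esub> x) = a \<odot>\<^bsub>N\<^esub> f x)" for f
    by (auto simp: mod_iso_def iso_def hom_def bij_betw_def)
  then show ?thesis by (simp only: module_isomorphic_def Bex_def)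
qed

lemma mod_isoI:
  assumes "bij_betw f (carrier M) (carrier N)"
    and "\<And>x y. x \<in> carrier M \<Longrightarrow> y \<in> carrier M \<Longrightarrow> f (x \<oplus>\<^bsub>M\<^esub> y) = f x \<oplus>\<^bsub>N\<^esub> f y"
    and "\<And>a x. a \<in> carrier R \<Longrightarrow> x \<in> carrier M \<Longrightarrow> f (a \<odot>\<^bsub>M\<^esub> x) = a \<odot>\<^bsub>N\<^esub> f x"
  shows "mod_iso R M N f"
  using assms by (simp add: mod_iso_def)

lemma mod_isoD:
  assumes "mod_iso R M N f"
  shows "bij_betw f (carrier M) (carrier N)"
    and "\<And>x y. x \<in> carrier M \<Longrightarrow> y \<in> carrier M \<Longrightarrow> f (x \<oplus>\<^bsub>M\<^esub> y) = f x \<oplus>\<^bsub>N\<^esub> f y"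
    and "\<And>a x. a \<in> carrier R \<Longrightarrow> x \<in> carrier M \<Longrightarrow> f (a \<odot>\<^bsub>M\<^esub> x) = a \<odot>\<^bsub>N\<^esub> f x"
    and "\<And>x. x \<in> carrier M \<Longrightarrow> f x \<in> carrier N"
  using assms by (auto simp: mod_iso_def bij_betw_def)

section \<open>Arithmetic and submodules of a left module\<close>

context left_module
begin

lemma smult_r_null: "a \<in> carrier R \<Longrightarrow> a \<odot>\<^bsub>M\<^esub> \<zero>\<^bsub>M\<^esub> = \<zero>\<^bsub>M\<^esub>"
  using smult_r_distr[of a "\<zero>\<^bsub>M\<^esub>" "\<zero>\<^bsub>M\<^esub>"] smult_closed[of a "\<zero>\<^bsub>M\<^esub>"]
  by (metis M.add.l_cancel_one' M.l_zero M.zero_closed)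

lemma smult_l_null: "x \<in> carrier M \<Longrightarrow> \<zero> \<odot>\<^bsub>M\<^esub> x = \<zero>\<^bsub>M\<^esub>"
  using smult_l_distr[of \<zero> \<zero> x] smult_closed[of \<zero> x]
  by (metis M.add.l_cancel_one' R.l_zero R.zero_closed)

lemma smult_r_minus: "a \<in> carrier R \<Longrightarrow> x \<in> carrier M \<Longrightarrow> a \<odot>\<^bsub>M\<^esub> (\<ominus>\<^bsub>M\<^esub> x) = \<ominus>\<^bsub>M\<^esub> (a \<odot>\<^bsub>M\<^esub> x)"
  using smult_r_distr[of a "\<ominus>\<^bsub>M\<^esub> x" x] smult_closed[of a x] smult_closed[of a "\<ominus>\<^bsub>M\<^esub> x"] smult_r_null[of a]
  by (metis M.a_inv_closed M.l_neg M.minus_equality)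

lemma smult_l_minus_one: "x \<in> carrier M \<Longrightarrow> (\<ominus> \<one>) \<odot>\<^bsub>M\<^esub> x = \<ominus>\<^bsub>M\<^esub> x"
  using smult_l_distr[of "\<ominus> \<one>" \<one> x] smult_closed[of "\<ominus> \<one>" x] smult_one[of x] smult_l_null[of x]
  by (metis M.minus_equality R.a_inv_closed R.l_neg R.one_closed)

lemma smult_finsum:
  assumes "a \<in> carrier R" "g \<in> A \<rightarrow> carrier M"
  shows "a \<odot>\<^bsub>M\<^esub> finsum M g A = finsum M (\<lambda>i. a \<odot>\<^bsub>M\<^esub> g i) A"
  using assms(2)
proof (induction A rule: infinite_finite_induct)
  case (insert i A)
  then have "g \<in> A \<rightarrow> carrier M" "g i \<in> carrier M" by auto
  moreover then have "(\<lambda>i. a \<odot>\<^bsub>M\<^esub> g i) \<in> A \<rightarrow> carrier M" using assms(1) by (auto intro!: smult_closed)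
  ultimately show ?case
    using insert assms(1) by (simp add: smult_r_distr smult_closed M.finsum_closed)
qed (simp_all add: smult_r_null assms(1))

text \<open>Closure under negation is implied, because the negative of x is obtained by acting with
  the negative of 1.\<close>

lemma submodule_iff:
  "submodule N R M \<longleftrightarrow> N \<subseteq> carrier M \<and> \<zero>\<^bsub>M\<^esub> \<in> N \<and> (\<forall>x\<in>N. \<forall>y\<in>N. x \<oplus>\<^bsub>M\<^esub> y \<in> N) \<and>
     (\<forall>a\<in>carrier R. \<forall>x\<in>N. a \<odot>\<^bsub>M\<^esub> x \<in> N)" (is "_ \<longleftrightarrow> ?r")
proof
  assume "submodule N R M"
  then interpret N: submodule N R M .
  show ?r
    using N.subset N.one_closed N.m_closed N.smult_closed by auto
next
  assume r: ?r
  have "\<ominus>\<^bsub>M\<^esub> x \<in> N" if "x \<in> N" for x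
    using r that smult_l_minus_one[of x] by (metis R.a_inv_closed R.one_closed subsetD)
  then show "submodule N R M"
    using r by (intro submodule.intro subgroup.intro submodule_axioms.intro) (auto simp: a_inv_def)
qed

end

lemma mod_iso_zero:
  assumes "mod_iso R M N f" "left_module R M" "left_module R N"
  shows "f \<zero>\<^bsub>M\<^esub> = \<zero>\<^bsub>N\<^esub>"
proof -
  interpret M: left_module R M by fact
  interpret N: left_module R N by fact
  have "f \<zero>\<^bsub>M\<^esub> \<oplus>\<^bsub>N\<^esub> f \<zero>\<^bsub>M\<^esub> = f \<zero>\<^bsub>M\<^esub>"
    using mod_isoD(2)[OF assms(1), of "\<zero>\<^bsub>M\<^esub>" "\<zero>\<^bsub>M\<^esub>"] by simp
  then show ?thesis
    using mod_isoD(4)[OF assms(1), of "\<zero>\<^bsub>M\<^esub>"] by simp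
qed

lemma mod_iso_inv:
  assumes f: "mod_iso R M N f" and M: "left_module R M"
  shows "mod_iso R N M (inv_into (carrier M) f)"
proof -
  interpret M: left_module R M by fact
  let ?g = "inv_into (carrier M) f"
  note b = mod_isoD(1)[OF f]
  have g: "?g y \<in> carrier M" "f (?g y) = y" if "y \<in> carrier N" for y
    using that b by (auto simp: bij_betw_def inv_into_into f_inv_into_f)
  have gf: "?g (f x) = x" if "x \<in> carrier M" for x
    using that b by (simp add: bij_betw_def)
  show ?thesis
  proof (rule mod_isoI)
    show "bij_betw ?g (carrier N) (carrier M)" using b by (rule bij_betw_inv_into)
    show "?g (x \<oplus>\<^bsub>N\<^esub> y) = ?g x \<oplus>\<^bsub>M\<^esub> ?g y" if "x \<in> carrier N" "y \<in> carrier N" for x y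
      using g[OF that(1)] g[OF that(2)] mod_isoD(2)[OF f, of "?g x" "?g y"] gf[of "?g x \<oplus>\<^bsub>M\<^esub> ?g y"] by simp
    show "?g (a \<odot>\<^bsub>N\<^esub> x) = a \<odot>\<^bsub>M\<^esub> ?g x" if "a \<in> carrier R" "x \<in> carrier N" for a x
      using g[OF that(2)] mod_isoD(3)[OF f that(1), of "?g x"] gf[of "a \<odot>\<^bsub>M\<^esub> ?g x"] M.smult_closed[OF that(1)] by simp
  qed
qed

lemma mod_iso_trans:
  assumes "mod_iso R M N f" "mod_iso R N L g"
  shows "mod_iso R M L (g \<circ> f)"
  by (rule mod_isoI)
     (use mod_isoD[OF assms(1)] mod_isoD[OF assms(2)] in \<open>auto intro: bij_betw_trans\<close>)

lemma module_isomorphic_sym: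
  "module_isomorphic R M N \<Longrightarrow> left_module R M \<Longrightarrow> module_isomorphic R N M"
  unfolding module_isomorphic_iff by (blast intro: mod_iso_inv)

lemma module_isomorphic_trans:
  "module_isomorphic R M N \<Longrightarrow> module_isomorphic R N L \<Longrightarrow> module_isomorphic R M L"
  using mod_iso_trans unfolding module_isomorphic_iff by blast

text \<open>Here \<open>M\<close> is only a record with closed operations, and all axioms are pulled
  back along the bijection \<open>f\<close>. In this way the tensor product inherits the module
  axioms from its model.\<close>

lemma left_module_transfer:
  assumes f: "mod_iso R M N f" and N: "left_module R N"
    and add: "\<And>x y. x \<in> carrier M \<Longrightarrow> y \<in> carrier M \<Longrightarrow> x \<oplus>\<^bsub>M\<^esub> y \<in> carrier M"
    and smult: "\<And>a x. a \<in> carrier R \<Longrightarrow> x \<in> carrier M \<Longrightarrow> a \<odot>\<^bsub>M\<^esub> x \<in> carrier M"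
    and zero: "\<zero>\<^bsub>M\<^esub> \<in> carrier M" "f \<zero>\<^bsub>M\<^esub> = \<zero>\<^bsub>N\<^esub>"
  shows "left_module R M"
proof -
  interpret N: left_module R N by fact
  note [simp] = mod_isoD(2,3,4)[OF f] add smult zero
  have eqI: "x = y" if "x \<in> carrier M" "y \<in> carrier M" "f x = f y" for x y
    using that mod_isoD(1)[OF f] by (meson bij_betw_def inj_onD)
  have surj: "\<exists>x\<in>carrier M. f x = y" if "y \<in> carrier N" for y
    using that mod_isoD(1)[OF f] by (metis bij_betw_def imageE)
  have "abelian_group M"
  proof (rule abelian_groupI)
    fix x assume x: "x \<in> carrier M"
    obtain y where "y \<in> carrier M" "f y = \<ominus>\<^bsub>N\<^esub> f x" using surj[of "\<ominus>\<^bsub>N\<^esub> f x"] x by auto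
    then show "\<exists>y\<in>carrier M. y \<oplus>\<^bsub>M\<^esub> x = \<zero>\<^bsub>M\<^esub>"
      using x by (intro bexI[of _ y] eqI) (auto simp: N.M.l_neg)
  qed (auto intro!: eqI simp: N.M.a_ac)
  then show ?thesis
    by (intro left_module.intro N.R.ring_axioms left_module_axioms.intro)
       (auto intro!: eqI simp: N.smult_l_distr N.smult_r_distr N.smult_assoc N.smult_one)
qed

text \<open>Moves a module into another type, which is how the one-variable factors are placed in
  the type of a given module.\<close>

lemma left_module_copy:
  fixes f :: "'m \<Rightarrow> 'l" and M :: "('r, 'm) module"
  assumes M: "left_module R M" and inj: "inj_on f (carrier M)"
  shows "\<exists>N :: ('r, 'l) module. left_module R N \<and> mod_iso R M N f"
proof -
  interpret M: left_module R M by fact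
  let ?g = "inv_into (carrier M) f"
  define N :: "('r, 'l) module" where
    "N = \<lparr> carrier = f ` carrier M, monoid.mult = undefined, monoid.one = undefined,
       ring.zero = f \<zero>\<^bsub>M\<^esub>, ring.add = (\<lambda>x y. f (?g x \<oplus>\<^bsub>M\<^esub> ?g y)), module.smult = (\<lambda>a x. f (a \<odot>\<^bsub>M\<^esub> ?g x)) \<rparr>"
  have gf [simp]: "?g (f x) = x" if "x \<in> carrier M" for x
    using that inj by simp
  have fiso: "mod_iso R M N f"
    by (rule mod_isoI) (use inj in \<open>auto simp: N_def bij_betw_def\<close>)
  have "mod_iso R N M ?g"
    by (rule mod_iso_inv[OF fiso M])
  then have "left_module R N"
    by (rule left_module_transfer[OF _ M])
       (auto simp: N_def M.smult_closed)
  with fiso show ?thesis by blast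
qed

text \<open>A submodule of \<open>N\<close> is the image of its preimage, which is zero or
  everything in \<open>M\<close>.\<close>

lemma simple_module_transfer:
  assumes f: "mod_iso R M N f" and N: "left_module R N" and M: "simple_module R M"
  shows "simple_module R N"
proof -
  interpret M: left_module R M using M by (simp add: simple_module_def)
  interpret N: left_module R N by fact
  note f0 = mod_iso_zero[OF f M.left_module_axioms N]
  note b = mod_isoD(1)[OF f]
  have "carrier N \<noteq> {\<zero>\<^bsub>N\<^esub>}"
  proof
    assume "carrier N = {\<zero>\<^bsub>N\<^esub>}"
    then have "x = \<zero>\<^bsub>M\<^esub>" if "x \<in> carrier M" for x
      using that mod_isoD(4)[OF f that] b f0 by (metis M.M.zero_closed bij_betw_def inj_onD singletonD)
    then show False using M by (auto simp: simple_module_def)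
  qed
  moreover have "P = {\<zero>\<^bsub>N\<^esub>} \<or> P = carrier N" if P: "submodule P R N" for P
  proof -
    let ?Q = "{x \<in> carrier M. f x \<in> P}"
    have "submodule ?Q R M"
      using P unfolding M.submodule_iff N.submodule_iff
      by (auto simp: f0 mod_isoD[OF f] M.smult_closed)
    then have "?Q = {\<zero>\<^bsub>M\<^esub>} \<or> ?Q = carrier M" using M by (auto simp: simple_module_def)
    moreover have "P = f ` ?Q"
      using P b by (auto simp: N.submodule_iff bij_betw_def image_iff)
    ultimately show ?thesis using f0 b by (auto simp: bij_betw_def)
  qed
  ultimately show ?thesis by (auto simp: simple_module_def N)
qed

text \<open>Decompositions in \<open>M\<close> and \<open>N\<close> correspond under composition
  with \<open>f\<close>; for uniqueness a competing decomposition in \<open>N\<close> is pulled back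
  by the inverse map.\<close>

lemma internal_direct_sum_transfer:
  fixes V :: "'i \<Rightarrow> 'm set"
  assumes f: "mod_iso R M N f" and M: "left_module R M" and N: "left_module R N"
    and V: "internal_direct_sum M V" and W: "\<And>i. W i = f ` V i"
  shows "internal_direct_sum N W"
proof -
  interpret M: left_module R M by fact
  interpret N: left_module R N by fact
  note f0 = mod_iso_zero[OF f M N]
  note b = mod_isoD(1)[OF f]
  let ?g = "inv_into (carrier M) f"
  have Vc: "V i \<subseteq> carrier M" for i
    using V subgroup.subset[of "V i" "add_monoid M"] by (auto simp: internal_direct_sum_def)
  have gf: "?g (f x) = x" if "x \<in> carrier M" for x
    using that b by (simp add: bij_betw_def)
  have inj: "x = y" if "x \<in> carrier M" "y \<in> carrier M" "f x = f y" for x y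
    using that gf by metis
  have gh: "group_hom (add_monoid M) (add_monoid N) f"
    using mod_isoD[OF f] by (intro group_hom.intro group_hom_axioms.intro M.M.a_group N.M.a_group) (auto simp: hom_def)
  have sg: "subgroup (W i) (add_monoid N)" for i
    unfolding W using group_hom.subgroup_img_is_subgroup[OF gh] V by (simp add: internal_direct_sum_def)
  have fs: "f (finsum M h A) = finsum N (\<lambda>i. f (h i)) A" if "h \<in> A \<rightarrow> carrier M" for h :: "'i \<Rightarrow> 'm" and A
    using that
  proof (induction A rule: infinite_finite_induct)
    case (insert i A)
    then have "h \<in> A \<rightarrow> carrier M" "h i \<in> carrier M" "(\<lambda>i. f (h i)) \<in> A \<rightarrow> carrier N"
      using mod_isoD(4)[OF f] by auto
    then show ?case using insert by (simp add: mod_isoD[OF f] M.finsum_closed)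
  qed (simp_all add: f0)
  have "\<exists>!h. (\<forall>i. h i \<in> W i) \<and> finite {i. h i \<noteq> \<zero>\<^bsub>N\<^esub>} \<and> w = (\<Oplus>\<^bsub>N\<^esub>i\<in>{i. h i \<noteq> \<zero>\<^bsub>N\<^esub>}. h i)"
    if w: "w \<in> carrier N" for w
  proof -
    obtain v where v: "v \<in> carrier M" "w = f v" using w b by (auto simp: bij_betw_def)
    define P where "P h \<longleftrightarrow> (\<forall>i. h i \<in> V i) \<and> finite {i. h i \<noteq> \<zero>\<^bsub>M\<^esub>} \<and> v = (\<Oplus>\<^bsub>M\<^esub>i\<in>{i. h i \<noteq> \<zero>\<^bsub>M\<^esub>}. h i)" for h
    have "\<exists>!h. P h"
      using V v(1) by (simp add: internal_direct_sum_def P_def)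
    then obtain h where "P h" and u: "\<And>h'. P h' \<Longrightarrow> h' = h"
      by blast
    then have h: "\<And>i. h i \<in> V i" "finite {i. h i \<noteq> \<zero>\<^bsub>M\<^esub>}" "v = (\<Oplus>\<^bsub>M\<^esub>i\<in>{i. h i \<noteq> \<zero>\<^bsub>M\<^esub>}. h i)"
      by (auto simp: P_def)
    have z: "f (h' i) \<noteq> \<zero>\<^bsub>N\<^esub> \<longleftrightarrow> h' i \<noteq> \<zero>\<^bsub>M\<^esub>" if "\<And>i. h' i \<in> V i" for h' i
      using inj[of "h' i" "\<zero>\<^bsub>M\<^esub>"] that[of i] Vc[of i] f0 by auto
    have supp: "{i. f (h' i) \<noteq> \<zero>\<^bsub>N\<^esub>} = {i. h' i \<noteq> \<zero>\<^bsub>M\<^esub>}" if "\<And>i. h' i \<in> V i" for h'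
      using z[OF that] by auto
    show ?thesis
    proof (rule ex1I[of _ "\<lambda>i. f (h i)"], intro conjI allI)
      show "f (h i) \<in> W i" for i using h(1) by (simp add: W)
      show "finite {i. f (h i) \<noteq> \<zero>\<^bsub>N\<^esub>}" using h(2) supp[OF h(1)] by simp
      show "w = (\<Oplus>\<^bsub>N\<^esub>i\<in>{i. f (h i) \<noteq> \<zero>\<^bsub>N\<^esub>}. f (h i))"
        using fs[of h "{i. h i \<noteq> \<zero>\<^bsub>M\<^esub>}"] h(1,3) Vc v(2) supp[OF h(1)] by (auto simp: subset_iff)
    next
      fix k assume k: "(\<forall>i. k i \<in> W i) \<and> finite {i. k i \<noteq> \<zero>\<^bsub>N\<^esub>} \<and> w = (\<Oplus>\<^bsub>N\<^esub>i\<in>{i. k i \<noteq> \<zero>\<^bsub>N\<^esub>}. k i)"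
      define h' where "h' i = ?g (k i)" for i
      have h': "h' i \<in> V i" "f (h' i) = k i" for i
      proof -
        obtain x where "x \<in> V i" "k i = f x" using k W by blast
        then show "h' i \<in> V i" "f (h' i) = k i" using gf[of x] Vc[of i] by (auto simp: h'_def)
      qed
      have "f (\<Oplus>\<^bsub>M\<^esub>i\<in>{i. h' i \<noteq> \<zero>\<^bsub>M\<^esub>}. h' i) = w"
        using fs[of h' "{i. h' i \<noteq> \<zero>\<^bsub>M\<^esub>}"] k h' Vc supp[of h', OF h'(1)] by (auto simp: subset_iff)
      then have "v = (\<Oplus>\<^bsub>M\<^esub>i\<in>{i. h' i \<noteq> \<zero>\<^bsub>M\<^esub>}. h' i)"
        using v h'(1) Vc by (intro inj M.M.finsum_closed) auto
      moreover have "finite {i. h' i \<noteq> \<zero>\<^bsub>M\<^esub>}"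
        using k supp[of h', OF h'(1)] h'(2) by simp
      ultimately have "h' = h" using h'(1) by (intro u) (simp add: P_def)
      then show "k = (\<lambda>i. f (h i))" using h'(2) by auto
    qed
  qed
  then show ?thesis using sg by (simp add: internal_direct_sum_def)
qed

lemma image_Collect_eq:
  "(\<And>x. x \<in> A \<Longrightarrow> P (f x) \<longleftrightarrow> Q x) \<Longrightarrow> {y \<in> f ` A. P y} = f ` {x \<in> A. Q x}"
  by blast

section \<open>Weight spaces\<close>

lemma carrier_D_alg: "carrier (D_alg :: ('n::finite, 'k::field_char_0) mpol_op ring) \<subseteq> carrier intdiff_alg"
proof
  fix b :: "('n, 'k) mpol_op" assume "b \<in> carrier D_alg"
  then have "b \<in> carrier (gen_subalg (range op_H))" by (simp add: D_alg_def)
  then show "b \<in> carrier intdiff_alg"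
    by (rule gen_subalg_induct) (auto simp only: plin_op_H op_H_intdiff intdiff_gens intdiff_closed)
qed

lemma ring_D_alg: "ring (D_alg :: ('n::finite, 'k::field_char_0) mpol_op ring)"
proof -
  have "range pm_scale \<union> range op_H \<subseteq> carrier (mpol_End :: ('n, 'k) mpol_op ring)"
    by (auto simp: mpol_End_def linear_scale plin_op_H)
  from ring.subring_is_ring[OF ring_mpol_End ring.generate_ring_is_subring[OF ring_mpol_End this]]
  show ?thesis by (simp add: D_alg_def gen_subalg_def)
qed

lemma D_alg_gens [simp, intro]: "op_H i \<in> carrier D_alg" "pm_scale c \<in> carrier D_alg"
  by (auto simp: D_alg_def gen_subalg_def intro!: generate_ring.incl)

text \<open>The generator \<open>H_i - w_i\<close> of the maximal ideal, written as a sum with a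
  scalar operator so that the rules for sums apply to symbols and to module actions.\<close>

definition H_shift :: "('n \<Rightarrow> 'k) \<Rightarrow> 'n \<Rightarrow> ('n::finite, 'k::field_char_0) mpol_op" where
  "H_shift w i = (\<lambda>p. op_H i p + pm_scale (- w i) p)"

lemma H_shift_D: "H_shift w i \<in> carrier D_alg"
  using ring.ring_simprules(1)[OF ring_D_alg, of "op_H i" "pm_scale (- w i)"] by (simp add: H_shift_def)

lemma H_shift_intdiff [simp, intro]: "H_shift w i \<in> carrier intdiff_alg"
  using H_shift_D carrier_D_alg by blast

lemma max_ideal_eq:
  fixes w :: "'n::finite \<Rightarrow> 'k::field_char_0"
  shows "max_ideal w = genideal D_alg (range (H_shift w))"
proof -
  have "op_H i \<ominus>\<^bsub>D_alg\<^esub> pm_scale (w i) = H_shift w i" for i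
  proof -
    interpret D: ring "D_alg :: ('n, 'k) mpol_op ring" by (rule ring_D_alg)
    have "\<ominus>\<^bsub>D_alg\<^esub> pm_scale (w i) = (pm_scale (- w i) :: ('n, 'k) mpol_op)"
      by (rule D.minus_equality) (auto simp: fun_eq_iff)
    then show ?thesis by (simp only: a_minus_def H_shift_def D_alg_simps)
  qed
  then show ?thesis by (simp add: max_ideal_def)
qed

lemma ideal_max_ideal: "ideal (max_ideal w) D_alg"
  unfolding max_ideal_eq
  by (rule ring.genideal_ideal[OF ring_D_alg]) (use H_shift_D in auto)

lemma H_shift_max_ideal: "H_shift w i \<in> max_ideal w"
  unfolding max_ideal_eq
  using ring.genideal_self[OF ring_D_alg, of "range (H_shift w)"] H_shift_D by auto

lemma ideals_set_simps [simp]: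
  "monoid.one (ideals_set R) = carrier R" "monoid.mult (ideals_set R) = ideal_prod R"
  by (simp_all add: ideals_set_def)

lemma max_ideal_power_simps:
  "max_ideal w [^]\<^bsub>ideals_set D_alg\<^esub> (0::nat) = carrier D_alg"
  "max_ideal w [^]\<^bsub>ideals_set D_alg\<^esub> (Suc k) =
     ideal_prod D_alg (max_ideal w [^]\<^bsub>ideals_set D_alg\<^esub> k) (max_ideal w)"
  by (simp_all add: nat_pow_def)

text \<open>Membership of these powers is what makes each \<open>H_i - w_i\<close> nilpotent on a
  generalized weight vector.\<close>

lemma H_shift_power: "(H_shift w i) ^^ k \<in> max_ideal w [^]\<^bsub>ideals_set D_alg\<^esub> (k::nat)"
proof (induction k)
  case 0
  then show ?case
    using ring.ring_simprules(6)[OF ring_D_alg] by (simp add: max_ideal_power_simps id_def)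
next
  case (Suc k)
  have "(H_shift w i) ^^ Suc k = ((H_shift w i) ^^ k) \<circ> H_shift w i"
    by (rule funpow_Suc_right)
  then show ?case
    using ideal_prod.prod[OF Suc H_shift_max_ideal[of w i], of D_alg] by (simp only: max_ideal_power_simps D_alg_simps)
qed

lemma H_shift_power_intdiff: "(H_shift w i) ^^ k \<in> carrier intdiff_alg"
  by (induction k) (simp_all only: funpow.simps id_intdiff intdiff_closed(1) H_shift_intdiff)

locale intdiff_module = left_module intdiff_alg M for M :: "(('n::finite, 'k::field_char_0) mpol_op, 'm) module" (structure)
begin

lemma smult_comp:
  "f \<in> carrier intdiff_alg \<Longrightarrow> g \<in> carrier intdiff_alg \<Longrightarrow> x \<in> carrier M \<Longrightarrow> (f \<circ> g) \<odot> x = f \<odot> (g \<odot> x)"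
  using smult_assoc[of f g x] by simp

lemma smult_plus:
  "f \<in> carrier intdiff_alg \<Longrightarrow> g \<in> carrier intdiff_alg \<Longrightarrow> x \<in> carrier M \<Longrightarrow>
    (\<lambda>p. f p + g p) \<odot> x = f \<odot> x \<oplus> g \<odot> x"
  using smult_l_distr[of f g x] by simp

lemma smult_id: "x \<in> carrier M \<Longrightarrow> id \<odot> x = x"
  using smult_one[of x] by simp

lemma scale_one: "x \<in> carrier M \<Longrightarrow> pm_scale 1 \<odot> x = x"
proof -
  have "pm_scale 1 = (id :: ('n, 'k) mpol_op)" by (auto simp: fun_eq_iff)
  then show "x \<in> carrier M \<Longrightarrow> pm_scale 1 \<odot> x = x" using smult_id[of x] by metis
qed

lemma zero_op: "x \<in> carrier M \<Longrightarrow> (\<lambda>p. 0) \<odot> x = \<zero>"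
  using smult_l_null[of x] by simp

lemma scale_zero: "x \<in> carrier M \<Longrightarrow> pm_scale 0 \<odot> x = \<zero>"
proof -
  have "pm_scale 0 = (\<lambda>p :: ('n, 'k) mpol. 0)" by (auto simp: fun_eq_iff)
  then show "x \<in> carrier M \<Longrightarrow> pm_scale 0 \<odot> x = \<zero>" using zero_op[of x] by metis
qed

lemma scale_scale: "x \<in> carrier M \<Longrightarrow> pm_scale c \<odot> (pm_scale d \<odot> x) = pm_scale (c * d) \<odot> x"
proof -
  have "pm_scale (c * d) = (pm_scale c \<circ> pm_scale d :: ('n, 'k) mpol_op)" by (auto simp: fun_eq_iff)
  then show "x \<in> carrier M \<Longrightarrow> ?thesis" using smult_comp[of "pm_scale c" "pm_scale d" x] by simp
qed

lemma scale_plus: "x \<in> carrier M \<Longrightarrow> pm_scale (c + d) \<odot> x = pm_scale c \<odot> x \<oplus> pm_scale d \<odot> x"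
proof -
  have "pm_scale (c + d) = (\<lambda>p :: ('n, 'k) mpol. pm_scale c p + pm_scale d p)"
    by (auto simp: fun_eq_iff PM.scale_left_distrib)
  then show "x \<in> carrier M \<Longrightarrow> ?thesis" using smult_plus[of "pm_scale c" "pm_scale d" x] by simp
qed

lemma scale_commute:
  assumes "f \<in> carrier intdiff_alg" "x \<in> carrier M"
  shows "f \<odot> (pm_scale c \<odot> x) = pm_scale c \<odot> (f \<odot> x)"
proof -
  have "f \<circ> pm_scale c = pm_scale c \<circ> f"
    using plin_scale[OF plin_intdiff[OF assms(1)]] by (auto simp: fun_eq_iff)
  then show ?thesis
    using smult_comp[of f "pm_scale c" x] smult_comp[of "pm_scale c" f x] assms by simp
qed

lemma scale_minus: "x \<in> carrier M \<Longrightarrow> pm_scale (- c) \<odot> x = \<ominus> (pm_scale c \<odot> x)"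
  using scale_plus[of x "-c" c] scale_zero[of x]
  by (intro M.minus_equality[symmetric]) (auto intro: smult_closed)

lemma scale_eq_zero:
  assumes "x \<in> carrier M" "c \<noteq> 0" "pm_scale c \<odot> x = \<zero>"
  shows "x = \<zero>"
  using scale_scale[of x "inverse c" c] scale_one[of x] assms smult_r_null[of "pm_scale (inverse c)"] by simp

lemma H_shift_eq_zero_iff:
  assumes "v \<in> carrier M"
  shows "H_shift w i \<odot> v = \<zero> \<longleftrightarrow> op_H i \<odot> v = pm_scale (w i) \<odot> v"
proof -
  have "H_shift w i \<odot> v = op_H i \<odot> v \<oplus> \<ominus> (pm_scale (w i) \<odot> v)"
    using smult_plus[of "op_H i" "pm_scale (- w i)" v] assms by (simp add: H_shift_def scale_minus)
  then show ?thesis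
    using assms by (metis M.minus_equality M.minus_minus M.r_neg M.a_inv_closed intdiff_gens(4) op_H_intdiff smult_closed)
qed

text \<open>The work is in showing that a common eigenvector of the \<open>H_i\<close> is killed by
  the whole ideal: its annihilator in \<open>D_alg\<close> is an ideal that contains the
  generators.\<close>

lemma weight_space_eq:
  "weight_space M w = {v \<in> carrier M. \<forall>i. op_H i \<odot> v = pm_scale (w i) \<odot> v}"
proof (intro equalityI subsetI)
  fix v assume "v \<in> weight_space M w"
  then have "v \<in> carrier M" "\<And>i. H_shift w i \<odot> v = \<zero>"
    using H_shift_max_ideal by (auto simp: weight_space_def)
  then show "v \<in> {v \<in> carrier M. \<forall>i. op_H i \<odot> v = pm_scale (w i) \<odot> v}"
    using H_shift_eq_zero_iff by blast
next
  fix v assume "v \<in> {v \<in> carrier M. \<forall>i. op_H i \<odot> v = pm_scale (w i) \<odot> v}"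
  then have v: "v \<in> carrier M" and H: "\<And>i. op_H i \<odot> v = pm_scale (w i) \<odot> v" by auto
  interpret D: ring "D_alg :: ('n, 'k) mpol_op ring" by (rule ring_D_alg)
  \<comment> \<open>Every element of \<open>D_alg\<close> multiplies v by a scalar, which makes the
    annihilator of v closed under multiplication on the right as well.\<close>
  have eigen: "\<exists>c. d \<odot> v = pm_scale c \<odot> v" if "d \<in> carrier D_alg" for d
  proof -
    have "d \<in> carrier (gen_subalg (range op_H))" using that by (simp add: D_alg_def)
    then show ?thesis
    proof (rule gen_subalg_induct)
      fix f g :: "('n, 'k) mpol_op"
      assume fg: "f \<in> carrier (gen_subalg (range op_H))" "g \<in> carrier (gen_subalg (range op_H))"
        "\<exists>c. f \<odot> v = pm_scale c \<odot> v" "\<exists>c. g \<odot> v = pm_scale c \<odot> v"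
      then have c: "f \<in> carrier intdiff_alg" "g \<in> carrier intdiff_alg"
        using carrier_D_alg by (auto simp: D_alg_def)
      obtain a b where ab: "f \<odot> v = pm_scale a \<odot> v" "g \<odot> v = pm_scale b \<odot> v" using fg by auto
      show "\<exists>c. (\<lambda>p. f p + g p) \<odot> v = pm_scale c \<odot> v"
        using smult_plus[OF c v] ab scale_plus[OF v, of a b] by (intro exI[of _ "a + b"]) simp
      show "\<exists>c. (f \<circ> g) \<odot> v = pm_scale c \<odot> v"
        using smult_comp[OF c v] ab scale_commute[OF c(1) v, of b] scale_scale[OF v, of b a]
        by (intro exI[of _ "b * a"]) simp
    qed (use H plin_op_H in auto)
  qed
  let ?J = "{a \<in> carrier D_alg. a \<odot> v = \<zero>}"
  have Dc: "a \<in> carrier D_alg \<Longrightarrow> a \<in> carrier intdiff_alg" for a :: "('n, 'k) mpol_op" using carrier_D_alg by blast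
  have "ideal ?J D_alg"
  proof (rule idealI)
    show "subgroup ?J (add_monoid D_alg)"
    proof (rule D.add.subgroupI)
      show "?J \<noteq> {}" using D.zero_closed zero_op[OF v] by auto
      fix a assume a: "a \<in> ?J"
      have "\<ominus>\<^bsub>D_alg\<^esub> a = pm_scale (-1) \<circ> a"
        using a D.m_closed[of "pm_scale (-1)" a] by (intro D.minus_equality) (auto simp: fun_eq_iff)
      moreover have "(pm_scale (-1) \<circ> a) \<odot> v = \<zero>"
        using a Dc smult_comp[of "pm_scale (-1)" a v] v smult_r_null[of "pm_scale (-1)"] by simp
      ultimately show "\<ominus>\<^bsub>D_alg\<^esub> a \<in> ?J"
        using a D.a_inv_closed[of a] by simp
      fix b assume b: "b \<in> ?J"
      show "a \<oplus>\<^bsub>D_alg\<^esub> b \<in> ?J"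
        using a b D.a_closed[of a b] smult_plus[of a b v] Dc v by simp
    qed auto
    fix a x :: "('n, 'k) mpol_op" assume a: "a \<in> ?J" and x: "x \<in> carrier D_alg"
    show "x \<otimes>\<^bsub>D_alg\<^esub> a \<in> ?J"
      using a x D.m_closed[of x a] smult_comp[of x a v] Dc v smult_r_null[of x] by simp
    obtain c where "x \<odot> v = pm_scale c \<odot> v" using eigen[OF x] by auto
    then show "a \<otimes>\<^bsub>D_alg\<^esub> x \<in> ?J"
      using a x D.m_closed[of a x] smult_comp[of a x v] Dc v scale_commute[of a v c]
        smult_r_null[of "pm_scale c"] by simp
  qed (rule ring_D_alg)
  moreover have "range (H_shift w) \<subseteq> ?J"
    using H_shift_D H v H_shift_eq_zero_iff by auto
  ultimately have "max_ideal w \<subseteq> ?J"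
    unfolding max_ideal_eq by (rule D.genideal_minimal)
  then show "v \<in> weight_space M w" using v by (auto simp: weight_space_def)
qed

lemma weight_space_subset_gen: "weight_space M w \<subseteq> gen_weight_space M w"
proof
  fix v assume "v \<in> weight_space M w"
  then have v: "v \<in> carrier M" and z: "\<And>a. a \<in> max_ideal w \<Longrightarrow> a \<odot> v = \<zero>" by (auto simp: weight_space_def)
  \<comment> \<open>The first power is by definition the product of the zeroth power, which is all
    of \<open>D_alg\<close>, with the maximal ideal.\<close>
  have "ideal_prod D_alg (carrier D_alg) (max_ideal w) \<subseteq> max_ideal w"
    using ring.ideal_prod_inter[OF ring_D_alg ring.oneideal[OF ring_D_alg] ideal_max_ideal] by blast
  then have "\<forall>a\<in>max_ideal w [^]\<^bsub>ideals_set D_alg\<^esub> (Suc 0). a \<odot> v = \<zero>"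
    using z by (auto simp: max_ideal_power_simps)
  then show "v \<in> gen_weight_space M w" using v unfolding gen_weight_space_def by blast
qed

lemma gen_weight_space_nilpotent:
  assumes "v \<in> gen_weight_space M w"
  shows "v \<in> carrier M" "\<exists>k. (H_shift w i ^^ k) \<odot> v = \<zero>"
proof -
  obtain k :: nat where "v \<in> carrier M" "\<forall>a\<in>max_ideal w [^]\<^bsub>ideals_set D_alg\<^esub> k. a \<odot> v = \<zero>"
    using assms by (auto simp: gen_weight_space_def)
  then show "v \<in> carrier M" "\<exists>k. (H_shift w i ^^ k) \<odot> v = \<zero>"
    using H_shift_power[where w = w and i = i and k = k] by blast+
qed

end

lemma intdiff_moduleI: "left_module intdiff_alg M \<Longrightarrow> intdiff_module M"
  by (simp add: intdiff_module_def)

lemma ideal_power_subset: "max_ideal w [^]\<^bsub>ideals_set D_alg\<^esub> (k::nat) \<subseteq> carrier D_alg"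
proof -
  have "ideal (max_ideal w [^]\<^bsub>ideals_set D_alg\<^esub> k) D_alg"
  proof (induction k)
    case 0
    then show ?case by (simp add: max_ideal_power_simps ring.oneideal[OF ring_D_alg])
  next
    case (Suc k)
    then show ?case
      by (simp add: max_ideal_power_simps ring.ideal_prod_is_ideal[OF ring_D_alg _ ideal_max_ideal])
  qed
  from ideal.Icarr[OF this] show ?thesis by blast
qed

context
  fixes M :: "(('n::finite, 'k::field_char_0) mpol_op, 'm) module" and N :: "(('n, 'k) mpol_op, 'l) module"
    and f :: "'m \<Rightarrow> 'l"
  assumes f: "mod_iso intdiff_alg M N f" and M: "left_module intdiff_alg M" and N: "left_module intdiff_alg N"
begin

lemma smult_eq_zero_transfer:
  assumes "a \<in> carrier intdiff_alg" "v \<in> carrier M"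
  shows "a \<odot>\<^bsub>N\<^esub> f v = \<zero>\<^bsub>N\<^esub> \<longleftrightarrow> a \<odot>\<^bsub>M\<^esub> v = \<zero>\<^bsub>M\<^esub>"
proof -
  interpret M: left_module intdiff_alg M by (rule M)
  have "a \<odot>\<^bsub>N\<^esub> f v = f (a \<odot>\<^bsub>M\<^esub> v)" using mod_isoD(3)[OF f assms] by simp
  then show ?thesis
    using mod_iso_zero[OF f M N] mod_isoD(1)[OF f] M.smult_closed[OF assms] M.M.zero_closed
    by (metis bij_betw_def inj_onD)
qed

lemma weight_space_transfer: "weight_space N w = f ` weight_space M w"
proof -
  have "max_ideal w \<subseteq> carrier intdiff_alg"
    using ideal.Icarr[OF ideal_max_ideal] carrier_D_alg by blast
  then have e: "(\<forall>a\<in>max_ideal w. a \<odot>\<^bsub>N\<^esub> f v = \<zero>\<^bsub>N\<^esub>) \<longleftrightarrow> (\<forall>a\<in>max_ideal w. a \<odot>\<^bsub>M\<^esub> v = \<zero>\<^bsub>M\<^esub>)"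
    if "v \<in> carrier M" for v
    using smult_eq_zero_transfer[OF _ that] by (meson subsetD)
  have c: "carrier N = f ` carrier M" using mod_isoD(1)[OF f] by (simp add: bij_betw_def)
  show ?thesis
    unfolding weight_space_def c by (rule image_Collect_eq) (simp add: e)
qed

lemma gen_weight_space_transfer: "gen_weight_space N w = f ` gen_weight_space M w"
proof -
  have "max_ideal w [^]\<^bsub>ideals_set D_alg\<^esub> (k::nat) \<subseteq> carrier intdiff_alg" for k
    using ideal_power_subset carrier_D_alg by blast
  then have e: "(\<exists>k::nat. \<forall>a\<in>max_ideal w [^]\<^bsub>ideals_set D_alg\<^esub> k. a \<odot>\<^bsub>N\<^esub> f v = \<zero>\<^bsub>N\<^esub>) \<longleftrightarrow>
      (\<exists>k::nat. \<forall>a\<in>max_ideal w [^]\<^bsub>ideals_set D_alg\<^esub> k. a \<odot>\<^bsub>M\<^esub> v = \<zero>\<^bsub>M\<^esub>)" if "v \<in> carrier M" for v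
    using smult_eq_zero_transfer[OF _ that] by (meson subsetD)
  have c: "carrier N = f ` carrier M" using mod_isoD(1)[OF f] by (simp add: bij_betw_def)
  show ?thesis
    unfolding gen_weight_space_def c by (rule image_Collect_eq) (simp only: e)
qed

lemma Supp_transfer: "Supp N = Supp M"
proof -
  have "f ` gen_weight_space M w = {\<zero>\<^bsub>N\<^esub>} \<longleftrightarrow> gen_weight_space M w = {\<zero>\<^bsub>M\<^esub>}" for w
  proof -
    interpret M: left_module intdiff_alg M by (rule M)
    have "gen_weight_space M w \<subseteq> carrier M" by (auto simp: gen_weight_space_def)
    moreover have "inj_on f (carrier M)" using mod_isoD(1)[OF f] by (simp add: bij_betw_def)
    ultimately show ?thesis
      using inj_on_image_eq_iff[of f "carrier M" "gen_weight_space M w" "{\<zero>\<^bsub>M\<^esub>}"] mod_iso_zero[OF f M N] by simp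
  qed
  then show ?thesis by (auto simp: Supp_def gen_weight_space_transfer)
qed

lemma weight_module_transfer: "weight_module M \<Longrightarrow> weight_module N"
  using internal_direct_sum_transfer[OF f M N, of "weight_space M" "weight_space N"] weight_space_transfer
  by (simp add: weight_module_def N)

lemma gen_weight_module_transfer: "gen_weight_module M \<Longrightarrow> gen_weight_module N"
  using internal_direct_sum_transfer[OF f M N, of "gen_weight_space M" "gen_weight_space N"] gen_weight_space_transfer
  by (simp add: gen_weight_module_def N)

lemma simple_weight_module_transfer: "simple_weight_module M \<Longrightarrow> simple_weight_module N"
  using simple_module_transfer[OF f N] weight_module_transfer by (auto simp: simple_weight_module_def)

lemma simple_gen_weight_module_transfer: "simple_gen_weight_module M \<Longrightarrow> simple_gen_weight_module N"
  using simple_module_transfer[OF f N] gen_weight_module_transfer by (auto simp: simple_gen_weight_module_def)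

end

section \<open>Shift operators\<close>

text \<open>A truncated shift in the basis of divided powers; the factorials convert monomials to
  that basis.\<close>

definition shift_op :: "('n \<Rightarrow> int) \<Rightarrow> ('n::finite, 'k::field_char_0) mpol_op" where
  "shift_op \<delta> = lin_ext (\<lambda>\<beta>. pm_scale (\<Prod>i\<in>UNIV. fact (lookup \<beta> i))
     (dpow (\<lambda>i. int (lookup \<beta> i) + \<delta> i)))"

lemma plin_shift_op: "plin (shift_op \<delta>)"
  by (simp add: shift_op_def plin_lin_ext)

lemma shift_op_dpow: "(\<And>i. 0 \<le> \<beta> i) \<Longrightarrow> shift_op \<delta> (dpow \<beta>) = dpow (\<lambda>i. \<beta> i + \<delta> i)"
  by (simp add: shift_op_def dpow_nonneg[of \<beta>])

lemma d_shift_op: "op_d i \<circ> shift_op \<delta> = (shift_op (\<delta>(i := \<delta> i - 1)) :: ('n::finite, 'k::field_char_0) mpol_op)"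
proof
  fix p :: "('n, 'k) mpol"
  show "(op_d i \<circ> shift_op \<delta>) p = shift_op (\<delta>(i := \<delta> i - 1)) p"
    unfolding comp_apply
  proof (rule dpow_eqI[OF plin_comp[OF plin_op_d plin_shift_op] plin_shift_op])
    fix \<beta> :: "'n \<Rightarrow> int" assume b: "\<And>i. 0 \<le> \<beta> i"
    have "(\<lambda>j. \<beta> j + \<delta> j)(i := \<beta> i + \<delta> i - 1) = (\<lambda>j. \<beta> j + (\<delta>(i := \<delta> i - 1)) j)" by auto
    then show "op_d i (shift_op \<delta> (dpow \<beta>)) = shift_op (\<delta>(i := \<delta> i - 1)) (dpow \<beta>)"
      using b by (simp add: shift_op_dpow op_d_dpow)
  qed
qed

text \<open>The sign condition is essential: once a negative shift has truncated a divided power to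
  zero, integration cannot restore it. Differentiation only lowers further, so
  \<open>d_shift_op\<close> holds for all \<delta>.\<close>

lemma int_shift_op:
  assumes "0 \<le> \<delta> i"
  shows "op_int i \<circ> shift_op \<delta> = (shift_op (\<delta>(i := \<delta> i + 1)) :: ('n::finite, 'k::field_char_0) mpol_op)"
proof
  fix p :: "('n, 'k) mpol"
  show "(op_int i \<circ> shift_op \<delta>) p = shift_op (\<delta>(i := \<delta> i + 1)) p"
    unfolding comp_apply
  proof (rule dpow_eqI[OF plin_comp[OF plin_op_int plin_shift_op] plin_shift_op])
    fix \<beta> :: "'n \<Rightarrow> int" assume b: "\<And>i. 0 \<le> \<beta> i"
    have "(\<lambda>j. \<beta> j + \<delta> j)(i := \<beta> i + \<delta> i + 1) = (\<lambda>j. \<beta> j + (\<delta>(i := \<delta> i + 1)) j)" by auto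
    then show "op_int i (shift_op \<delta> (dpow \<beta>)) = shift_op (\<delta>(i := \<delta> i + 1)) (dpow \<beta>)"
      using b[of i] assms b by (simp add: shift_op_dpow op_int_dpow)
  qed
qed

lemma shift_op_zero: "shift_op (\<lambda>_. 0) = (id :: ('n::finite, 'k::field_char_0) mpol_op)"
proof
  fix p :: "('n, 'k) mpol"
  have "plin (id :: ('n, 'k) mpol_op)" by (rule plinI) auto
  then show "shift_op (\<lambda>_. 0) p = id p"
    by (rule dpow_eqI[OF plin_shift_op]) (simp add: shift_op_dpow)
qed

text \<open>Induction on the sum of the absolute values of \<delta>: a negative coordinate is
  brought closer to 0 by splitting off a derivative, a positive one by splitting off an
  integration.\<close>

lemma shift_op_intdiff: "(shift_op \<delta> :: ('n::finite, 'k::field_char_0) mpol_op) \<in> carrier intdiff_alg"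
proof (induction "\<Sum>i\<in>UNIV. nat \<bar>\<delta> i\<bar>" arbitrary: \<delta> rule: less_induct)
  case less
  have smaller: "(\<Sum>j\<in>UNIV. nat \<bar>(\<delta>(i := c)) j\<bar>) < (\<Sum>j\<in>UNIV. nat \<bar>\<delta> j\<bar>)" if "nat \<bar>c\<bar> < nat \<bar>\<delta> i\<bar>" for i c
    by (rule sum_strict_mono_ex1) (use that in auto)
  show ?case
  proof (cases "\<delta> = (\<lambda>_. 0)")
    case True
    then show ?thesis by (simp only: shift_op_zero id_intdiff)
  next
    case False
    then obtain i where i: "\<delta> i \<noteq> 0" by auto
    show ?thesis
    proof (cases "\<delta> i < 0")
      case True
      have "(shift_op (\<delta>(i := \<delta> i + 1)) :: ('n, 'k) mpol_op) \<in> carrier intdiff_alg"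
        using True by (intro less smaller) auto
      then have "(op_d i \<circ> shift_op (\<delta>(i := \<delta> i + 1)) :: ('n, 'k) mpol_op) \<in> carrier intdiff_alg"
        by (intro intdiff_closed intdiff_gens)
      then show ?thesis unfolding d_shift_op by (simp only: fun_upd_upd fun_upd_same add_diff_cancel fun_upd_triv)
    next
      case False
      with i have p: "0 < \<delta> i" by simp
      have "(shift_op (\<delta>(i := \<delta> i - 1)) :: ('n, 'k) mpol_op) \<in> carrier intdiff_alg"
        using p by (intro less smaller) auto
      then have "(op_int i \<circ> shift_op (\<delta>(i := \<delta> i - 1)) :: ('n, 'k) mpol_op) \<in> carrier intdiff_alg"
        by (intro intdiff_closed intdiff_gens)
      moreover have "op_int i \<circ> shift_op (\<delta>(i := \<delta> i - 1)) = (shift_op \<delta> :: ('n, 'k) mpol_op)"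
        using int_shift_op[of "\<delta>(i := \<delta> i - 1)" i] p by simp
      ultimately show ?thesis by (simp only:)
    qed
  qed
qed

lemma symbol_shift:
  fixes S :: "'n::finite set"
  shows "symbol S (shift_op \<delta> :: ('n, 'k::field_char_0) mpol_op)
     (\<lambda>\<nu> \<alpha>. single (\<lambda>i. \<alpha> i + \<delta> i) (if (\<lambda>i. \<alpha> i + \<delta> i) \<in> orthant S then 1 else 0))"
proof (rule symbol_single)
  fix \<alpha> assume a: "\<alpha> \<in> orthant S"
  \<comment> \<open>The sum of all \<open>nat (- \<alpha> i)\<close> serves as one threshold for all
    coordinates at once.\<close>
  have "shift_op \<delta> (dpow_at m \<alpha> :: ('n, 'k) mpol) =
      pm_scale (if (\<lambda>i. \<alpha> i + \<delta> i) \<in> orthant S then 1 else 0) (dpow (\<lambda>i. \<alpha> i + \<delta> i + int (m i)))"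
    if m: "test_point S (\<Sum>i\<in>UNIV. nat (- \<alpha> i)) m" for m
  proof -
    have "0 \<le> \<alpha> i + int (m i)" for i
    proof (cases "i \<in> S")
      case True
      then show ?thesis using a by (auto simp: orthant_def)
    next
      case False
      then have "(\<Sum>i\<in>UNIV. nat (- \<alpha> i)) \<le> m i" using m by (auto simp: test_point_def)
      moreover have "nat (- \<alpha> i) \<le> (\<Sum>i\<in>UNIV. nat (- \<alpha> i))" by (rule member_le_sum) auto
      ultimately show ?thesis by linarith
    qed
    then have "shift_op \<delta> (dpow_at m \<alpha> :: ('n, 'k) mpol) = dpow (\<lambda>i. \<alpha> i + \<delta> i + int (m i))"
      by (simp add: shift_op_dpow algebra_simps)
    moreover have "dpow (\<lambda>i. \<alpha> i + \<delta> i + int (m i)) = (0 :: ('n, 'k) mpol)" if out: "(\<lambda>i. \<alpha> i + \<delta> i) \<notin> orthant S"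
    proof -
      obtain i where i: "i \<in> S" "\<alpha> i + \<delta> i < 0" using out by (auto simp: orthant_def not_le)
      moreover then have "m i = 0" using m by (auto simp: test_point_def)
      ultimately show ?thesis by (intro dpow_neg[of _ i]) auto
    qed
    ultimately show ?thesis by simp
  qed
  then show "\<exists>N. \<forall>m. test_point S N m \<longrightarrow> shift_op \<delta> (dpow_at m \<alpha> :: ('n, 'k) mpol) =
      pm_scale (if (\<lambda>i. \<alpha> i + \<delta> i) \<in> orthant S then 1 else 0) (dpow (\<lambda>i. \<alpha> i + \<delta> i + int (m i)))"
    by (intro exI allI impI)
qed (simp_all add: plin_shift_op polyfun.const)

section \<open>The weights of the model modules\<close>

definition wt :: "('n \<Rightarrow> 'k::field_char_0) \<Rightarrow> ('n \<Rightarrow> int) \<Rightarrow> ('n \<Rightarrow> 'k)" where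
  "wt \<nu> \<alpha> = (\<lambda>i. \<nu> i + of_int (\<alpha> i + 1))"

text \<open>The integers embed in a field of characteristic zero; hence distinct basis vectors of a
  model have distinct weights.\<close>

lemma wt_inj [simp]: "wt \<nu> \<alpha> = wt \<nu> \<beta> \<longleftrightarrow> \<alpha> = \<beta>"
  by (auto simp: wt_def fun_eq_iff)

lemma lookup_lin_ext_diag:
  "lookup (lin_ext (\<lambda>\<alpha>. single \<alpha> (f \<alpha>)) p) \<beta> = f \<beta> * lookup p \<beta>"
proof -
  have "lookup (lin_ext (\<lambda>\<alpha>. single \<alpha> (f \<alpha>)) p) \<beta> =
      (\<Sum>\<alpha>\<in>keys p. if \<beta> = \<alpha> then f \<alpha> * lookup p \<alpha> else 0)"
    unfolding lookup_lin_ext by (rule sum.cong) (auto simp: lookup_single when_def)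
  also have "\<dots> = f \<beta> * lookup p \<beta>"
    by (simp add: in_keys_iff)
  finally show ?thesis .
qed

lemma symbol_H:
  "symbol S (op_H i :: ('n::finite, 'k::field_char_0) mpol_op) (\<lambda>\<nu> \<alpha>. single \<alpha> (wt \<nu> \<alpha> i))"
proof (rule symbol_single)
  fix \<alpha> :: "'n \<Rightarrow> int"
  show "polyfun (\<lambda>\<nu>. wt \<nu> \<alpha> i)"
    unfolding wt_def by (rule polyfun.add[OF polyfun.coord polyfun.const])
  show "\<exists>N. \<forall>m. test_point S N m \<longrightarrow> op_H i (dpow_at m \<alpha> :: ('n, 'k) mpol) =
      pm_scale (wt (\<lambda>i. of_nat (m i)) \<alpha> i) (dpow_at m \<alpha>)"
    by (simp add: op_H_dpow wt_def algebra_simps)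
qed (simp_all add: plin_op_H)

lemma symbol_H_shift:
  "symbol S (H_shift w i) (\<lambda>\<nu> \<alpha>. single \<alpha> (wt \<nu> \<alpha> i - w i))"
  using symbol_add[OF symbol_H[of S i] symbol_scale[of S "- w i"]]
  by (simp add: H_shift_def single_add[symmetric])

context
  fixes S :: "'n::finite set" and \<nu> :: "'n \<Rightarrow> 'k::field_char_0"
  assumes nu: "\<forall>i\<in>S. \<nu> i = 0"
begin

interpretation std: intdiff_module "std_module S \<nu>"
  by (rule intdiff_moduleI[OF left_module_std[OF nu]])

lemma rep_single:
  assumes "symbol S b h" "\<alpha> \<in> orthant S"
  shows "rep S \<nu> b (single \<alpha> 1) = h \<nu> \<alpha>"
  using rep_symbol[OF assms(1) nu, of "single \<alpha> 1"] assms(2) by simp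

lemma lookup_rep_H:
  "keys p \<subseteq> orthant S \<Longrightarrow>
     lookup (rep S \<nu> (op_H i) p) \<alpha> = wt \<nu> \<alpha> i * lookup p \<alpha>"
  by (simp add: rep_symbol[OF symbol_H nu] lookup_lin_ext_diag)

lemma lookup_rep_H_shift:
  "keys p \<subseteq> orthant S \<Longrightarrow>
     lookup (rep S \<nu> (H_shift w i) p) \<alpha> = (wt \<nu> \<alpha> i - w i) * lookup p \<alpha>"
  by (simp add: rep_symbol[OF symbol_H_shift nu] lookup_lin_ext_diag)

lemma lookup_rep_H_shift_power:
  assumes "keys p \<subseteq> orthant S"
  shows "lookup (rep S \<nu> (H_shift w i ^^ k) p) \<alpha> = (wt \<nu> \<alpha> i - w i) ^ k * lookup p \<alpha>"
proof (induction k)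
  case 0
  have "H_shift w i ^^ 0 = id" by (simp add: id_def)
  then show ?case using rep_id[OF nu assms] by (simp only: power_0 mult_1_left)
next
  case (Suc k)
  have "rep S \<nu> (H_shift w i \<circ> H_shift w i ^^ k) p = rep S \<nu> (H_shift w i) (rep S \<nu> (H_shift w i ^^ k) p)"
    by (rule rep_comp[OF nu assms H_shift_intdiff H_shift_power_intdiff])
  then have "rep S \<nu> (H_shift w i ^^ Suc k) p = rep S \<nu> (H_shift w i) (rep S \<nu> (H_shift w i ^^ k) p)"
    by (simp only: funpow.simps)
  then show ?case
    using Suc lookup_rep_H_shift[OF rep_keys[OF H_shift_power_intdiff assms]] by (simp only: power_Suc mult.assoc)
qed

text \<open>The operators \<open>H_i\<close> separate the basis vectors, so the terms of p can be
  removed one after another without leaving the submodule.\<close>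

lemma std_submodule_single:
  assumes N: "submodule N intdiff_alg (std_module S \<nu>)" and "p \<in> N" "p \<noteq> 0"
  shows "\<exists>\<alpha>\<in>orthant S. single \<alpha> 1 \<in> N"
  using assms(2,3)
proof (induction "card (keys p)" arbitrary: p rule: less_induct)
  case less
  note N' = N[unfolded std.submodule_iff]
  have k: "keys p \<subseteq> orthant S" using less.prems(1) N' by auto
  from less.prems obtain \<alpha> where a: "\<alpha> \<in> keys p"
    by (auto simp: poly_mapping_eq_iff fun_eq_iff in_keys_iff)
  show ?case
  proof (cases "keys p = {\<alpha>}")
    case True
    let ?c = "lookup p \<alpha>"
    have "?c \<noteq> 0" using a by (simp add: in_keys_iff)
    then have "pm_scale (inverse ?c) p = single \<alpha> 1"
      using True a by (intro poly_mapping_eqI) (auto simp: lookup_single when_def in_keys_iff)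
    moreover have "rep S \<nu> (pm_scale (inverse ?c)) p \<in> N"
      using N' less.prems(1) by auto
    ultimately have "single \<alpha> 1 \<in> N"
      by (simp add: rep_scale[OF nu k])
    then show ?thesis using a k by auto
  next
    case False
    then obtain \<beta> where b: "\<beta> \<in> keys p" "\<beta> \<noteq> \<alpha>" using a by auto
    then obtain i where i: "\<beta> i \<noteq> \<alpha> i" by auto
    \<comment> \<open>This operator kills the component at \<alpha> and multiplies the one at
      \<beta> by the nonzero number \<open>\<beta> i - \<alpha> i\<close>, so the support shrinks
      but does not become empty.\<close>
    let ?q = "rep S \<nu> (H_shift (wt \<nu> \<alpha>) i) p"
    have q: "lookup ?q \<gamma> = of_int (\<gamma> i - \<alpha> i) * lookup p \<gamma>" for \<gamma>
      by (simp add: lookup_rep_H_shift[OF k] wt_def)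
    have "?q \<in> N" using N' less.prems(1) by auto
    moreover have "\<beta> \<in> keys ?q" using b i by (simp add: in_keys_iff q)
    moreover then have "?q \<noteq> 0" by auto
    moreover have "keys ?q \<subseteq> keys p - {\<alpha>}" by (auto simp: in_keys_iff q)
    then have "card (keys ?q) < card (keys p)"
      using a by (intro psubset_card_mono) auto
    ultimately show ?thesis using less.hyps[of ?q] by auto
  qed
qed

lemma simple_std: "simple_module intdiff_alg (std_module S \<nu>)"
  unfolding simple_module_def
proof (intro conjI allI impI)
  show "left_module intdiff_alg (std_module S \<nu>)" by (rule left_module_std[OF nu])
  have "single (\<lambda>_. 0) 1 \<in> carrier (std_module S \<nu>)"
    by (simp add: orthant_def)
  moreover have "single (\<lambda>_::'n. 0::int) (1::'k) \<noteq> 0"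
    by (metis lookup_single_eq lookup_zero zero_neq_one)
  ultimately show "carrier (std_module S \<nu>) \<noteq> {\<zero>\<^bsub>std_module S \<nu>\<^esub>}" by force
  fix N assume N: "submodule N intdiff_alg (std_module S \<nu>)"
  note N' = N[unfolded std.submodule_iff]
  show "N = {\<zero>\<^bsub>std_module S \<nu>\<^esub>} \<or> N = carrier (std_module S \<nu>)"
  proof (cases "N = {0}")
    case False
    then obtain p where "p \<in> N" "p \<noteq> 0" using N' by auto
    then obtain \<alpha> where a: "\<alpha> \<in> orthant S" "single \<alpha> 1 \<in> N"
      using std_submodule_single[OF N] by blast
    \<comment> \<open>The shift by the difference of \<gamma> and \<alpha> lies in the algebra and
      takes one basis vector to the other, so a single basis vector generates all of them.\<close>
    have single: "single \<gamma> 1 \<in> N" if "\<gamma> \<in> orthant S" for \<gamma>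
    proof -
      have "rep S \<nu> (shift_op (\<lambda>i. \<gamma> i - \<alpha> i)) (single \<alpha> 1) \<in> N"
        using conjunct2[OF conjunct2[OF conjunct2[OF N']]] a(2) shift_op_intdiff
        unfolding std_module_simps by blast
      then show ?thesis
        using that by (simp add: rep_single[OF symbol_shift a(1)])
    qed
    have "q \<in> N" if "keys q \<subseteq> orthant S" for q
    proof -
      have "(\<Sum>\<gamma>\<in>A. pm_scale (lookup q \<gamma>) (single \<gamma> 1)) \<in> N"
        if "finite A" "A \<subseteq> orthant S" for A
        using that
      proof (induction A rule: finite_induct)
        case (insert \<gamma> A)
        have "rep S \<nu> (pm_scale (lookup q \<gamma>)) (single \<gamma> 1) \<in> N"
          using N' single[of \<gamma>] insert.prems by auto
        then have "pm_scale (lookup q \<gamma>) (single \<gamma> 1) \<in> N"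
          using insert.prems rep_scale[OF nu, of "single \<gamma> 1"] by simp
        then show ?case using insert N' by simp
      qed (use N' in simp)
      from this[OF finite_keys that] show ?thesis
        using lin_ext_singles[of q, unfolded lin_ext_def] by (simp only:)
    qed
    then show ?thesis using N' by auto
  qed simp
qed

lemma std_weight_space: "weight_space (std_module S \<nu>) w = {p. keys p \<subseteq> {\<alpha> \<in> orthant S. wt \<nu> \<alpha> = w}}"
proof -
  have "(\<forall>i. rep S \<nu> (op_H i) p = rep S \<nu> (pm_scale (w i)) p) \<longleftrightarrow> (\<forall>\<alpha>\<in>keys p. wt \<nu> \<alpha> = w)"
    if "keys p \<subseteq> orthant S" for p
    by (auto simp: poly_mapping_eq_iff fun_eq_iff lookup_rep_H[OF that] rep_scale[OF nu that] in_keys_iff)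
  then show ?thesis by (auto simp: std.weight_space_eq)
qed

text \<open>The \<open>H_i\<close> are diagonal, so a power of \<open>H_i - w_i\<close> annihilates
  a coefficient only if \<open>H_i - w_i\<close> itself does.\<close>

lemma std_gen_weight_space: "gen_weight_space (std_module S \<nu>) w = weight_space (std_module S \<nu>) w"
proof
  show "gen_weight_space (std_module S \<nu>) w \<subseteq> weight_space (std_module S \<nu>) w"
  proof
    fix p assume p: "p \<in> gen_weight_space (std_module S \<nu>) w"
    note nil = std.gen_weight_space_nilpotent[OF p]
    have k: "keys p \<subseteq> orthant S" using nil(1) by simp
    have "wt \<nu> \<alpha> = w" if "\<alpha> \<in> keys p" for \<alpha>
    proof
      fix i
      obtain k where "rep S \<nu> (H_shift w i ^^ k) p = 0" using nil(2)[of i] by auto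
      then have "(wt \<nu> \<alpha> i - w i) ^ k * lookup p \<alpha> = 0"
        by (simp add: lookup_rep_H_shift_power[OF k, symmetric])
      then show "wt \<nu> \<alpha> i = w i" using that by (simp add: in_keys_iff)
    qed
    then show "p \<in> weight_space (std_module S \<nu>) w" using k by (auto simp: std_weight_space)
  qed
qed (rule std.weight_space_subset_gen)

lemma std_finsum: "finite A \<Longrightarrow> g \<in> A \<rightarrow> carrier (std_module S \<nu>) \<Longrightarrow> finsum (std_module S \<nu>) g A = sum g A"
proof (induction A rule: finite_induct)
  case (insert a A)
  then have "g \<in> A \<rightarrow> carrier (std_module S \<nu>)" "g a \<in> carrier (std_module S \<nu>)" by auto
  with insert show ?case using std.finsum_insert[of A a g] by simp
qed simp

lemma std_direct_sum: "internal_direct_sum (std_module S \<nu>) (weight_space (std_module S \<nu>))"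
  unfolding internal_direct_sum_def
proof (intro conjI allI ballI)
  fix w
  show "subgroup (weight_space (std_module S \<nu>) w) (add_monoid (std_module S \<nu>))"
  proof (rule std.add.subgroupI)
    fix p q assume "p \<in> weight_space (std_module S \<nu>) w" "q \<in> weight_space (std_module S \<nu>) w"
    then show "p \<oplus>\<^bsub>std_module S \<nu>\<^esub> q \<in> weight_space (std_module S \<nu>) w"
      using keys_add[of p q] by (auto simp: std_weight_space)
  next
    fix p assume p: "p \<in> weight_space (std_module S \<nu>) w"
    have "\<ominus>\<^bsub>std_module S \<nu>\<^esub> p = - p"
      using p by (intro std.minus_equality) (auto simp: std_weight_space in_keys_iff)
    then show "\<ominus>\<^bsub>std_module S \<nu>\<^esub> p \<in> weight_space (std_module S \<nu>) w"
      using p by (auto simp: std_weight_space in_keys_iff)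
  qed (auto simp: std_weight_space intro: exI[of _ 0])
next
  fix p assume p: "p \<in> carrier (std_module S \<nu>)"
  define f where "f w = lin_ext (\<lambda>\<alpha>. single \<alpha> (if wt \<nu> \<alpha> = w then 1 else 0)) p" for w
  have f: "lookup (f w) \<alpha> = (if wt \<nu> \<alpha> = w then lookup p \<alpha> else 0)" for w \<alpha>
    by (simp add: f_def lookup_lin_ext_diag)
  have sum_eq: "finsum (std_module S \<nu>) g {w. g w \<noteq> 0} = (\<Sum>w\<in>{w. g w \<noteq> 0}. g w)"
    if "\<forall>w. g w \<in> weight_space (std_module S \<nu>) w" "finite {w. g w \<noteq> 0}" for g
    using that by (intro std_finsum) (auto simp: std_weight_space)
  \<comment> \<open>The coefficient at \<alpha> receives a contribution only from the summand of
    weight \<open>wt \<nu> \<alpha>\<close>. This gives existence with \<open>f\<close> and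
    uniqueness against any competitor.\<close>
  have lookup_sum_eq: "lookup (\<Sum>w\<in>{w. g w \<noteq> 0}. g w) \<alpha> = lookup (g (wt \<nu> \<alpha>)) \<alpha>"
    if "\<forall>w. g w \<in> weight_space (std_module S \<nu>) w" "finite {w. g w \<noteq> 0}" for g \<alpha>
  proof -
    have "lookup (g w) \<alpha> = (if wt \<nu> \<alpha> = w then lookup (g w) \<alpha> else 0)" for w
      using that(1)[rule_format, of w] by (auto simp: std_weight_space in_keys_iff)
    then have "lookup (\<Sum>w\<in>{w. g w \<noteq> 0}. g w) \<alpha> =
        (\<Sum>w\<in>{w. g w \<noteq> 0}. if wt \<nu> \<alpha> = w then lookup (g w) \<alpha> else 0)"
      unfolding lookup_sum by (rule sum.cong[OF refl])
    also have "\<dots> = lookup (g (wt \<nu> \<alpha>)) \<alpha>"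
      using that(2) by simp
    finally show ?thesis .
  qed
  have fw: "\<forall>w. f w \<in> weight_space (std_module S \<nu>) w"
    using p by (auto simp: std_weight_space in_keys_iff f split: if_splits)
  have "{w. f w \<noteq> 0} \<subseteq> wt \<nu> ` keys p"
  proof
    fix w assume "w \<in> {w. f w \<noteq> 0}"
    then obtain \<alpha> where "lookup (f w) \<alpha> \<noteq> 0" by (auto simp: poly_mapping_eq_iff fun_eq_iff)
    then have "wt \<nu> \<alpha> = w" "\<alpha> \<in> keys p" by (auto simp: f in_keys_iff split: if_splits)
    then show "w \<in> wt \<nu> ` keys p" by blast
  qed
  then have fin: "finite {w. f w \<noteq> 0}" by (rule finite_subset) simp
  show "\<exists>!f. (\<forall>w. f w \<in> weight_space (std_module S \<nu>) w) \<and> finite {w. f w \<noteq> \<zero>\<^bsub>std_module S \<nu>\<^esub>} \<and>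
      p = (\<Oplus>\<^bsub>std_module S \<nu>\<^esub>w\<in>{w. f w \<noteq> \<zero>\<^bsub>std_module S \<nu>\<^esub>}. f w)"
  proof (rule ex1I[of _ f])
    show "(\<forall>w. f w \<in> weight_space (std_module S \<nu>) w) \<and> finite {w. f w \<noteq> \<zero>\<^bsub>std_module S \<nu>\<^esub>} \<and>
      p = (\<Oplus>\<^bsub>std_module S \<nu>\<^esub>w\<in>{w. f w \<noteq> \<zero>\<^bsub>std_module S \<nu>\<^esub>}. f w)"
    proof -
      have "p = (\<Sum>w\<in>{w. f w \<noteq> 0}. f w)"
        by (rule poly_mapping_eqI) (simp only: lookup_sum_eq[OF fw fin] f if_True simp_thms)
      then show ?thesis using fw fin sum_eq[OF fw fin] by simp
    qed
  next
    fix g assume "(\<forall>w. g w \<in> weight_space (std_module S \<nu>) w) \<and> finite {w. g w \<noteq> \<zero>\<^bsub>std_module S \<nu>\<^esub>} \<and>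
      p = (\<Oplus>\<^bsub>std_module S \<nu>\<^esub>w\<in>{w. g w \<noteq> \<zero>\<^bsub>std_module S \<nu>\<^esub>}. g w)"
    then have g: "\<forall>w. g w \<in> weight_space (std_module S \<nu>) w" "finite {w. g w \<noteq> 0}" "p = (\<Sum>w\<in>{w. g w \<noteq> 0}. g w)"
      by (simp_all add: sum_eq)
    show "g = f"
    proof (rule ext, rule poly_mapping_eqI)
      fix w \<alpha>
      show "lookup (g w) \<alpha> = lookup (f w) \<alpha>"
      proof (cases "wt \<nu> \<alpha> = w")
        case True
        then show ?thesis using lookup_sum_eq[OF g(1,2), of \<alpha>] g(3) by (simp add: f)
      next
        case False
        then show ?thesis using g(1)[rule_format, of w] by (auto simp: std_weight_space f in_keys_iff)
      qed
    qed
  qed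
qed

lemma simple_weight_std: "simple_weight_module (std_module S \<nu>)"
  and simple_gen_weight_std: "simple_gen_weight_module (std_module S \<nu>)"
proof -
  have "gen_weight_space (std_module S \<nu>) = weight_space (std_module S \<nu>)"
    by (rule ext) (rule std_gen_weight_space)
  then show "simple_weight_module (std_module S \<nu>)" "simple_gen_weight_module (std_module S \<nu>)"
    using std_direct_sum simple_std left_module_std[OF nu]
    by (simp_all add: simple_weight_module_def simple_gen_weight_module_def weight_module_def gen_weight_module_def)
qed

lemma Supp_std: "Supp (std_module S \<nu>) = wt \<nu> ` orthant S"
proof -
  have "{p. keys p \<subseteq> {\<alpha> \<in> orthant S. wt \<nu> \<alpha> = w}} \<noteq> {0 :: ('n \<Rightarrow> int) \<Rightarrow>\<^sub>0 'k} \<longleftrightarrow> w \<in> wt \<nu> ` orthant S" for w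
  proof
    assume n: "{p. keys p \<subseteq> {\<alpha> \<in> orthant S. wt \<nu> \<alpha> = w}} \<noteq> {0 :: ('n \<Rightarrow> int) \<Rightarrow>\<^sub>0 'k}"
    have "(0 :: ('n \<Rightarrow> int) \<Rightarrow>\<^sub>0 'k) \<in> {p. keys p \<subseteq> {\<alpha> \<in> orthant S. wt \<nu> \<alpha> = w}}" by simp
    with n obtain p :: "('n \<Rightarrow> int) \<Rightarrow>\<^sub>0 'k" where "keys p \<subseteq> {\<alpha> \<in> orthant S. wt \<nu> \<alpha> = w}" "p \<noteq> 0" by blast
    moreover then obtain \<alpha> where "\<alpha> \<in> keys p"
      by (auto simp: poly_mapping_eq_iff fun_eq_iff in_keys_iff)
    ultimately show "w \<in> wt \<nu> ` orthant S" by blast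
  next
    assume "w \<in> wt \<nu> ` orthant S"
    then obtain \<alpha> where "\<alpha> \<in> orthant S" "w = wt \<nu> \<alpha>" by auto
    then have "single \<alpha> (1 :: 'k) \<in> {p. keys p \<subseteq> {\<alpha> \<in> orthant S. wt \<nu> \<alpha> = w}}" by simp
    moreover have "single \<alpha> (1 :: 'k) \<noteq> 0" by (metis lookup_single_eq lookup_zero zero_neq_one)
    ultimately show "{p. keys p \<subseteq> {\<alpha> \<in> orthant S. wt \<nu> \<alpha> = w}} \<noteq> {0 :: ('n \<Rightarrow> int) \<Rightarrow>\<^sub>0 'k}" by blast
  qed
  then show ?thesis
    unfolding Supp_def std_gen_weight_space std_weight_space by auto
qed

end

section \<open>Relations between the generators\<close>

lemma op_eqI:
  fixes f g :: "('n::finite, 'k::field_char_0) mpol_op"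
  assumes "f \<in> carrier intdiff_alg" "g \<in> carrier intdiff_alg"
    and "\<And>\<beta>. (\<And>i. 0 \<le> \<beta> i) \<Longrightarrow> f (dpow \<beta>) = g (dpow \<beta>)"
  shows "f = g"
proof
  fix p show "f p = g p"
    by (rule dpow_eqI[OF assms(1,2)[THEN plin_intdiff] assms(3)])
qed

lemma op_d_int: "op_d i \<circ> op_int i = (id :: ('n::finite, 'k::field_char_0) mpol_op)"
proof (rule op_eqI)
  fix \<beta> :: "'n \<Rightarrow> int" assume "\<And>j. 0 \<le> \<beta> j"
  then show "(op_d i \<circ> op_int i) (dpow \<beta>) = id (dpow \<beta> :: ('n, 'k) mpol)"
    by (simp add: op_int_dpow op_d_dpow)
qed (intro intdiff_closed intdiff_gens id_intdiff)+

text \<open>Reduces the action of x_i on an arbitrary module to the actions of \<integral>_i and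
  \<open>H_i\<close>.\<close>

lemma op_x_eq: "op_x i = (op_int i \<circ> op_H i :: ('n::finite, 'k::field_char_0) mpol_op)"
proof (rule op_eqI)
  fix \<beta> :: "'n \<Rightarrow> int" assume "\<And>j. 0 \<le> \<beta> j"
  then show "op_x i (dpow \<beta> :: ('n, 'k) mpol) = (op_int i \<circ> op_H i) (dpow \<beta>)"
    by (simp add: op_H_dpow plin_scale[OF plin_op_int] op_int_dpow op_x_dpow)
qed (intro intdiff_closed intdiff_gens op_H_intdiff)+

lemma op_H_eq: "op_H i = (\<lambda>p :: ('n::finite, 'k::field_char_0) mpol. (op_x i \<circ> op_d i) p + id p)"
proof (rule op_eqI)
  fix \<beta> :: "'n \<Rightarrow> int" assume "\<And>j. 0 \<le> \<beta> j"
  then show "op_H i (dpow \<beta> :: ('n, 'k) mpol) = (op_x i \<circ> op_d i) (dpow \<beta>) + id (dpow \<beta>)"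
    by (simp add: op_H_dpow op_x_dpow op_d_dpow PM.scale_left_distrib)
qed (intro intdiff_closed intdiff_gens op_H_intdiff id_intdiff)+

text \<open>Shifting by \<delta> raises the weight by \<delta>; where the shifted divided power is
  truncated, all terms are zero.\<close>

lemma op_H_shift:
  "op_H i \<circ> shift_op \<delta> =
    (\<lambda>p :: ('n::finite, 'k::field_char_0) mpol. (shift_op \<delta> \<circ> op_H i) p + (pm_scale (of_int (\<delta> i)) \<circ> shift_op \<delta>) p)"
proof (rule op_eqI)
  fix \<beta> :: "'n \<Rightarrow> int" assume "\<And>j. 0 \<le> \<beta> j"
  then show "(op_H i \<circ> shift_op \<delta>) (dpow \<beta> :: ('n, 'k) mpol) =
      (shift_op \<delta> \<circ> op_H i) (dpow \<beta>) + (pm_scale (of_int (\<delta> i)) \<circ> shift_op \<delta>) (dpow \<beta>)"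
    by (simp add: op_H_dpow shift_op_dpow plin_scale[OF plin_shift_op] add.commute add.left_commute
        flip: PM.scale_left_distrib)
qed (intro intdiff_closed intdiff_gens op_H_intdiff shift_op_intdiff)+

text \<open>A lowering shift may differentiate first, since at exponent 0 both sides give zero. With
  \<partial>_i acting first, the shift annihilates every vector of a module that \<partial>_i
  kills.\<close>

lemma shift_op_neg:
  assumes "\<delta> i < 0"
  shows "shift_op \<delta> = (shift_op (\<delta>(i := \<delta> i + 1)) \<circ> op_d i :: ('n::finite, 'k::field_char_0) mpol_op)"
proof (rule op_eqI)
  fix \<beta> :: "'n \<Rightarrow> int" assume b: "\<And>j. 0 \<le> \<beta> j"
  show "shift_op \<delta> (dpow \<beta> :: ('n, 'k) mpol) = (shift_op (\<delta>(i := \<delta> i + 1)) \<circ> op_d i) (dpow \<beta>)"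
  proof (cases "\<beta> i = 0")
    case True
    then show ?thesis
      using b assms by (simp add: shift_op_dpow op_d_dpow dpow_neg[of _ i] plin_zero[OF plin_shift_op])
  next
    case False
    then have "0 \<le> \<beta> i - 1" using b[of i] by linarith
    then have "0 \<le> (\<beta>(i := \<beta> i - 1)) j" for j using b by simp
    moreover have "(\<lambda>j. (\<beta>(i := \<beta> i - 1)) j + (\<delta>(i := \<delta> i + 1)) j) = (\<lambda>j. \<beta> j + \<delta> j)" by auto
    ultimately show ?thesis using b by (simp add: shift_op_dpow op_d_dpow del: fun_upd_apply)
  qed
qed (intro intdiff_closed intdiff_gens shift_op_intdiff)+

lemma op_d_eq_shift: "op_d i = (shift_op ((\<lambda>_. 0)(i := -1)) :: ('n::finite, 'k::field_char_0) mpol_op)"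
  using d_shift_op[of i "\<lambda>_. 0"] by (simp add: shift_op_zero comp_def)

lemma op_H_d:
  "op_H j \<circ> op_d i = (\<lambda>p :: ('n::finite, 'k::field_char_0) mpol.
     (op_d i \<circ> op_H j) p + (pm_scale (if i = j then -1 else 0) \<circ> op_d i) p)"
proof -
  have "of_int (((\<lambda>_. 0)(i := -1)) j) = (if i = j then -1 else 0 :: 'k)" by simp
  then show ?thesis
    by (simp only: op_d_eq_shift op_H_shift)
qed

lemma op_d_commute:
  fixes g :: "('n::finite, 'k::field_char_0) mpol_op"
  assumes "g \<in> {op_d j, op_int j, op_x j, op_H j}" "i \<noteq> j \<or> g = op_d j"
  shows "op_d i \<circ> g = g \<circ> op_d i"
proof (rule op_eqI)
  show g: "op_d i \<circ> g \<in> carrier intdiff_alg" "g \<circ> op_d i \<in> carrier intdiff_alg"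
    using assms by (auto simp del: comp_apply intro!: intdiff_closed)
  fix \<beta> :: "'n \<Rightarrow> int" assume "\<And>j. 0 \<le> \<beta> j"
  then show "(op_d i \<circ> g) (dpow \<beta>) = (g \<circ> op_d i) (dpow \<beta>)"
    using assms
    by (cases "i = j") (auto simp: op_d_dpow op_int_dpow op_x_dpow op_H_dpow plin_scale[OF plin_op_d] fun_upd_twist)
qed

lemma H_shift_commute: "H_shift w i \<circ> H_shift w j = (H_shift w j \<circ> H_shift w i :: ('n::finite, 'k::field_char_0) mpol_op)"
proof (rule op_eqI)
  fix \<beta> :: "'n \<Rightarrow> int"
  have pl: "plin (H_shift w i)" for i by (rule plin_intdiff) simp
  have e: "H_shift w i (dpow \<beta>) = pm_scale (of_int (\<beta> i + 1) - w i) (dpow \<beta> :: ('n, 'k) mpol)" for i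
    unfolding H_shift_def op_H_dpow by (simp add: PM.scale_left_diff_distrib)
  show "(H_shift w i \<circ> H_shift w j) (dpow \<beta>) = (H_shift w j \<circ> H_shift w i) (dpow \<beta> :: ('n, 'k) mpol)"
    by (simp add: e plin_scale[OF pl] mult.commute)
qed (intro intdiff_closed H_shift_intdiff)+

section \<open>Common kernels of commuting locally nilpotent maps\<close>

lemma funpow_commute:
  assumes "\<And>x. x \<in> C \<Longrightarrow> f x \<in> C" "\<And>x. x \<in> C \<Longrightarrow> f (g x) = g (f x)" "x \<in> C"
  shows "(f ^^ k) (g x) = g ((f ^^ k) x)" "(f ^^ k) x \<in> C"
proof -
  have "(f ^^ k) (g x) = g ((f ^^ k) x) \<and> (f ^^ k) x \<in> C"
    by (induction k) (simp_all add: assms)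
  then show "(f ^^ k) (g x) = g ((f ^^ k) x)" "(f ^^ k) x \<in> C" by simp_all
qed

lemma funpow_last_nonzero:
  assumes "(f ^^ k) u = z" "u \<noteq> z"
  shows "\<exists>j. (f ^^ j) u \<noteq> z \<and> f ((f ^^ j) u) = z"
  using assms
proof (induction k)
  case (Suc k)
  then show ?case by (cases "(f ^^ k) u = z") auto
qed simp

text \<open>Each map in turn is applied until one more application would give \<open>z\<close>.
  Because the maps commute, the kernels reached earlier survive, and so does an invariant property
  \<open>P\<close>. The lemma serves for the \<open>H_i - w_i\<close>, and then for the \<partial>_i
  with \<open>P\<close> saying that the vector has some weight.\<close>

lemma common_kernel:
  fixes h :: "'i \<Rightarrow> 'm \<Rightarrow> 'm"
  assumes "finite U"
    and closed: "\<And>i x. x \<in> C \<Longrightarrow> h i x \<in> C"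
    and zero: "\<And>i. h i z = z"
    and comm: "\<And>i j x. x \<in> C \<Longrightarrow> h i (h j x) = h j (h i x)"
    and inv: "\<And>i x. x \<in> C \<Longrightarrow> P x \<Longrightarrow> P (h i x)"
    and v: "v \<in> C" "v \<noteq> z" "P v" and nil: "\<And>i. i \<in> U \<Longrightarrow> \<exists>k. (h i ^^ k) v = z"
  shows "\<exists>u\<in>C. u \<noteq> z \<and> P u \<and> (\<forall>i\<in>U. h i u = z)"
proof -
  \<comment> \<open>Nilpotency of all maps in \<open>U\<close> is carried along to the new vector,
    since the remaining maps have to be applied to it.\<close>
  have "\<exists>u\<in>C. u \<noteq> z \<and> P u \<and> (\<forall>i\<in>V. h i u = z) \<and> (\<forall>i\<in>U. \<exists>k. (h i ^^ k) u = z)" if "finite V" "V \<subseteq> U" for V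
    using that
  proof (induction V rule: finite_induct)
    case empty
    then show ?case using v nil by blast
  next
    case (insert i V)
    then obtain u where u: "u \<in> C" "u \<noteq> z" "P u" "\<forall>j\<in>V. h j u = z" "\<forall>j\<in>U. \<exists>k. (h j ^^ k) u = z" by auto
    then obtain k where "(h i ^^ k) u = z" using insert.prems by blast
    with u(2) obtain j where j: "(h i ^^ j) u \<noteq> z" "h i ((h i ^^ j) u) = z" using funpow_last_nonzero by metis
    have z: "(h l ^^ k) z = z" for l k by (induction k) (simp_all add: zero)
    have Pj: "P ((h i ^^ j) u) \<and> (h i ^^ j) u \<in> C" for j
      by (induction j) (simp_all add: u inv closed)
    have "h l ((h i ^^ j) u) = z" if "l \<in> V" for l
      using funpow_commute(1)[of C "h i" "h l" u j] u(1,4) that closed comm z by metis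
    moreover have "\<exists>k. (h l ^^ k) ((h i ^^ j) u) = z" if l: "l \<in> U" for l
    proof -
      obtain k where k: "(h l ^^ k) u = z" using u(5) l by blast
      have "(h i ^^ j) ((h l ^^ k) u) = (h l ^^ k) ((h i ^^ j) u)"
      proof (rule funpow_commute(1)[of C])
        fix x assume "x \<in> C"
        then show "h i ((h l ^^ k) x) = (h l ^^ k) (h i x)"
          using funpow_commute(1)[of C "h l" "h i" x k] closed comm by metis
      qed (use u(1) closed in auto)
      then show ?thesis using k z by metis
    qed
    ultimately show ?case using j Pj by (intro bexI[of _ "(h i ^^ j) u"]) auto
  qed
  from this[OF assms(1) order_refl] show ?thesis by blast
qed

section \<open>Classification of the simple modules with a weight\<close>

text \<open>Kernel and image of \<open>f\<close> are submodules, and \<open>x0\<close> rules out the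
  zero map.\<close>

lemma schur:
  assumes M: "simple_module R M" and N: "simple_module R N"
    and car: "\<And>x. x \<in> carrier M \<Longrightarrow> f x \<in> carrier N"
    and add: "\<And>x y. x \<in> carrier M \<Longrightarrow> y \<in> carrier M \<Longrightarrow> f (x \<oplus>\<^bsub>M\<^esub> y) = f x \<oplus>\<^bsub>N\<^esub> f y"
    and smult: "\<And>a x. a \<in> carrier R \<Longrightarrow> x \<in> carrier M \<Longrightarrow> f (a \<odot>\<^bsub>M\<^esub> x) = a \<odot>\<^bsub>N\<^esub> f x"
    and nz: "x0 \<in> carrier M" "f x0 \<noteq> \<zero>\<^bsub>N\<^esub>"
  shows "mod_iso R M N f"
proof -
  interpret M: left_module R M using M by (simp add: simple_module_def)
  interpret N: left_module R N using N by (simp add: simple_module_def)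
  have f0: "f \<zero>\<^bsub>M\<^esub> = \<zero>\<^bsub>N\<^esub>"
    using smult[of "\<zero>\<^bsub>R\<^esub>" "\<zero>\<^bsub>M\<^esub>"] M.smult_l_null[of "\<zero>\<^bsub>M\<^esub>"] N.smult_l_null[of "f \<zero>\<^bsub>M\<^esub>"] car[of "\<zero>\<^bsub>M\<^esub>"] by simp
  let ?K = "{x \<in> carrier M. f x = \<zero>\<^bsub>N\<^esub>}"
  have "submodule ?K R M"
    unfolding M.submodule_iff by (auto simp: f0 add smult M.smult_closed N.smult_r_null)
  then have K: "?K = {\<zero>\<^bsub>M\<^esub>}" using M nz by (auto simp: simple_module_def)
  have "submodule (f ` carrier M) R N"
    unfolding N.submodule_iff
    by (auto simp: car add[symmetric] smult[symmetric] M.smult_closed intro: image_eqI[of _ _ "\<zero>\<^bsub>M\<^esub>"] f0[symmetric])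
  then have im: "f ` carrier M = carrier N"
    using N nz by (auto simp: simple_module_def)
  have "inj_on f (carrier M)"
  proof (rule inj_onI)
    fix x y assume xy: "x \<in> carrier M" "y \<in> carrier M" "f x = f y"
    have "f (x \<oplus>\<^bsub>M\<^esub> (\<ominus>\<^bsub>R\<^esub> \<one>\<^bsub>R\<^esub>) \<odot>\<^bsub>M\<^esub> y) = f y \<oplus>\<^bsub>N\<^esub> (\<ominus>\<^bsub>R\<^esub> \<one>\<^bsub>R\<^esub>) \<odot>\<^bsub>N\<^esub> f y"
      using xy by (simp add: add smult M.smult_closed)
    also have "\<dots> = \<zero>\<^bsub>N\<^esub>" using xy car by (simp add: N.smult_l_minus_one N.r_neg)
    finally have "x \<oplus>\<^bsub>M\<^esub> (\<ominus>\<^bsub>M\<^esub> y) \<in> ?K"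
      using xy by (simp add: M.smult_l_minus_one)
    then have "x \<oplus>\<^bsub>M\<^esub> (\<ominus>\<^bsub>M\<^esub> y) = \<zero>\<^bsub>M\<^esub>" using K by blast
    then show "x = y" using xy by (metis M.M.minus_equality M.M.minus_minus M.a_inv_closed)
  qed
  then show ?thesis
    using im by (intro mod_isoI add smult) (auto simp: bij_betw_def)
qed

context intdiff_module
begin

lemma d_closed: "x \<in> carrier M \<Longrightarrow> op_d i \<odot> x \<in> carrier M"
  by (simp add: smult_closed)

text \<open>The vectors killed by the k-th power of \<partial>_i form a filtration.
  \<open>\<integral>_i\<close> raises the level by at most one because
  \<open>\<partial>_i \<integral>_i = 1\<close>, \<open>H_i\<close> preserves it, and
  \<open>x_i = \<integral>_i H_i\<close>; the generators in the other variables commute with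
  \<partial>_i.\<close>

lemma submodule_eventually_killed:
  "submodule {x \<in> carrier M. \<exists>k. ((\<lambda>x. op_d i \<odot> x) ^^ k) x = \<zero>} intdiff_alg M"
proof -
  let ?d = "\<lambda>x. op_d i \<odot> x"
  define T where "T k = {x \<in> carrier M. (?d ^^ k) x = \<zero>}" for k
  have T0: "\<zero> \<in> T k" for k
    by (induction k) (simp_all add: T_def smult_r_null del: funpow.simps add: funpow_0 funpow_Suc_right)
  have T_Suc: "x \<in> T (Suc k) \<longleftrightarrow> x \<in> carrier M \<and> ?d x \<in> T k" for x k
    by (auto simp: T_def d_closed funpow_Suc_right simp del: funpow.simps)
  have T_0: "x \<in> T 0 \<longleftrightarrow> x = \<zero>" for x by (auto simp: T_def)
  have T_carrier: "x \<in> T k \<Longrightarrow> x \<in> carrier M" for x k by (simp add: T_def)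
  have T_step: "x \<in> T k \<Longrightarrow> x \<in> T (Suc k)" for x k
    by (simp add: T_def smult_r_null)
  have T_mono: "x \<in> T l" if "k \<le> l" "x \<in> T k" for x k l
    using that by (induction rule: dec_induct) (simp_all add: T_step)
  have T_add: "x \<in> T k \<Longrightarrow> y \<in> T k \<Longrightarrow> x \<oplus> y \<in> T k" for x y k
    by (induction k arbitrary: x y) (auto simp: T_0 T_Suc smult_r_distr)
  have T_scale: "x \<in> T k \<Longrightarrow> pm_scale c \<odot> x \<in> T k" for x k c
    by (induction k arbitrary: x) (auto simp: T_0 T_Suc smult_r_null smult_closed scale_commute)
  have T_comm: "x \<in> T k \<Longrightarrow> g \<odot> x \<in> T k"
    if g: "g \<in> carrier intdiff_alg" "op_d i \<circ> g = g \<circ> op_d i" for x k g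
  proof (induction k arbitrary: x)
    case 0
    then show ?case using g by (simp add: T_0 smult_r_null)
  next
    case (Suc k)
    then have x: "x \<in> carrier M" "?d x \<in> T k" by (auto simp: T_Suc)
    have "?d (g \<odot> x) = g \<odot> ?d x"
      using smult_comp[OF intdiff_gens(2) g(1) x(1), of i] smult_comp[OF g(1) intdiff_gens(2) x(1), of i] g(2) by simp
    then show ?case using Suc.IH[OF x(2)] x g by (simp add: T_Suc smult_closed)
  qed
  have T_int: "x \<in> T k \<Longrightarrow> op_int j \<odot> x \<in> T (Suc k)" for x k j
  proof (cases "i = j")
    case True
    assume x: "x \<in> T k"
    have "?d (op_int j \<odot> x) = (op_d i \<circ> op_int i) \<odot> x"
      unfolding True by (rule smult_comp[OF intdiff_gens(2,3) T_carrier[OF x], symmetric])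
    also have "\<dots> = x"
      unfolding op_d_int by (rule smult_id[OF T_carrier[OF x]])
    finally have "?d (op_int j \<odot> x) = x" .
    then show ?thesis using x T_carrier[OF x] by (simp add: T_Suc smult_closed)
  next
    case False
    assume "x \<in> T k"
    then show ?thesis
      by (intro T_step T_comm op_d_commute[of _ j]) (use False in auto)
  qed
  have T_H: "x \<in> T k \<Longrightarrow> op_H j \<odot> x \<in> T k" for x k j
  proof (cases "i = j")
    case False
    assume "x \<in> T k"
    then show ?thesis
      by (intro T_comm op_d_commute[of _ j]) (use False in auto)
  next
    case True
    show "x \<in> T k \<Longrightarrow> op_H j \<odot> x \<in> T k"
    proof (induction k arbitrary: x)
      case 0
      then show ?case by (simp add: T_0 smult_r_null)
    next
      case (Suc k)
      then have x: "x \<in> carrier M" "?d x \<in> T k" by (auto simp: T_Suc)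
      have "op_H j \<odot> ?d x = (op_H j \<circ> op_d i) \<odot> x"
        using x by (intro smult_comp[symmetric]) auto
      also have "\<dots> = (op_d i \<circ> op_H j) \<odot> x \<oplus> (pm_scale (if i = j then -1 else 0) \<circ> op_d i) \<odot> x"
        unfolding op_H_d by (rule smult_plus) (intro intdiff_closed op_H_intdiff intdiff_gens x)+
      also have "\<dots> = ?d (op_H j \<odot> x) \<oplus> pm_scale (-1) \<odot> ?d x"
        using x True by (simp only: smult_comp intdiff_gens op_H_intdiff simp_thms if_True)
      finally have e: "?d (op_H j \<odot> x) \<oplus> pm_scale (-1) \<odot> ?d x = op_H j \<odot> ?d x" ..
      have c: "?d (op_H j \<odot> x) \<in> carrier M" "?d x \<in> carrier M" using x by (auto intro!: smult_closed)
      \<comment> \<open>The commutator of \<partial>_i and \<open>H_i\<close> is \<partial>_i, so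
        after one derivative both summands lie one level lower.\<close>
      have "?d (op_H j \<odot> x) = op_H j \<odot> ?d x \<oplus> ?d x"
        using c scale_minus[of "?d x" 1] scale_one[of "?d x"] unfolding e[symmetric]
        by (simp add: M.a_assoc M.l_neg)
      then show ?case
        using x Suc.IH[OF x(2)] T_add by (simp add: T_Suc smult_closed)
    qed
  qed
  define U where "U = {x \<in> carrier M. \<exists>k. (?d ^^ k) x = \<zero>}"
  have U: "x \<in> U \<longleftrightarrow> (\<exists>k. x \<in> T k)" for x by (auto simp: U_def T_def)
  have U_add: "x \<oplus> y \<in> U" if xy: "x \<in> U" "y \<in> U" for x y
  proof -
    obtain k l where "x \<in> T k" "y \<in> T l" using xy unfolding U by blast
    then have "x \<in> T (max k l)" "y \<in> T (max k l)"
      using T_mono[of k "max k l" x] T_mono[of l "max k l" y] by simp_all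
    then have "x \<oplus> y \<in> T (max k l)" by (rule T_add)
    then show ?thesis unfolding U by blast
  qed
  have "x \<in> U \<longrightarrow> b \<odot> x \<in> U" if "b \<in> carrier intdiff_alg" for b x
    using that
  proof (induction arbitrary: x rule: intdiff_induct)
    case (x i)
    show ?case
    proof
      assume xU: "x \<in> U"
      then have "x \<in> carrier M" by (simp add: U_def)
      then have "op_x i \<odot> x = op_int i \<odot> (op_H i \<odot> x)"
        unfolding op_x_eq by (intro smult_comp intdiff_gens op_H_intdiff)
      moreover obtain k where "x \<in> T k" using xU unfolding U by blast
      ultimately have "op_x i \<odot> x \<in> T (Suc k)" using T_H[of x k i] T_int[of "op_H i \<odot> x" k i] by simp
      then show "op_x i \<odot> x \<in> U" unfolding U by blast
    qed
  next
    case (d j)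
    show ?case
    proof
      assume "x \<in> U"
      then obtain k where "x \<in> T k" unfolding U by blast
      then have "op_d j \<odot> x \<in> T k" by (intro T_comm op_d_commute[of _ j]) auto
      then show "op_d j \<odot> x \<in> U" unfolding U by blast
    qed
  next
    case (int i)
    show ?case unfolding U using T_int by blast
  next
    case (scale c)
    show ?case unfolding U using T_scale by blast
  next
    case (add f g)
    show ?case
    proof
      assume x: "x \<in> U"
      then have "x \<in> carrier M" by (simp add: U_def)
      then show "(\<lambda>p. f p + g p) \<odot> x \<in> U"
        using x add.IH U_add by (simp only: smult_plus[OF add.hyps(1,2)] simp_thms)
    qed
  next
    case (comp f g)
    show ?case
    proof
      assume x: "x \<in> U"
      then have "x \<in> carrier M" by (simp add: U_def)
      then show "(f \<circ> g) \<odot> x \<in> U"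
        using x comp.IH by (simp only: smult_comp[OF comp.hyps(1,2)] simp_thms)
    qed
  qed
  then have "submodule U intdiff_alg M"
    unfolding submodule_iff using U[of "\<zero>"] T0 U_add by (simp add: subset_iff) (simp add: U_def)
  then show ?thesis by (simp add: U_def)
qed

section \<open>The homomorphism from a model determined by a weight vector\<close>

context
  fixes S :: "'n set" and \<nu> :: "'n \<Rightarrow> 'k" and v :: 'm
  assumes nu: "\<forall>i\<in>S. \<nu> i = 0" and v: "v \<in> carrier M"
    and weight: "\<And>i. op_H i \<odot> v = pm_scale (\<nu> i + 1) \<odot> v"
    and lowest: "\<And>i. i \<in> S \<Longrightarrow> op_d i \<odot> v = \<zero>"
    and inj: "\<And>i x. i \<notin> S \<Longrightarrow> x \<in> carrier M \<Longrightarrow> op_d i \<odot> x = \<zero> \<Longrightarrow> x = \<zero>"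
begin

text \<open>The future image of the basis vector \<alpha>. The vector v corresponds to index 0,
  whose weight \<open>\<nu> i + 1\<close> is the eigenvalue required of v.\<close>

definition orbit :: "('n \<Rightarrow> int) \<Rightarrow> 'm" where
  "orbit \<alpha> = shift_op \<alpha> \<odot> v"

lemma orbit_closed [simp]: "orbit \<alpha> \<in> carrier M"
  by (simp add: orbit_def smult_closed shift_op_intdiff v)

lemma d_orbit: "op_d i \<odot> orbit \<alpha> = orbit (\<alpha>(i := \<alpha> i - 1))"
  unfolding orbit_def d_shift_op[symmetric]
  by (rule smult_comp[symmetric]) (auto simp: shift_op_intdiff v)

text \<open>A shift that is negative at some i in \<open>S\<close> factors through \<partial>_i
  acting first, and \<partial>_i kills v.\<close>

lemma orbit_outside:
  assumes "\<alpha> \<notin> orthant S"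
  shows "orbit \<alpha> = \<zero>"
proof -
  obtain i where i: "i \<in> S" "\<alpha> i < 0" using assms by (auto simp: orthant_def not_le)
  have "orbit \<alpha> = shift_op (\<alpha>(i := \<alpha> i + 1)) \<odot> (op_d i \<odot> v)"
    unfolding orbit_def using smult_comp[OF shift_op_intdiff intdiff_gens(2) v] shift_op_neg[of \<alpha> i, OF i(2)] by metis
  then show ?thesis using lowest[OF i(1)] by (simp add: smult_r_null shift_op_intdiff)
qed

text \<open>For a nonnegative coordinate this is a relation between operators. For a negative one i
  lies outside \<open>S\<close>, and injectivity of \<partial>_i on the module supplies what
  truncation destroys on polynomials.\<close>

lemma int_orbit:
  assumes "\<alpha> \<in> orthant S"
  shows "op_int i \<odot> orbit \<alpha> = orbit (\<alpha>(i := \<alpha> i + 1))"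
proof (cases "0 \<le> \<alpha> i")
  case True
  show ?thesis
    unfolding orbit_def int_shift_op[of \<alpha> i, OF True, symmetric]
    by (rule smult_comp[symmetric]) (auto simp: shift_op_intdiff v)
next
  case False
  then have "i \<notin> S" using assms by (auto simp: orthant_def)
  have id: "op_int i \<odot> (op_d i \<odot> x) = x" if x: "x \<in> carrier M" for x
  proof -
    let ?y = "op_int i \<odot> (op_d i \<odot> x)"
    have y: "?y \<in> carrier M" "op_d i \<odot> x \<in> carrier M" using x by (auto intro!: smult_closed)
    have "op_d i \<odot> ?y = (op_d i \<circ> op_int i) \<odot> (op_d i \<odot> x)"
      by (rule smult_comp[OF intdiff_gens(2,3) y(2), symmetric])
    also have "\<dots> = op_d i \<odot> x"
      unfolding op_d_int by (rule smult_id[OF y(2)])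
    finally have "op_d i \<odot> ?y = op_d i \<odot> x" .
    then have "op_d i \<odot> (?y \<oplus> \<ominus> x) = \<zero>"
      using x y by (simp add: smult_r_distr smult_r_minus M.r_neg)
    then have "?y \<oplus> \<ominus> x = \<zero>"
      by (rule inj[OF \<open>i \<notin> S\<close>, rotated]) (use x y in simp)
    then have "?y = \<ominus> (\<ominus> x)" using x y by (intro M.minus_equality[symmetric]) auto
    then show ?thesis using x by simp
  qed
  \<comment> \<open>\<open>orbit \<alpha>\<close> is \<partial>_i of the orbit vector one step
    higher, which \<integral>_i therefore returns.\<close>
  show ?thesis
    using id[of "orbit (\<alpha>(i := \<alpha> i + 1))"] by (simp add: d_orbit)
qed

lemma H_orbit: "op_H i \<odot> orbit \<alpha> = pm_scale (wt \<nu> \<alpha> i) \<odot> orbit \<alpha>"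
proof -
  have "op_H i \<odot> orbit \<alpha> = (op_H i \<circ> shift_op \<alpha>) \<odot> v"
    unfolding orbit_def by (rule smult_comp[symmetric]) (auto simp: shift_op_intdiff v)
  also have "\<dots> = (shift_op \<alpha> \<circ> op_H i) \<odot> v \<oplus> (pm_scale (of_int (\<alpha> i)) \<circ> shift_op \<alpha>) \<odot> v"
    unfolding op_H_shift by (rule smult_plus) (intro intdiff_closed shift_op_intdiff op_H_intdiff intdiff_gens v)+
  also have "\<dots> = shift_op \<alpha> \<odot> (pm_scale (\<nu> i + 1) \<odot> v) \<oplus> pm_scale (of_int (\<alpha> i)) \<odot> orbit \<alpha>"
    using v by (simp only: smult_comp shift_op_intdiff op_H_intdiff intdiff_gens weight orbit_def)
  also have "\<dots> = pm_scale (\<nu> i + 1) \<odot> orbit \<alpha> \<oplus> pm_scale (of_int (\<alpha> i)) \<odot> orbit \<alpha>"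
    by (simp only: scale_commute[OF shift_op_intdiff v] orbit_def)
  also have "\<dots> = pm_scale (wt \<nu> \<alpha> i) \<odot> orbit \<alpha>"
    using scale_plus[of "orbit \<alpha>" "\<nu> i + 1" "of_int (\<alpha> i)"] by (simp add: wt_def algebra_simps)
  finally show ?thesis .
qed

definition orbit_map :: "(('n \<Rightarrow> int) \<Rightarrow>\<^sub>0 'k) \<Rightarrow> 'm" where
  "orbit_map p = finsum M (\<lambda>\<alpha>. pm_scale (lookup p \<alpha>) \<odot> orbit \<alpha>) (keys p)"

lemma orbit_map_superset:
  assumes "finite A" "keys p \<subseteq> A"
  shows "orbit_map p = finsum M (\<lambda>\<alpha>. pm_scale (lookup p \<alpha>) \<odot> orbit \<alpha>) A"
  unfolding orbit_map_def
  by (rule M.add.finprod_mono_neutral_cong_left[OF assms])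
     (auto simp: in_keys_iff scale_zero intro!: smult_closed)

lemma orbit_map_closed [simp]: "orbit_map p \<in> carrier M"
  unfolding orbit_map_def by (rule M.finsum_closed) (auto intro!: smult_closed)

lemma orbit_map_zero: "orbit_map 0 = \<zero>"
  by (simp add: orbit_map_def)

lemma orbit_map_add: "orbit_map (p + q) = orbit_map p \<oplus> orbit_map q"
proof -
  let ?A = "keys p \<union> keys q"
  have "orbit_map (p + q) = finsum M (\<lambda>\<alpha>. pm_scale (lookup p \<alpha>) \<odot> orbit \<alpha> \<oplus>
      pm_scale (lookup q \<alpha>) \<odot> orbit \<alpha>) ?A"
    using keys_add[of p q] by (subst orbit_map_superset[of ?A]) (auto simp: lookup_add scale_plus)
  also have "\<dots> = orbit_map p \<oplus> orbit_map q"
    by (subst M.finsum_addf) (auto simp: orbit_map_superset[of ?A] intro!: smult_closed)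
  finally show ?thesis .
qed

lemma orbit_map_scale: "orbit_map (pm_scale c p) = pm_scale c \<odot> orbit_map p"
proof -
  have "orbit_map (pm_scale c p) = finsum M (\<lambda>\<alpha>. pm_scale c \<odot> (pm_scale (lookup p \<alpha>) \<odot> orbit \<alpha>)) (keys p)"
    using keys_pm_scale[of c p] by (subst orbit_map_superset[of "keys p"]) (auto simp: scale_scale)
  also have "\<dots> = pm_scale c \<odot> orbit_map p"
    unfolding orbit_map_def by (subst smult_finsum) (auto intro!: smult_closed)
  finally show ?thesis .
qed

lemma orbit_map_single: "orbit_map (single \<alpha> c) = pm_scale c \<odot> orbit \<alpha>"
  by (subst orbit_map_superset[of "{\<alpha>}"]) (auto simp: smult_closed)

lemma orbit_map_sum: "finite A \<Longrightarrow> orbit_map (sum g A) = finsum M (\<lambda>a. orbit_map (g a)) A"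
  by (induction A rule: finite_induct) (auto simp: orbit_map_zero orbit_map_add)

text \<open>Compatibility with an operator can be tested on basis vectors against any one of its
  symbols, so the explicit symbols of the generators can be inserted.\<close>

lemma orbit_map_action:
  assumes b: "b \<in> carrier intdiff_alg" and s: "symbol S b h"
    and act: "\<And>\<alpha>. \<alpha> \<in> orthant S \<Longrightarrow> b \<odot> orbit \<alpha> = orbit_map (h \<nu> \<alpha>)"
    and p: "keys p \<subseteq> orthant S"
  shows "b \<odot> orbit_map p = orbit_map (rep S \<nu> b p)"
proof -
  have "b \<odot> orbit_map p = finsum M (\<lambda>\<alpha>. b \<odot> (pm_scale (lookup p \<alpha>) \<odot> orbit \<alpha>)) (keys p)"
    unfolding orbit_map_def using b by (intro smult_finsum) (auto intro!: smult_closed)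
  also have "\<dots> = finsum M (\<lambda>\<alpha>. orbit_map (pm_scale (lookup p \<alpha>) (h \<nu> \<alpha>))) (keys p)"
    using p by (intro M.finsum_cong') (auto simp: scale_commute[OF b] act orbit_map_scale subset_iff intro!: smult_closed)
  also have "\<dots> = orbit_map (rep S \<nu> b p)"
    by (simp add: rep_symbol[OF s nu p] lin_ext_def orbit_map_sum)
  finally show ?thesis .
qed

lemma orbit_map_smult:
  assumes "b \<in> carrier intdiff_alg" "keys p \<subseteq> orthant S"
  shows "orbit_map (rep S \<nu> b p) = b \<odot> orbit_map p"
  using assms
proof (induction arbitrary: p rule: intdiff_induct)
  case (x i)
  show ?case
  proof (rule orbit_map_action[OF _ symbol_x _ x, symmetric])
    fix \<alpha> assume a: "\<alpha> \<in> orthant S"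
    have "op_x i \<odot> orbit \<alpha> = op_int i \<odot> (op_H i \<odot> orbit \<alpha>)"
      unfolding op_x_eq by (rule smult_comp) simp_all
    also have "\<dots> = pm_scale (wt \<nu> \<alpha> i) \<odot> orbit (\<alpha>(i := \<alpha> i + 1))"
      by (simp add: H_orbit scale_commute int_orbit[OF a])
    finally show "op_x i \<odot> orbit \<alpha> = orbit_map (single (\<alpha>(i := \<alpha> i + 1)) (\<nu> i + of_int (\<alpha> i + 1)))"
      by (simp add: orbit_map_single wt_def)
  qed simp
next
  case (d i)
  \<comment> \<open>If the lowered index leaves the orthant, \<open>orbit_outside\<close> matches
    the coefficient 0 of the symbol.\<close>
  show ?case
    by (rule orbit_map_action[OF _ symbol_d _ d, symmetric])
       (auto simp: d_orbit orbit_map_single orbit_outside scale_one scale_zero)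
next
  case (int i)
  show ?case
    by (rule orbit_map_action[OF _ symbol_int _ int, symmetric])
       (auto simp: int_orbit orbit_map_single scale_one)
next
  case (scale c)
  then show ?case by (simp add: rep_scale[OF nu] orbit_map_scale)
next
  case (add f g)
  then show ?case by (simp add: rep_add[OF nu] orbit_map_add smult_plus)
next
  case (comp f g)
  then have "orbit_map (rep S \<nu> (f \<circ> g) p) = f \<odot> (g \<odot> orbit_map p)"
    using rep_comp[OF nu comp.prems comp.hyps] rep_keys[OF comp.hyps(2) comp.prems] by simp
  then show ?case using smult_comp[OF comp.hyps, of "orbit_map p"] orbit_map_closed[of p] by (simp only:)
qed

text \<open>The basis vector of index 0 is sent to v, so the map is nonzero and \<open>schur\<close>
  applies.\<close>

lemma std_iso:
  assumes "simple_module intdiff_alg M" "v \<noteq> \<zero>"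
  shows "module_isomorphic intdiff_alg (std_module S \<nu>) M"
proof -
  have "mod_iso intdiff_alg (std_module S \<nu>) M orbit_map"
  proof (rule schur[OF simple_std[OF nu] assms(1), of _ "single (\<lambda>_. 0) 1"])
    show "orbit_map (single (\<lambda>_. 0) 1) \<noteq> \<zero>"
      using assms(2) v by (simp add: orbit_map_single orbit_def shift_op_zero scale_one smult_id smult_closed del: comp_apply)
  qed (simp_all add: orbit_map_add orbit_map_smult orthant_def)
  then show ?thesis by (auto simp: module_isomorphic_iff)
qed

end

lemma simple_module_iso_std:
  assumes simple: "simple_module intdiff_alg M" and gw: "gen_weight_space M w0 \<noteq> {\<zero>}"
  shows "\<exists>S \<nu>. (\<forall>i\<in>S. \<nu> i = 0) \<and> module_isomorphic intdiff_alg (std_module S \<nu>) M"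
proof -
  have "\<zero> \<in> weight_space M w0"
    by (simp add: weight_space_eq smult_r_null)
  then obtain v0 where v0: "v0 \<in> gen_weight_space M w0" "v0 \<noteq> \<zero>"
    using gw weight_space_subset_gen by blast
  \<comment> \<open>The weight is left existential because each \<partial>_i changes it.\<close>
  define P where "P u \<longleftrightarrow> (\<exists>w. \<forall>i. op_H i \<odot> u = pm_scale (w i) \<odot> u)" for u
  have "\<exists>u\<in>carrier M. u \<noteq> \<zero> \<and> True \<and> (\<forall>i\<in>UNIV. H_shift w0 i \<odot> u = \<zero>)"
  proof (rule common_kernel[of _ _ _ _ "\<lambda>_. True" v0])
    fix i j :: 'n and x assume x: "x \<in> carrier M"
    show "H_shift w0 i \<odot> (H_shift w0 j \<odot> x) = H_shift w0 j \<odot> (H_shift w0 i \<odot> x)"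
      using smult_comp[OF H_shift_intdiff H_shift_intdiff x] H_shift_commute by metis
  next
    fix i :: 'n
    have "((\<lambda>x. H_shift w0 i \<odot> x) ^^ k) v0 = (H_shift w0 i ^^ k) \<odot> v0" for k
    proof (induction k)
      case 0
      then show ?case using smult_id gen_weight_space_nilpotent(1)[OF v0(1)] by (simp add: id_def)
    next
      case (Suc k)
      have "((\<lambda>x. H_shift w0 i \<odot> x) ^^ Suc k) v0 = H_shift w0 i \<odot> ((H_shift w0 i ^^ k) \<odot> v0)"
        by (simp only: funpow.simps comp_apply Suc)
      also have "\<dots> = (H_shift w0 i \<circ> (H_shift w0 i ^^ k)) \<odot> v0"
        by (rule smult_comp[OF H_shift_intdiff H_shift_power_intdiff gen_weight_space_nilpotent(1)[OF v0(1)], symmetric])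
      also have "H_shift w0 i \<circ> (H_shift w0 i ^^ k) = H_shift w0 i ^^ Suc k"
        by (simp only: funpow.simps)
      finally show ?case .
    qed
    then show "\<exists>k. ((\<lambda>x. H_shift w0 i \<odot> x) ^^ k) v0 = \<zero>"
      using gen_weight_space_nilpotent(2)[OF v0(1), of i] by simp
  qed (use v0 gen_weight_space_nilpotent(1)[OF v0(1)] in \<open>auto simp: smult_closed smult_r_null\<close>)
  then obtain u where u: "u \<in> carrier M" "u \<noteq> \<zero>" "\<And>i. op_H i \<odot> u = pm_scale (w0 i) \<odot> u"
    using H_shift_eq_zero_iff by auto
  define S where "S = {i. \<exists>x\<in>carrier M. x \<noteq> \<zero> \<and> op_d i \<odot> x = \<zero>}"
  have "\<exists>v\<in>carrier M. v \<noteq> \<zero> \<and> P v \<and> (\<forall>i\<in>S. op_d i \<odot> v = \<zero>)"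
  proof (rule common_kernel[of _ _ _ _ P u])
    fix i j :: 'n and x assume x: "x \<in> carrier M"
    have "op_d i \<circ> op_d j = (op_d j \<circ> op_d i :: ('n, 'k) mpol_op)" by (rule op_d_commute[of _ j]) auto
    then show "op_d i \<odot> (op_d j \<odot> x) = op_d j \<odot> (op_d i \<odot> x)"
      using smult_comp[OF intdiff_gens(2) intdiff_gens(2) x] by metis
  next
    fix i :: 'n and x assume x: "x \<in> carrier M" "P x"
    then obtain w where w: "\<And>j. op_H j \<odot> x = pm_scale (w j) \<odot> x" by (auto simp: P_def)
    let ?c = "\<lambda>j. if i = j then -1 else 0 :: 'k"
    have "op_H j \<odot> (op_d i \<odot> x) = pm_scale (w j + ?c j) \<odot> (op_d i \<odot> x)" for j
    proof -
      have "op_H j \<odot> (op_d i \<odot> x) = (op_H j \<circ> op_d i) \<odot> x"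
        using x by (intro smult_comp[symmetric]) auto
      also have "\<dots> = (op_d i \<circ> op_H j) \<odot> x \<oplus> (pm_scale (?c j) \<circ> op_d i) \<odot> x"
        unfolding op_H_d by (rule smult_plus) (intro intdiff_closed op_H_intdiff intdiff_gens x)+
      also have "\<dots> = pm_scale (w j) \<odot> (op_d i \<odot> x) \<oplus> pm_scale (?c j) \<odot> (op_d i \<odot> x)"
        using x by (simp only: smult_comp intdiff_gens op_H_intdiff w scale_commute)
      also have "\<dots> = pm_scale (w j + ?c j) \<odot> (op_d i \<odot> x)"
        using x by (intro scale_plus[symmetric] d_closed)
      finally show ?thesis .
    qed
    then show "P (op_d i \<odot> x)" unfolding P_def by (intro exI[of _ "\<lambda>j. w j + ?c j"] allI)
  next
    fix i assume "i \<in> S"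
    then obtain x where x: "x \<in> carrier M" "x \<noteq> \<zero>" "op_d i \<odot> x = \<zero>" by (auto simp: S_def)
    let ?T = "{x \<in> carrier M. \<exists>k. ((\<lambda>x. op_d i \<odot> x) ^^ k) x = \<zero>}"
    have "((\<lambda>x. op_d i \<odot> x) ^^ 1) x = \<zero>" using x by simp
    then have "x \<in> ?T" using x by blast
    then have "?T = carrier M"
      using simple submodule_eventually_killed[of i] x(2) unfolding simple_module_def by blast
    then show "\<exists>k. ((\<lambda>x. op_d i \<odot> x) ^^ k) u = \<zero>" using u(1) by blast
  qed (use u in \<open>auto simp: smult_closed smult_r_null P_def\<close>)
  then obtain v w where v: "v \<in> carrier M" "v \<noteq> \<zero>" "\<And>i. i \<in> S \<Longrightarrow> op_d i \<odot> v = \<zero>"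
    "\<And>i. op_H i \<odot> v = pm_scale (w i) \<odot> v"
    unfolding P_def by blast
  \<comment> \<open>The relation \<open>H_i = x_i \<partial>_i + 1\<close> gives v the eigenvalue 1
    for i in \<open>S\<close>. The parameter \<open>w i - 1\<close> accounts for the offset 1 in the
    weight of index 0.\<close>
  have nu: "\<forall>i\<in>S. w i - 1 = 0"
  proof
    fix i assume i: "i \<in> S"
    have "op_H i \<odot> v = (op_x i \<circ> op_d i) \<odot> v \<oplus> id \<odot> v"
      unfolding op_H_eq by (rule smult_plus) (intro intdiff_closed intdiff_gens id_intdiff v)+
    also have "(op_x i \<circ> op_d i) \<odot> v = op_x i \<odot> (op_d i \<odot> v)"
      using v by (intro smult_comp) auto
    finally have "pm_scale (w i) \<odot> v = v"
      using v(1) v(3)[OF i] v(4)[of i] smult_id[OF v(1)] by (simp only: smult_r_null intdiff_gens M.l_zero)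
    then have "pm_scale (w i - 1) \<odot> v = \<zero>"
      using scale_plus[OF v(1), of "w i" "-1"] scale_minus[OF v(1), of 1] scale_one[OF v(1)] v(1) by (simp add: M.r_neg)
    then show "w i - 1 = 0" using scale_eq_zero[OF v(1)] v(2) by blast
  qed
  have "module_isomorphic intdiff_alg (std_module S (\<lambda>i. w i - 1)) M"
    by (rule std_iso[OF nu v(1) _ v(3) _ simple v(2)]) (use v in \<open>auto simp: S_def\<close>)
  with nu show ?thesis by (intro exI conjI)
qed

end

section \<open>Multilinear extension\<close>

text \<open>Two nested inductions: on the set of slots not yet holding a basis vector, and for one
  such slot on a finite set containing its support. The sets \<open>C j\<close> confine the
  supports, since in a tensor product of models the slots are limited to orthants.\<close>

lemma multi_induct:
  fixes Pr :: "('n::finite \<Rightarrow> ('b \<Rightarrow>\<^sub>0 'k::field)) \<Rightarrow> bool"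
  assumes zero: "\<And>q i. (\<forall>j. keys (q j) \<subseteq> C j) \<Longrightarrow> q i = 0 \<Longrightarrow> Pr q"
    and add: "\<And>q i a b. (\<forall>j. keys (q j) \<subseteq> C j) \<Longrightarrow> keys a \<subseteq> C i \<Longrightarrow>
      keys b \<subseteq> C i \<Longrightarrow> Pr (q(i := a)) \<Longrightarrow> Pr (q(i := b)) \<Longrightarrow> Pr (q(i := a + b))"
    and scale: "\<And>q i a c. (\<forall>j. keys (q j) \<subseteq> C j) \<Longrightarrow> keys a \<subseteq> C i \<Longrightarrow>
      Pr (q(i := a)) \<Longrightarrow> Pr (q(i := pm_scale c a))"
    and single: "\<And>\<beta>. (\<forall>j. \<beta> j \<in> C j) \<Longrightarrow> Pr (\<lambda>j. single (\<beta> j) 1)"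
    and q: "\<forall>j. keys (q j) \<subseteq> C j"
  shows "Pr q"
proof -
  have "Pr q" if "finite U" "\<forall>j. keys (q j) \<subseteq> C j"
    "\<forall>j. j \<notin> U \<longrightarrow> (\<exists>\<beta>\<in>C j. q j = single \<beta> 1)" for U q
    using that
  proof (induction U arbitrary: q rule: finite_induct)
    case empty
    then have "\<forall>j. \<exists>\<beta>. \<beta> \<in> C j \<and> q j = single \<beta> 1" by blast
    then obtain \<beta> where "\<forall>j. \<beta> j \<in> C j \<and> q j = single (\<beta> j) 1" using choice by meson
    then have "\<forall>j. \<beta> j \<in> C j" "q = (\<lambda>j. single (\<beta> j) 1)" by auto
    then show ?case using single by simp
  next
    case (insert u U)
    have "Pr (q(u := p))" if "finite A" "keys p \<subseteq> A" "keys p \<subseteq> C u" for A p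
      using that
    proof (induction A arbitrary: p rule: finite_induct)
      case empty
      then have "p = 0" by (auto simp: poly_mapping_eq_iff fun_eq_iff in_keys_iff)
      then show ?case using insert.prems(1) by (intro zero[of _ u]) auto
    next
      case (insert \<gamma> A)
      show ?case
      proof (cases "\<gamma> \<in> keys p")
        case False
        then have "keys p \<subseteq> A" using insert.prems(1) by blast
        then show ?thesis using insert.IH insert.prems(2) by blast
      next
        case True
        let ?a = "pm_scale (lookup p \<gamma>) (single \<gamma> 1)"
        have k: "keys (p - ?a) \<subseteq> keys p - {\<gamma>}"
          by (auto simp: in_keys_iff lookup_minus lookup_single when_def split: if_splits)
        have "keys (p - ?a) \<subseteq> A" "keys (p - ?a) \<subseteq> C u"
          using k insert.prems by blast+
        then have 1: "Pr (q(u := p - ?a))" by (rule insert.IH)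
        have g: "\<gamma> \<in> C u" using True insert.prems(2) by blast
        have "Pr (q(u := single \<gamma> 1))"
          using \<open>\<forall>j. keys (q j) \<subseteq> C j\<close> \<open>\<forall>j. j \<notin> Set.insert u U \<longrightarrow> _\<close> g
          by (intro \<open>\<And>q. \<lbrakk>\<forall>j. keys (q j) \<subseteq> C j; \<forall>j. j \<notin> U \<longrightarrow> _ q j\<rbrakk> \<Longrightarrow> Pr q\<close>) auto
        then have 2: "Pr (q(u := ?a))"
          using \<open>\<forall>j. keys (q j) \<subseteq> C j\<close> g by (intro scale) auto
        have "Pr (q(u := ?a + (p - ?a)))"
          using \<open>\<forall>j. keys (q j) \<subseteq> C j\<close> g k insert.prems(2) 1 2
            keys_pm_scale[of "lookup p \<gamma>" "single \<gamma> 1"]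
          by (intro add) (auto split: if_splits)
        moreover have "?a + (p - ?a) = p" by simp
        ultimately show ?thesis by (simp only:)
      qed
    qed
    from this[OF finite_keys order_refl, of "q u"] show ?case using insert.prems(1) by simp
  qed
  from this[of UNIV q] show ?thesis using q by simp
qed

lemma multi_eq:
  fixes F G :: "('n::finite \<Rightarrow> ('b \<Rightarrow>\<^sub>0 'k::field)) \<Rightarrow> ('c \<Rightarrow>\<^sub>0 'k)"
  assumes "\<And>q i a b. F (q(i := a + b)) = F (q(i := a)) + F (q(i := b))"
    and "\<And>q i a b. G (q(i := a + b)) = G (q(i := a)) + G (q(i := b))"
    and Fs: "\<And>q i a c. F (q(i := pm_scale c a)) = pm_scale c (F (q(i := a)))"
    and Gs: "\<And>q i a c. G (q(i := pm_scale c a)) = pm_scale c (G (q(i := a)))"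
    and "\<And>\<beta>. F (\<lambda>j. single (\<beta> j) 1) = G (\<lambda>j. single (\<beta> j) 1)"
  shows "F q = G q"
proof (rule multi_induct[of "\<lambda>_. UNIV" "\<lambda>q. F q = G q" q])
  fix q :: "'n \<Rightarrow> ('b \<Rightarrow>\<^sub>0 'k)" and i assume "q i = 0"
  then have "q = q(i := pm_scale 0 (q i))" by (auto simp: fun_eq_iff)
  then have "F q = 0" "G q = 0"
    using Fs[of q i 0 "q i"] Gs[of q i 0 "q i"] by simp_all
  then show "F q = G q" by simp
qed (use assms in simp_all)

lemma prod_additive:
  fixes f :: "'n::finite \<Rightarrow> 'a \<Rightarrow> 'b::comm_ring_1"
  assumes "f i c = f i a + f i b"
  shows "(\<Prod>j\<in>UNIV. f j ((q(i := c)) j)) = (\<Prod>j\<in>UNIV. f j ((q(i := a)) j)) + (\<Prod>j\<in>UNIV. f j ((q(i := b)) j))"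
proof -
  have "(\<Prod>j\<in>UNIV. f j ((q(i := d)) j)) = f i d * (\<Prod>j\<in>UNIV - {i}. f j (q j))" for d
    by (subst prod.remove[of _ i]) (auto intro!: prod.cong)
  then show ?thesis using assms by (simp add: distrib_right)
qed

lemma prod_homogeneous:
  fixes f :: "'n::finite \<Rightarrow> 'a \<Rightarrow> 'b::comm_ring_1"
  assumes "f i c = d * f i a"
  shows "(\<Prod>j\<in>UNIV. f j ((q(i := c)) j)) = d * (\<Prod>j\<in>UNIV. f j ((q(i := a)) j))"
proof -
  have "(\<Prod>j\<in>UNIV. f j ((q(i := d)) j)) = f i d * (\<Prod>j\<in>UNIV - {i}. f j (q j))" for d
    by (subst prod.remove[of _ i]) (auto intro!: prod.cong)
  then show ?thesis using assms by (simp add: mult.assoc)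
qed

section \<open>Tensor products of vectors and of operators\<close>

text \<open>The pure tensor of the vectors \<open>q i\<close>, under the identification of the
  tensor product of the spaces with basis the integers with the space with basis the integer
  vectors.\<close>

definition tens :: "('n::finite \<Rightarrow> ((unit \<Rightarrow> int) \<Rightarrow>\<^sub>0 'k::field)) \<Rightarrow> (('n \<Rightarrow> int) \<Rightarrow>\<^sub>0 'k)" where
  "tens q = Abs_poly_mapping (\<lambda>\<gamma>. \<Prod>i\<in>UNIV. lookup (q i) (\<lambda>_. \<gamma> i))"

lemma finite_coordinates:
  fixes Q :: "'n::finite \<Rightarrow> (unit \<Rightarrow> int) set"
  assumes "\<And>i. finite (Q i)"
  shows "finite {\<gamma>. \<forall>i. (\<lambda>_. \<gamma> i) \<in> Q i}"
proof (rule finite_subset)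
  show "{\<gamma>. \<forall>i. (\<lambda>_. \<gamma> i) \<in> Q i} \<subseteq> PiE UNIV (\<lambda>i. (\<lambda>\<beta>. \<beta> ()) ` Q i)"
    by (force simp: PiE_def Pi_def image_iff)
  show "finite (PiE UNIV (\<lambda>i. (\<lambda>\<beta>. \<beta> ()) ` Q i))"
    using assms by (intro finite_PiE) auto
qed

lemma lookup_tens: "lookup (tens q) \<gamma> = (\<Prod>i\<in>UNIV. lookup (q i) (\<lambda>_. \<gamma> i))"
proof -
  have "{\<gamma>. (\<Prod>i\<in>UNIV. lookup (q i) (\<lambda>_. \<gamma> i)) \<noteq> 0} = {\<gamma>. \<forall>i. (\<lambda>_. \<gamma> i) \<in> keys (q i)}"
    by (auto simp: in_keys_iff)
  then show ?thesis
    unfolding tens_def by (subst lookup_Abs_poly_mapping) (simp_all add: finite_coordinates)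
qed

lemma keys_tens: "keys (tens q) = {\<gamma>. \<forall>i. (\<lambda>_. \<gamma> i) \<in> keys (q i)}"
  by (auto simp: in_keys_iff lookup_tens)

lemma tens_add: "tens (q(i := a + b)) = tens (q(i := a)) + tens (q(i := b))"
  by (rule poly_mapping_eqI)
     (simp only: lookup_tens lookup_add, rule prod_additive[of "\<lambda>i p. lookup p (\<lambda>_. _ i)"], simp add: lookup_add)

lemma tens_scale: "tens (q(i := pm_scale c a)) = pm_scale c (tens (q(i := a)))"
  by (rule poly_mapping_eqI)
     (simp only: lookup_tens lookup_pm_scale, rule prod_homogeneous[of "\<lambda>i p. lookup p (\<lambda>_. _ i)"], simp)

lemma tens_single:
  fixes \<beta> :: "'n::finite \<Rightarrow> unit \<Rightarrow> int"
  shows "tens (\<lambda>i. single (\<beta> i) (1 :: 'k::field)) = single (\<lambda>i. \<beta> i ()) 1"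
proof (rule poly_mapping_eqI)
  fix \<gamma> :: "'n \<Rightarrow> int"
  have e: "\<beta> i = (\<lambda>_. \<gamma> i) \<longleftrightarrow> \<beta> i () = \<gamma> i" for i by (auto simp: fun_eq_iff)
  show "lookup (tens (\<lambda>i. single (\<beta> i) (1 :: 'k))) \<gamma> =
      lookup (single (\<lambda>i. \<beta> i ()) 1) \<gamma>"
  proof (cases "\<gamma> = (\<lambda>i. \<beta> i ())")
    case True
    then show ?thesis by (simp add: lookup_tens lookup_single e)
  next
    case False
    then obtain i where "\<beta> i () \<noteq> \<gamma> i" unfolding fun_eq_iff by metis
    then have "(\<Prod>i\<in>UNIV. lookup (single (\<beta> i) (1 :: 'k)) (\<lambda>_. \<gamma> i)) = 0"
      by (intro prod_zero) (auto simp: lookup_single e when_def)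
    then show ?thesis using False by (simp add: lookup_tens lookup_single when_def)
  qed
qed

lemma pm_scale_mult: "pm_scale c p = single 0 c * (p :: ('n, 'k::field) mpol)"
  by (simp add: pm_scale_def mult_map_scale_conv_mult)

lemma plin_in_var: "plin (in_var i)"
  by (simp add: in_var_def plin_lin_ext)

lemma plin_tensor_op: "plin (tensor_op a)"
  by (simp add: tensor_op_def plin_lin_ext)

lemma prod_single_mpol:
  "(\<Prod>i\<in>A. single (f i) (c i) :: ('n, 'k::field) mpol) = single (\<Sum>i\<in>A. f i) (\<Prod>i\<in>A. c i)"
  by (induction A rule: infinite_finite_induct) (simp_all add: mult_single)

lemma sum_single_Abs: "(\<Sum>i\<in>UNIV. single i (f i)) = Abs_poly_mapping (f :: 'n::finite \<Rightarrow> nat)"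
  by (rule poly_mapping_eqI) (simp add: lookup_sum lookup_single when_def)

lemma prod_in_var_additive:
  fixes g :: "'n::finite \<Rightarrow> ('b \<Rightarrow>\<^sub>0 'k::field_char_0) \<Rightarrow> (unit, 'k) mpol"
  assumes "\<And>i. plin (g i)"
  shows "(\<Prod>j\<in>UNIV. in_var j (g j ((q(i := a + b)) j))) =
    (\<Prod>j\<in>UNIV. in_var j (g j ((q(i := a)) j))) + (\<Prod>j\<in>UNIV. in_var j (g j ((q(i := b)) j)))"
  by (rule prod_additive[of "\<lambda>j p. in_var j (g j p)"]) (simp add: plin_add[OF assms] plin_add[OF plin_in_var])

lemma prod_in_var_scale:
  fixes g :: "'n::finite \<Rightarrow> ('b \<Rightarrow>\<^sub>0 'k::field_char_0) \<Rightarrow> (unit, 'k) mpol"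
  assumes "\<And>i. plin (g i)"
  shows "(\<Prod>j\<in>UNIV. in_var j (g j ((q(i := pm_scale c a)) j))) = pm_scale c (\<Prod>j\<in>UNIV. in_var j (g j ((q(i := a)) j)))"
  unfolding pm_scale_mult[of c "prod _ _"]
  by (rule prod_homogeneous[of "\<lambda>j p. in_var j (g j p)"])
     (simp only: plin_scale[OF assms] plin_scale[OF plin_in_var] pm_scale_mult[symmetric])

lemma plin_ident: "plin (\<lambda>p. p)"
  by (rule plinI) auto

text \<open>\<open>tensor_op\<close> is defined through its values on monomials; both sides are
  multilinear in p, so agreement on tuples of monomials suffices.\<close>

lemma tensor_op_prod:
  fixes a :: "'n::finite \<Rightarrow> (unit, 'k::field_char_0) mpol_op"
  assumes a: "\<And>i. plin (a i)"
  shows "tensor_op a (\<Prod>i\<in>UNIV. in_var i (p i)) = (\<Prod>i\<in>UNIV. in_var i (a i (p i)))"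
proof (rule multi_eq[of "\<lambda>p. tensor_op a (\<Prod>i\<in>UNIV. in_var i (p i))" "\<lambda>p. \<Prod>i\<in>UNIV. in_var i (a i (p i))"])
  show "tensor_op a (\<Prod>j\<in>UNIV. in_var j ((q(i := x + y)) j)) =
      tensor_op a (\<Prod>j\<in>UNIV. in_var j ((q(i := x)) j)) + tensor_op a (\<Prod>j\<in>UNIV. in_var j ((q(i := y)) j))" for q i x y
    using prod_in_var_additive[of "\<lambda>_ p. p" q i x y] by (simp only: plin_ident plin_add[OF plin_tensor_op])
  show "tensor_op a (\<Prod>j\<in>UNIV. in_var j ((q(i := pm_scale c x)) j)) =
      pm_scale c (tensor_op a (\<Prod>j\<in>UNIV. in_var j ((q(i := x)) j)))" for q i x c
    using prod_in_var_scale[of "\<lambda>_ p. p" q i c x] by (simp only: plin_ident plin_scale[OF plin_tensor_op])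
  show "(\<Prod>j\<in>UNIV. in_var j (a j ((q(i := x + y)) j))) =
      (\<Prod>j\<in>UNIV. in_var j (a j ((q(i := x)) j))) + (\<Prod>j\<in>UNIV. in_var j (a j ((q(i := y)) j)))" for q i x y
    by (rule prod_in_var_additive[OF a])
  show "(\<Prod>j\<in>UNIV. in_var j (a j ((q(i := pm_scale c x)) j))) =
      pm_scale c (\<Prod>j\<in>UNIV. in_var j (a j ((q(i := x)) j)))" for q i x c
    by (rule prod_in_var_scale[OF a])
  fix \<beta> :: "'n \<Rightarrow> unit \<Rightarrow>\<^sub>0 nat"
  have e: "single () (lookup (\<beta> i) ()) = \<beta> i" for i
    by (rule poly_mapping_eqI) simp
  show "tensor_op a (\<Prod>i\<in>UNIV. in_var i (single (\<beta> i) 1)) =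
      (\<Prod>i\<in>UNIV. in_var i (a i (single (\<beta> i) 1)))"
    by (simp add: in_var_def prod_single_mpol sum_single_Abs tensor_op_def e
        del: lookup_Abs_poly_mapping)
qed

text \<open>Factorials multiply slot by slot and exponents occupy separate variables; a negative
  exponent makes one factor zero, in accordance with the convention on the right.\<close>

lemma prod_in_var_dpow: "(\<Prod>i\<in>UNIV. in_var i (dpow (\<lambda>_. \<beta> i))) = (dpow \<beta> :: ('n::finite, 'k::field_char_0) mpol)"
proof (cases "\<forall>i. 0 \<le> \<beta> i")
  case True
  have "in_var i (dpow (\<lambda>_. \<beta> i)) = (single (single i (nat (\<beta> i))) (1 / fact (nat (\<beta> i))) :: ('n, 'k) mpol)" for i
    using True by (simp add: dpow_nonneg in_var_def pm_scale_single)
  then show ?thesis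
    using True by (simp add: dpow_nonneg prod_single_mpol sum_single_Abs prod_dividef)
next
  case False
  then obtain i where i: "\<beta> i < 0" by (auto simp: not_le)
  then have "in_var i (dpow (\<lambda>_. \<beta> i)) = (0 :: ('n, 'k) mpol)"
    by (simp add: dpow_neg[of _ "()"] plin_zero[OF plin_in_var])
  then have "(\<Prod>i\<in>UNIV. in_var i (dpow (\<lambda>_. \<beta> i))) = (0 :: ('n, 'k) mpol)"
    by (intro prod_zero) auto
  then show ?thesis using i by (simp add: dpow_neg[of _ i])
qed

lemma tensor_op_dpow:
  assumes "\<And>i. plin (a i)"
  shows "tensor_op a (dpow \<beta>) = (\<Prod>i\<in>UNIV. in_var i (a i (dpow (\<lambda>_. \<beta> i))))"
  using tensor_op_prod[OF assms, where p = "\<lambda>i. dpow (\<lambda>_. \<beta> i)"] by (simp only: prod_in_var_dpow)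

lemma tensor_op_comp:
  fixes a :: "'n::finite \<Rightarrow> (unit, 'k::field_char_0) mpol_op"
  assumes "\<And>i. plin (a i)" "\<And>i. plin (b i)"
  shows "tensor_op a (tensor_op b p) = tensor_op (\<lambda>i. a i \<circ> b i) p"
proof (rule dpow_eqI[OF plin_comp[OF plin_tensor_op plin_tensor_op] plin_tensor_op])
  fix \<beta> :: "'n \<Rightarrow> int"
  have "plin (a i \<circ> b i)" for i using plin_comp[OF assms] by (simp add: comp_def)
  then show "tensor_op a (tensor_op b (dpow \<beta>)) = tensor_op (\<lambda>i. a i \<circ> b i) (dpow \<beta>)"
    by (simp only: tensor_op_dpow assms tensor_op_prod comp_apply)
qed

text \<open>One scheme for x_i, \<partial>_i and \<integral>_i: each acts on divided powers through
  the exponent of x_i alone, with coefficient \<open>c\<close> and new exponent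
  \<open>e\<close>.\<close>

lemma tensor_op_gen:
  fixes g :: "(unit, 'k::field_char_0) mpol_op" and f :: "('n::finite, 'k) mpol_op"
  assumes "plin g" "plin f"
    and "\<And>b. 0 \<le> b \<Longrightarrow> g (dpow (\<lambda>_. b)) = pm_scale (c b) (dpow (\<lambda>_. e b))"
    and "\<And>\<beta>. (\<And>j. 0 \<le> \<beta> j) \<Longrightarrow> f (dpow \<beta>) = pm_scale (c (\<beta> i)) (dpow (\<beta>(i := e (\<beta> i))))"
  shows "f = tensor_op ((\<lambda>_. id)(i := g))"
proof
  fix p
  have pl: "plin (((\<lambda>_. id)(i := g)) j)" for j
    using assms(1) plin_ident unfolding id_def by (cases "j = i") simp_all
  show "f p = tensor_op ((\<lambda>_. id)(i := g)) p"
  proof (rule dpow_eqI[OF assms(2) plin_tensor_op])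
    fix \<beta> :: "'n \<Rightarrow> int" assume b: "\<And>j. 0 \<le> \<beta> j"
    have "tensor_op ((\<lambda>_. id)(i := g)) (dpow \<beta>) = (\<Prod>j\<in>UNIV. in_var j ((((\<lambda>_. id)(i := g)) j) (dpow (\<lambda>_. \<beta> j))))"
      by (rule tensor_op_dpow[OF pl])
    also have "\<dots> = (\<Prod>j\<in>UNIV. in_var j (((\<lambda>j. dpow (\<lambda>_. (\<beta>(i := e (\<beta> i))) j))(i := pm_scale (c (\<beta> i)) (dpow (\<lambda>_. e (\<beta> i))))) j))"
      using assms(3)[OF b[of i]] by (intro prod.cong) auto
    also have "\<dots> = pm_scale (c (\<beta> i)) (\<Prod>j\<in>UNIV. in_var j (dpow (\<lambda>_. (\<beta>(i := e (\<beta> i))) j)))"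
      by (subst prod_in_var_scale[OF plin_ident]) (auto intro!: arg_cong[of _ _ "pm_scale _"] prod.cong)
    also have "\<dots> = f (dpow \<beta>)"
      using assms(4)[OF b] by (simp only: prod_in_var_dpow)
    finally show "f (dpow \<beta>) = tensor_op ((\<lambda>_. id)(i := g)) (dpow \<beta>)" ..
  qed
qed

section \<open>Writing operators as sums of pure tensors\<close>

lemma tensor_reps_iff:
  "r \<in> tensor_reps b \<longleftrightarrow> keys r \<subseteq> Pi UNIV (\<lambda>_. carrier intdiff_alg) \<and>
     b = (\<lambda>p. lin_ext (\<lambda>a. tensor_op a p) r)"
  by (simp add: tensor_reps_def lin_ext_def)

lemma tensor_reps_pure:
  "(\<And>i. a i \<in> carrier intdiff_alg) \<Longrightarrow> single a 1 \<in> tensor_reps (tensor_op a)"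
  by (simp add: tensor_reps_iff)

text \<open>Scalar multiplication on the tensor product is a union over all representations of an
  operator, so it is meaningful only if there is one.\<close>

lemma tensor_reps_nonempty:
  fixes b :: "('n::finite, 'k::field_char_0) mpol_op"
  assumes "b \<in> carrier intdiff_alg"
  shows "\<exists>r. r \<in> tensor_reps b"
  using assms
proof (induction rule: intdiff_induct)
  case (x i)
  have "op_x i = (tensor_op ((\<lambda>_. id)(i := op_x ())) :: ('n, 'k) mpol_op)"
    by (rule tensor_op_gen[where c = "\<lambda>b. of_int (b + 1)" and e = "\<lambda>b. b + 1"])
       (simp_all add: plin_op_x op_x_dpow, auto intro!: arg_cong[of _ _ "pm_scale _"] arg_cong[of _ _ dpow])
  then show ?case using tensor_reps_pure[of "(\<lambda>_. id)(i := op_x ())"] by (metis fun_upd_apply id_intdiff intdiff_gens(1))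
next
  case (d i)
  have "op_d i = (tensor_op ((\<lambda>_. id)(i := op_d ())) :: ('n, 'k) mpol_op)"
    by (rule tensor_op_gen[where c = "\<lambda>b. 1" and e = "\<lambda>b. b - 1"])
       (simp_all add: plin_op_d op_d_dpow, auto intro!: arg_cong[of _ _ dpow])
  then show ?case using tensor_reps_pure[of "(\<lambda>_. id)(i := op_d ())"] by (metis fun_upd_apply id_intdiff intdiff_gens(2))
next
  case (int i)
  have "op_int i = (tensor_op ((\<lambda>_. id)(i := op_int ())) :: ('n, 'k) mpol_op)"
    by (rule tensor_op_gen[where c = "\<lambda>b. 1" and e = "\<lambda>b. b + 1"])
       (simp_all add: plin_op_int op_int_dpow, auto intro!: arg_cong[of _ _ dpow])
  then show ?case using tensor_reps_pure[of "(\<lambda>_. id)(i := op_int ())"] by (metis fun_upd_apply id_intdiff intdiff_gens(3))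
next
  case (scale c)
  have "tensor_op (\<lambda>_. id) p = (p :: ('n, 'k) mpol)" for p
    by (rule dpow_eqI[OF plin_tensor_op plin_ident])
       (simp add: tensor_op_dpow plin_ident id_def prod_in_var_dpow)
  then have "single (\<lambda>_. id) c \<in> tensor_reps (pm_scale c :: ('n, 'k) mpol_op)"
    by (auto simp: tensor_reps_iff fun_eq_iff)
  then show ?case by blast
next
  case (add f g)
  then obtain r s where "r \<in> tensor_reps f" "s \<in> tensor_reps g" by blast
  then have "r + s \<in> tensor_reps (\<lambda>p. f p + g p)"
    using keys_add[of r s] by (auto simp: tensor_reps_iff lin_ext_add)
  then show ?case by blast
next
  case (comp f g)
  then obtain r s where r: "r \<in> tensor_reps f" and s: "s \<in> tensor_reps g" by blast
  \<comment> \<open>The product of two combinations of pure tensors, expanded; pure tensors multiply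
    slot by slot.\<close>
  define t where "t = lin_ext (\<lambda>a. lin_ext (\<lambda>b. single (\<lambda>i. a i \<circ> b i) (1 :: 'k)) s) r"
  have kr: "a i \<in> carrier intdiff_alg" if "a \<in> keys r" for a i
    using r that by (auto simp: tensor_reps_iff)
  have ks: "a i \<in> carrier intdiff_alg" if "a \<in> keys s" for a i
    using s that by (auto simp: tensor_reps_iff)
  have "keys t \<subseteq> Pi UNIV (\<lambda>_. carrier intdiff_alg)"
    unfolding t_def
  proof (intro keys_lin_ext_subset)
    fix a b assume "a \<in> keys r" "b \<in> keys s"
    then have "a i \<circ> b i \<in> carrier intdiff_alg" for i using kr ks by (intro intdiff_closed)
    then show "keys (single (\<lambda>i. a i \<circ> b i) (1 :: 'k)) \<subseteq> Pi UNIV (\<lambda>_. carrier intdiff_alg)"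
      by (auto simp del: comp_apply)
  qed
  moreover have "f \<circ> g = (\<lambda>p. lin_ext (\<lambda>c. tensor_op c p) t)"
  proof
    fix p
    have "(f \<circ> g) p = lin_ext (\<lambda>a. tensor_op a (lin_ext (\<lambda>b. tensor_op b p) s)) r"
      using r s by (simp add: tensor_reps_iff)
    also have "\<dots> = lin_ext (\<lambda>a. lin_ext (\<lambda>b. tensor_op (\<lambda>i. a i \<circ> b i) p) s) r"
    proof (intro lin_ext_cong)
      fix a assume a: "a \<in> keys r"
      have "tensor_op a (lin_ext (\<lambda>b. tensor_op b p) s) = lin_ext (\<lambda>b. tensor_op a (tensor_op b p)) s"
        by (rule plin_lin_ext_comp[OF plin_tensor_op])
      also have "\<dots> = lin_ext (\<lambda>b. tensor_op (\<lambda>i. a i \<circ> b i) p) s"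
        by (intro lin_ext_cong tensor_op_comp plin_intdiff kr[OF a] ks)
      finally show "tensor_op a (lin_ext (\<lambda>b. tensor_op b p) s) = lin_ext (\<lambda>b. tensor_op (\<lambda>i. a i \<circ> b i) p) s" .
    qed
    also have "\<dots> = lin_ext (\<lambda>c. tensor_op c p) t"
      by (simp add: t_def plin_lin_ext_comp[OF plin_lin_ext] del: comp_apply)
    finally show "(f \<circ> g) p = lin_ext (\<lambda>c. tensor_op c p) t" .
  qed
  ultimately show ?case using tensor_reps_iff by blast
qed

section \<open>The action of pure tensors on the model modules\<close>

text \<open>The symbols of the factors multiply, each evaluated at its own coordinate of \<nu> and
  \<alpha>. As every \<open>T i\<close> is a subset of a one-point type, \<open>S\<close> collects
  the slots in which it is nonempty.\<close>

lemma symbol_tensor_op: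
  fixes a :: "'n::finite \<Rightarrow> (unit, 'k::field_char_0) mpol_op"
  assumes h: "\<And>i. symbol (T i) (a i) (h i)" and S: "S = {i. () \<in> T i}"
  shows "symbol S (tensor_op a) (\<lambda>\<nu> \<alpha>. tens (\<lambda>i. h i (\<lambda>_. \<nu> i) (\<lambda>_. \<alpha> i)))"
proof (rule symbolI)
  show "plin (tensor_op a)" by (rule plin_tensor_op)
  fix \<alpha> assume "\<alpha> \<in> orthant S"
  then have \<alpha>: "(\<lambda>_. \<alpha> i) \<in> orthant (T i)" for i by (auto simp: orthant_def S)
  define P where "P i QN \<longleftrightarrow> finite (fst QN) \<and> fst QN \<subseteq> orthant (T i) \<and>
    (\<forall>\<nu>. keys (h i \<nu> (\<lambda>_. \<alpha> i)) \<subseteq> fst QN) \<and>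
    (\<forall>m. test_point (T i) (snd QN) m \<longrightarrow> a i (dpow (\<lambda>j. \<alpha> i + int (m j))) =
        lin_ext (dpow_at m) (h i (\<lambda>j. of_nat (m j)) (\<lambda>_. \<alpha> i)))" for i QN
  have "\<exists>QN. P i QN" for i
  proof (rule symbolE[OF h[of i] \<alpha>])
    fix Q N
    assume "finite Q" "Q \<subseteq> orthant (T i)" "\<And>\<nu>. keys (h i \<nu> (\<lambda>_. \<alpha> i)) \<subseteq> Q"
      "\<And>m. test_point (T i) N m \<Longrightarrow> a i (dpow (\<lambda>j. \<alpha> i + int (m j))) =
        lin_ext (dpow_at m) (h i (\<lambda>j. of_nat (m j)) (\<lambda>_. \<alpha> i))"
    then show ?thesis by (intro exI[of _ "(Q, N)"]) (simp add: P_def)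
  qed
  then obtain QN where QN: "\<forall>i. P i (QN i)" using choice[of P] by blast
  define Q where "Q = fst \<circ> QN"
  define N where "N = snd \<circ> QN"
  have Q: "finite (Q i)" "Q i \<subseteq> orthant (T i)" "keys (h i \<nu> (\<lambda>_. \<alpha> i)) \<subseteq> Q i"
    "test_point (T i) (N i) m \<Longrightarrow> a i (dpow (\<lambda>j. \<alpha> i + int (m j))) =
        lin_ext (dpow_at m) (h i (\<lambda>j. of_nat (m j)) (\<lambda>_. \<alpha> i))" for i m \<nu>
    using QN by (simp_all add: P_def Q_def N_def)
  let ?Q = "{\<gamma>. \<forall>i. (\<lambda>_. \<gamma> i) \<in> Q i}"
  have "?Q \<subseteq> orthant S"
  proof
    fix \<gamma> assume g: "\<gamma> \<in> ?Q"
    have "0 \<le> \<gamma> i" if "i \<in> S" for i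
    proof -
      have "(\<lambda>_. \<gamma> i) \<in> orthant (T i)" using g Q(2)[of i] by blast
      then show ?thesis using that by (auto simp: orthant_def S)
    qed
    then show "\<gamma> \<in> orthant S" by (simp add: orthant_def)
  qed
  moreover have "finite ?Q" by (rule finite_coordinates) (rule Q(1))
  moreover have "keys (tens (\<lambda>i. h i (\<lambda>_. \<nu> i) (\<lambda>_. \<alpha> i))) \<subseteq> ?Q" for \<nu>
    unfolding keys_tens using Q(3) by blast
  ultimately show "\<exists>Q. finite Q \<and> Q \<subseteq> orthant S \<and> (\<forall>\<nu>. keys (tens (\<lambda>i. h i (\<lambda>_. \<nu> i) (\<lambda>_. \<alpha> i))) \<subseteq> Q)"
    by (intro exI[of _ ?Q] conjI allI)
  show "polyfun (\<lambda>\<nu>. lookup (tens (\<lambda>i. h i (\<lambda>_. \<nu> i) (\<lambda>_. \<alpha> i))) \<gamma>)" for \<gamma>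
    unfolding lookup_tens
    by (rule polyfun_prod) (rule polyfun_restrict[OF symbol_polyfun[OF h \<alpha>]])
  have pl: "plin (a i)" for i by (rule symbol_plin[OF h])
  show "\<exists>N. \<forall>m. test_point S N m \<longrightarrow> tensor_op a (dpow_at m \<alpha>) =
      lin_ext (dpow_at m) (tens (\<lambda>i. h i (\<lambda>_. of_nat (m i)) (\<lambda>_. \<alpha> i)))"
  proof (intro exI allI impI)
    fix m assume m: "test_point S (Max (range N)) m"
    let ?g = "\<lambda>i. lin_ext (\<lambda>\<gamma>. dpow (\<lambda>j. \<gamma> j + int (m i))) :: ((unit \<Rightarrow> int) \<Rightarrow>\<^sub>0 'k) \<Rightarrow> (unit, 'k) mpol"
    have "test_point (T i) (N i) (\<lambda>_. m i)" for i
    proof -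
      have "N i \<le> Max (range N)" by simp
      then show ?thesis using m[unfolded test_point_def, rule_format, of i]
        by (auto simp: test_point_def S split: if_splits)
    qed
    then have ai: "a i (dpow (\<lambda>_. \<alpha> i + int (m i))) = ?g i (h i (\<lambda>_. of_nat (m i)) (\<lambda>_. \<alpha> i))" for i
      using Q(4)[of i "\<lambda>_. m i"] by simp
    have "tensor_op a (dpow_at m \<alpha>) = (\<Prod>i\<in>UNIV. in_var i (?g i (h i (\<lambda>_. of_nat (m i)) (\<lambda>_. \<alpha> i))))"
      by (simp only: tensor_op_dpow[OF pl] ai)
    also have "\<dots> = lin_ext (dpow_at m) (tens (\<lambda>i. h i (\<lambda>_. of_nat (m i)) (\<lambda>_. \<alpha> i)))"
    \<comment> \<open>With the symbols of the factors replaced by arbitrary vectors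
      \<open>q i\<close>, both sides become multilinear, and tuples of basis vectors
      suffice.\<close>
    proof (rule multi_eq[of "\<lambda>q. \<Prod>i\<in>UNIV. in_var i (?g i (q i))" "\<lambda>q. lin_ext (dpow_at m) (tens q)"])
      fix \<beta> :: "'n \<Rightarrow> unit \<Rightarrow> int"
      have e: "(\<lambda>j. \<beta> i j + int (m i)) = (\<lambda>_. \<beta> i () + int (m i))" for i by auto
      show "(\<Prod>i\<in>UNIV. in_var i (?g i (single (\<beta> i) 1))) =
          lin_ext (dpow_at m) (tens (\<lambda>i. single (\<beta> i) 1))"
        by (simp only: tens_single lin_ext_single e PM.scale_one prod_in_var_dpow)
    qed (simp_all only: tens_add tens_scale lin_ext_add lin_ext_scale prod_in_var_additive[OF plin_lin_ext] prod_in_var_scale[OF plin_lin_ext])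
    finally show "tensor_op a (dpow_at m \<alpha>) =
      lin_ext (dpow_at m) (tens (\<lambda>i. h i (\<lambda>_. of_nat (m i)) (\<lambda>_. \<alpha> i)))" .
  qed
qed

text \<open>The existence of a symbol is recorded separately, because it is what
  \<open>rep_sum\<close> asks of a pure tensor.\<close>

lemma rep_tensor_op:
  fixes a :: "'n::finite \<Rightarrow> (unit, 'k::field_char_0) mpol_op"
  assumes a: "\<And>i. a i \<in> carrier intdiff_alg" and S: "S = {i. () \<in> T i}"
    and nu: "\<And>i. \<forall>u\<in>T i. \<mu> i u = 0" "\<And>i. \<nu> i = \<mu> i ()"
    and q: "\<And>i. keys (q i) \<subseteq> orthant (T i)"
  shows "\<exists>h. symbol S (tensor_op a) h"
    and "rep S \<nu> (tensor_op a) (tens q) = tens (\<lambda>i. rep (T i) (\<mu> i) (a i) (q i))"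
proof -
  have "\<forall>i. \<exists>h. symbol (T i) (a i) h" using symbol_exists[OF a] by blast
  then obtain h where h: "\<And>i. symbol (T i) (a i) (h i)" using choice[of "\<lambda>i h. symbol (T i) (a i) h"] by blast
  note s = symbol_tensor_op[OF h S]
  show "\<exists>h. symbol S (tensor_op a) h" using s by blast
  have mu: "(\<lambda>_. \<nu> i) = \<mu> i" for i by (auto simp: nu(2))
  have "keys (tens q) \<subseteq> orthant S"
    using q by (fastforce simp: keys_tens orthant_def S)
  moreover have "\<forall>i\<in>S. \<nu> i = 0" using nu by (auto simp: S)
  ultimately have "rep S \<nu> (tensor_op a) (tens q) = lin_ext (\<lambda>\<alpha>. tens (\<lambda>i. h i (\<mu> i) (\<lambda>_. \<alpha> i))) (tens q)"
    using rep_symbol[OF s, of \<nu> "tens q"] by (simp add: mu)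
  also have "\<dots> = tens (\<lambda>i. lin_ext (h i (\<mu> i)) (q i))"
  proof (rule multi_eq[of "\<lambda>q. lin_ext (\<lambda>\<alpha>. tens (\<lambda>i. h i (\<mu> i) (\<lambda>_. \<alpha> i))) (tens q)" "\<lambda>q. tens (\<lambda>i. lin_ext (h i (\<mu> i)) (q i))"])
    have upd: "(\<lambda>j. lin_ext (h j (\<mu> j)) ((q(i := x)) j)) = (\<lambda>j. lin_ext (h j (\<mu> j)) (q j))(i := lin_ext (h i (\<mu> i)) x)" for q i x
      by auto
    show "tens (\<lambda>j. lin_ext (h j (\<mu> j)) ((q(i := x + y)) j)) =
        tens (\<lambda>j. lin_ext (h j (\<mu> j)) ((q(i := x)) j)) + tens (\<lambda>j. lin_ext (h j (\<mu> j)) ((q(i := y)) j))" for q i x y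
      by (simp only: upd lin_ext_add tens_add)
    show "tens (\<lambda>j. lin_ext (h j (\<mu> j)) ((q(i := pm_scale c x)) j)) =
        pm_scale c (tens (\<lambda>j. lin_ext (h j (\<mu> j)) ((q(i := x)) j)))" for q i x c
      by (simp only: upd lin_ext_scale tens_scale)
    fix \<beta> :: "'n \<Rightarrow> unit \<Rightarrow> int"
    have "(\<lambda>_. \<beta> i ()) = \<beta> i" for i by auto
    then show "lin_ext (\<lambda>\<alpha>. tens (\<lambda>i. h i (\<mu> i) (\<lambda>_. \<alpha> i))) (tens (\<lambda>i. single (\<beta> i) 1)) =
        tens (\<lambda>i. lin_ext (h i (\<mu> i)) (single (\<beta> i) 1))"
      by (simp only: tens_single lin_ext_single PM.scale_one)
  qed (simp_all only: tens_add tens_scale lin_ext_add lin_ext_scale)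
  also have "\<dots> = tens (\<lambda>i. rep (T i) (\<mu> i) (a i) (q i))"
    by (simp only: rep_symbol[OF h nu(1) q])
  finally show "rep S \<nu> (tensor_op a) (tens q) = tens (\<lambda>i. rep (T i) (\<mu> i) (a i) (q i))" .
qed

text \<open>Hypothesis and conclusion speak of symbols rather than of membership in the algebra, so
  the lemma applies directly to pure tensors. It is the reason why the action does not depend on how
  an operator is written as a combination of them.\<close>

lemma rep_sum:
  fixes f :: "'a \<Rightarrow> ('n::finite, 'k::field_char_0) mpol_op"
  assumes nu: "\<forall>i\<in>S. \<nu> i = 0" and p: "keys p \<subseteq> orthant S"
    and "finite A" "\<And>a. a \<in> A \<Longrightarrow> \<exists>h. symbol S (f a) h"
  shows "(\<exists>h. symbol S (\<lambda>q. \<Sum>a\<in>A. pm_scale (c a) (f a q)) h) \<and>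
    rep S \<nu> (\<lambda>q. \<Sum>a\<in>A. pm_scale (c a) (f a q)) p = (\<Sum>a\<in>A. pm_scale (c a) (rep S \<nu> (f a) p))"
  using assms(3,4)
proof (induction A rule: finite_induct)
  case empty
  have z: "symbol S (\<lambda>q :: ('n, 'k) mpol. 0) (\<lambda>\<nu> \<alpha>. 0)"
    by (rule symbolI) (auto intro!: plinI polyfun.const)
  then show ?case using rep_symbol[OF z nu p] by (auto simp: lin_ext_def)
next
  case (insert a A)
  let ?F = "\<lambda>q. \<Sum>a\<in>A. pm_scale (c a) (f a q)"
  have "\<exists>h. symbol S (f a) h" "\<exists>h'. symbol S ?F h'" using insert by simp_all
  then obtain h h' where h: "symbol S (f a) h" and h': "symbol S ?F h'" by blast
  have IH: "rep S \<nu> ?F p = (\<Sum>a\<in>A. pm_scale (c a) (rep S \<nu> (f a) p))" using insert by auto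
  have "lin_ext (\<lambda>\<alpha>. single \<alpha> (c a)) q = pm_scale (c a) q" for q :: "('n \<Rightarrow> int) \<Rightarrow>\<^sub>0 'k"
    by (rule poly_mapping_eqI) (simp add: lookup_lin_ext_diag)
  then have "symbol S (\<lambda>q. pm_scale (c a) (f a q)) (\<lambda>\<nu> \<alpha>. pm_scale (c a) (h \<nu> \<alpha>))"
    using symbol_comp[OF symbol_scale[of S "c a"] h] by (simp add: comp_def)
  from symbol_add[OF this h'] have s: "symbol S (\<lambda>q. \<Sum>a\<in>Set.insert a A. pm_scale (c a) (f a q)) (\<lambda>\<nu> \<alpha>. pm_scale (c a) (h \<nu> \<alpha>) + h' \<nu> \<alpha>)"
    using insert.hyps by simp
  have "rep S \<nu> (\<lambda>q. \<Sum>a\<in>Set.insert a A. pm_scale (c a) (f a q)) p = pm_scale (c a) (rep S \<nu> (f a) p) + rep S \<nu> ?F p"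
    by (simp only: rep_symbol[OF s nu p] rep_symbol[OF h nu p] rep_symbol[OF h' nu p] lin_ext_fun_add lin_ext_fun_scale)
  then show ?case using s IH insert.hyps by auto
qed

section \<open>The tensor product of model modules\<close>

lemma tensor_free_iff:
  "f \<in> tensor_free M \<longleftrightarrow> (\<forall>m\<in>keys f. \<forall>i. m i \<in> carrier (M i))"
  by (auto simp: tensor_free_def)

lemma subspace_tensor_free: "PM.subspace (tensor_free M :: (('n \<Rightarrow> 'm) \<Rightarrow>\<^sub>0 'k::field) set)"
proof (rule PM.subspaceI)
  fix x y :: "('n \<Rightarrow> 'm) \<Rightarrow>\<^sub>0 'k" and c
  show "x \<in> tensor_free M \<Longrightarrow> y \<in> tensor_free M \<Longrightarrow> x + y \<in> tensor_free M"
    using keys_add[of x y] unfolding tensor_free_def by blast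
  show "x \<in> tensor_free M \<Longrightarrow> pm_scale c x \<in> tensor_free M"
    using keys_pm_scale[of c x] unfolding tensor_free_def by blast
qed (simp add: tensor_free_def)

lemma single_tensor_free: "(\<And>i. m i \<in> carrier (M i)) \<Longrightarrow> single m c \<in> tensor_free M"
  by (auto simp: tensor_free_def)

lemma subspace_tensor_rels: "PM.subspace (tensor_rels M)"
  unfolding tensor_rels_def by (rule PM.subspace_span)

lemma tensor_rels_add:
  assumes "\<And>j. m j \<in> carrier (M j)" "x \<in> carrier (M i)" "y \<in> carrier (M i)"
  shows "single (m(i := x \<oplus>\<^bsub>M i\<^esub> y)) 1
         - single (m(i := x)) 1 - single (m(i := y)) 1 \<in> tensor_rels M"
  unfolding tensor_rels_def by (rule PM.span_base, rule UnI1) (use assms in blast)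

lemma tensor_rels_scale:
  assumes "\<And>j. m j \<in> carrier (M j)" "x \<in> carrier (M i)"
  shows "single (m(i := pm_scale c \<odot>\<^bsub>M i\<^esub> x)) 1 - single (m(i := x)) c \<in> tensor_rels M"
  unfolding tensor_rels_def by (rule PM.span_base, rule UnI2) (use assms in blast)

lemma tensor_rels_induct:
  assumes "r \<in> tensor_rels M" and Z: "PM.subspace Z"
    and add: "\<And>m i x y. (\<And>j. m j \<in> carrier (M j)) \<Longrightarrow> x \<in> carrier (M i) \<Longrightarrow> y \<in> carrier (M i) \<Longrightarrow>
      single (m(i := x \<oplus>\<^bsub>M i\<^esub> y)) 1
         - single (m(i := x)) 1 - single (m(i := y)) 1 \<in> Z"
    and scale: "\<And>m i x c. (\<And>j. m j \<in> carrier (M j)) \<Longrightarrow> x \<in> carrier (M i) \<Longrightarrow>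
      single (m(i := pm_scale c \<odot>\<^bsub>M i\<^esub> x)) 1 - single (m(i := x)) c \<in> Z"
  shows "r \<in> Z"
proof -
  have "tensor_rels M \<subseteq> Z"
    unfolding tensor_rels_def
  proof (rule PM.span_minimal[OF _ Z], rule Un_least)
    show "{single (m(i := x \<oplus>\<^bsub>M i\<^esub> y)) 1
         - single (m(i := x)) 1 - single (m(i := y)) 1 | m i x y.
         m \<in> Pi UNIV (\<lambda>j. carrier (M j)) \<and> x \<in> carrier (M i) \<and> y \<in> carrier (M i)} \<subseteq> Z"
      using add by (auto simp: Pi_def)
    show "{single (m(i := pm_scale c \<odot>\<^bsub>M i\<^esub> x)) 1 - single (m(i := x)) c | m i x c.
         m \<in> Pi UNIV (\<lambda>j. carrier (M j)) \<and> x \<in> carrier (M i)} \<subseteq> Z"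
      using scale by (auto simp: Pi_def)
  qed
  then show ?thesis using assms(1) by blast
qed

lemma subspace_plin_kernel: "plin f \<Longrightarrow> PM.subspace {p. f p = 0}"
  by (rule PM.subspaceI) (simp_all add: plin_zero plin_add plin_scale)

lemma subspace_lin_ext:
  assumes "PM.subspace Z" "\<And>a. a \<in> keys p \<Longrightarrow> g a \<in> Z"
  shows "lin_ext g p \<in> Z"
  unfolding lin_ext_def by (intro PM.subspace_sum PM.subspace_scale assms)

lemma tensor_class_eq_iff: "tensor_class M f = tensor_class M g \<longleftrightarrow> f - g \<in> tensor_rels M"
proof
  assume "tensor_class M f = tensor_class M g"
  moreover have "f + 0 \<in> tensor_class M f"
    unfolding tensor_class_def using PM.subspace_0[OF subspace_tensor_rels] by blast
  ultimately obtain r where "r \<in> tensor_rels M" "f + 0 = g + r" unfolding tensor_class_def by blast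
  then show "f - g \<in> tensor_rels M" by simp
next
  assume d: "f - g \<in> tensor_rels M"
  have sub: "tensor_class M f \<subseteq> tensor_class M g" if "f - g \<in> tensor_rels M" for f g
  proof
    fix h assume "h \<in> tensor_class M f"
    then obtain r where r: "r \<in> tensor_rels M" "h = f + r" unfolding tensor_class_def by blast
    then have "h = g + ((f - g) + r)" by simp
    moreover have "(f - g) + r \<in> tensor_rels M"
      using PM.subspace_add[OF subspace_tensor_rels that r(1)] .
    ultimately show "h \<in> tensor_class M g" unfolding tensor_class_def by blast
  qed
  have "g - f \<in> tensor_rels M" using PM.subspace_neg[OF subspace_tensor_rels d] by simp
  then show "tensor_class M f = tensor_class M g" using sub d by (intro equalityI)
qed

section \<open>The tensor product of modules isomorphic to one-variable models\<close>

context
  fixes Ms :: "'n::finite \<Rightarrow> ((unit, 'k::field_char_0) mpol_op, 'm) module"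
    and T :: "'n \<Rightarrow> unit set" and \<mu> :: "'n \<Rightarrow> unit \<Rightarrow> 'k"
    and \<phi> :: "'n \<Rightarrow> 'm \<Rightarrow> ((unit \<Rightarrow> int) \<Rightarrow>\<^sub>0 'k)"
    and S :: "'n set" and \<nu> :: "'n \<Rightarrow> 'k"
  assumes mu: "\<And>i. \<forall>u\<in>T i. \<mu> i u = 0"
    and lm: "\<And>i. left_module intdiff_alg (Ms i)"
    and iso: "\<And>i. mod_iso intdiff_alg (Ms i) (std_module (T i) (\<mu> i)) (\<phi> i)"
    and S: "S = {i. () \<in> T i}" and nu_mu: "\<And>i. \<nu> i = \<mu> i ()"
begin

definition coord_inv :: "'n \<Rightarrow> ((unit \<Rightarrow> int) \<Rightarrow>\<^sub>0 'k) \<Rightarrow> 'm" where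
  "coord_inv i = inv_into (carrier (Ms i)) (\<phi> i)"

lemma coord_keys: "x \<in> carrier (Ms i) \<Longrightarrow> keys (\<phi> i x) \<subseteq> orthant (T i)"
  using mod_isoD(4)[OF iso, of x i] by simp

lemma coord_add: "x \<in> carrier (Ms i) \<Longrightarrow> y \<in> carrier (Ms i) \<Longrightarrow> \<phi> i (x \<oplus>\<^bsub>Ms i\<^esub> y) = \<phi> i x + \<phi> i y"
  using mod_isoD(2)[OF iso, of x i y] by simp

lemma coord_smult: "a \<in> carrier intdiff_alg \<Longrightarrow> x \<in> carrier (Ms i) \<Longrightarrow> \<phi> i (a \<odot>\<^bsub>Ms i\<^esub> x) = rep (T i) (\<mu> i) a (\<phi> i x)"
  using mod_isoD(3)[OF iso, of a x i] by simp

lemma coord_scale: "x \<in> carrier (Ms i) \<Longrightarrow> \<phi> i (pm_scale c \<odot>\<^bsub>Ms i\<^esub> x) = pm_scale c (\<phi> i x)"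
  using coord_smult[of "pm_scale c" x i] rep_scale[OF mu coord_keys, of x i c] by simp

lemma inv_coord: "x \<in> carrier (Ms i) \<Longrightarrow> coord_inv i (\<phi> i x) = x"
  using mod_isoD(1)[OF iso, of i] by (simp add: coord_inv_def bij_betw_def)

lemma coord_inv_iso: "mod_iso intdiff_alg (std_module (T i) (\<mu> i)) (Ms i) (coord_inv i)"
  unfolding coord_inv_def by (rule mod_iso_inv[OF iso lm])

lemma coord_inv_closed: "keys p \<subseteq> orthant (T i) \<Longrightarrow> coord_inv i p \<in> carrier (Ms i)"
  using mod_isoD(4)[OF coord_inv_iso, of p i] by simp

lemma coord_coord_inv: "keys p \<subseteq> orthant (T i) \<Longrightarrow> \<phi> i (coord_inv i p) = p"
  using mod_isoD(1)[OF iso, of i] by (simp add: coord_inv_def bij_betw_def f_inv_into_f)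

lemma coord_inv_add: "keys p \<subseteq> orthant (T i) \<Longrightarrow> keys q \<subseteq> orthant (T i) \<Longrightarrow>
    coord_inv i (p + q) = coord_inv i p \<oplus>\<^bsub>Ms i\<^esub> coord_inv i q"
  using mod_isoD(2)[OF coord_inv_iso, of p i q] by simp

lemma coord_inv_scale: "keys p \<subseteq> orthant (T i) \<Longrightarrow>
    coord_inv i (pm_scale c p) = pm_scale c \<odot>\<^bsub>Ms i\<^esub> coord_inv i p"
  using mod_isoD(3)[OF coord_inv_iso, of "pm_scale c" p i] rep_scale[OF mu, of p i c] by simp

definition tmap :: "(('n \<Rightarrow> 'm) \<Rightarrow>\<^sub>0 'k) \<Rightarrow> (('n \<Rightarrow> int) \<Rightarrow>\<^sub>0 'k)" where
  "tmap = lin_ext (\<lambda>m. tens (\<lambda>i. \<phi> i (m i)))"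

text \<open>A section of \<open>tmap\<close>; comparing f with \<open>tsec (tmap f)\<close> modulo
  the relations is how the kernel of \<open>tmap\<close> is found.\<close>

definition tsec :: "(('n \<Rightarrow> int) \<Rightarrow>\<^sub>0 'k) \<Rightarrow> (('n \<Rightarrow> 'm) \<Rightarrow>\<^sub>0 'k)" where
  "tsec = lin_ext (\<lambda>\<gamma>. single (\<lambda>i. coord_inv i (single (\<lambda>_. \<gamma> i) 1)) 1)"

lemma plin_tmap: "plin tmap" and plin_tsec: "plin tsec"
  by (simp_all add: tmap_def tsec_def plin_lin_ext)

lemma orthant_coordinate: "\<gamma> \<in> orthant S \<longleftrightarrow> (\<forall>i. (\<lambda>_. \<gamma> i) \<in> orthant (T i))"
proof -
  have "(\<forall>u\<in>T i. 0 \<le> \<gamma> i) \<longleftrightarrow> (() \<in> T i \<longrightarrow> 0 \<le> \<gamma> i)" for i by auto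
  then show ?thesis by (auto simp: orthant_def S)
qed

lemma tens_keys: "(\<And>i. keys (q i) \<subseteq> orthant (T i)) \<Longrightarrow> keys (tens q) \<subseteq> orthant S"
  unfolding keys_tens orthant_coordinate subset_iff by blast

lemma tmap_keys:
  assumes "f \<in> tensor_free Ms"
  shows "keys (tmap f) \<subseteq> orthant S"
  unfolding tmap_def
proof (rule keys_lin_ext_subset)
  fix m assume "m \<in> keys f"
  then have "m i \<in> carrier (Ms i)" for i using assms by (simp add: tensor_free_iff)
  then show "keys (tens (\<lambda>i. \<phi> i (m i))) \<subseteq> orthant S"
    by (intro tens_keys coord_keys)
qed

lemma tsec_free:
  assumes "keys p \<subseteq> orthant S"
  shows "tsec p \<in> tensor_free Ms"
  unfolding tsec_def
proof (intro subspace_lin_ext[OF subspace_tensor_free] single_tensor_free coord_inv_closed)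
  fix \<gamma> i assume "\<gamma> \<in> keys p"
  then show "keys (single (\<lambda>_. \<gamma> i) (1 :: 'k)) \<subseteq> orthant (T i)"
    using assms orthant_coordinate by auto
qed

lemma tmap_tsec:
  assumes "keys p \<subseteq> orthant S"
  shows "tmap (tsec p) = p"
proof -
  have "tmap (tsec p) = lin_ext (\<lambda>\<gamma>. tens (\<lambda>i. \<phi> i (coord_inv i (single (\<lambda>_. \<gamma> i) 1)))) p"
    unfolding tsec_def plin_lin_ext_comp[OF plin_tmap] by (simp add: tmap_def)
  also have "\<dots> = lin_ext (\<lambda>\<gamma>. single \<gamma> 1) p"
  proof (rule lin_ext_cong)
    fix \<gamma> assume "\<gamma> \<in> keys p"
    then have "keys (single (\<lambda>_. \<gamma> i) (1 :: 'k)) \<subseteq> orthant (T i)" for i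
      using assms orthant_coordinate by auto
    then have "\<phi> i (coord_inv i (single (\<lambda>_. \<gamma> i) 1)) = single (\<lambda>_. \<gamma> i) 1" for i
      by (rule coord_coord_inv)
    then show "tens (\<lambda>i. \<phi> i (coord_inv i (single (\<lambda>_. \<gamma> i) 1))) = single \<gamma> 1"
      by (simp only: tens_single)
  qed
  finally show ?thesis by simp
qed

lemma tensor_rels_free: "tensor_rels Ms \<subseteq> tensor_free Ms"
proof
  interpret M: left_module intdiff_alg "Ms i" for i by (rule lm)
  fix r assume "r \<in> tensor_rels Ms"
  then show "r \<in> tensor_free Ms"
    by (rule tensor_rels_induct[OF _ subspace_tensor_free])
       (intro PM.subspace_diff[OF subspace_tensor_free] single_tensor_free,
        auto intro!: M.smult_closed)+
qed

lemma tmap_rels: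
  assumes "r \<in> tensor_rels Ms"
  shows "tmap r = 0"
proof -
  have "r \<in> {p. tmap p = 0}"
    using assms
  proof (rule tensor_rels_induct[OF _ subspace_plin_kernel[OF plin_tmap]])
    have upd: "(\<lambda>j. \<phi> j ((m(i := x)) j)) = (\<lambda>j. \<phi> j (m j))(i := \<phi> i x)" for m i x by auto
    fix m i x
    assume x: "x \<in> carrier (Ms i)"
    show "single (m(i := x \<oplus>\<^bsub>Ms i\<^esub> y)) 1
         - single (m(i := x)) 1 - single (m(i := y)) 1 \<in> {p. tmap p = 0}"
      if "y \<in> carrier (Ms i)" for y
      using coord_add[OF x that] by (simp add: plin_diff[OF plin_tmap]) (simp add: tmap_def upd tens_add del: fun_upd_apply)
    show "single (m(i := pm_scale c \<odot>\<^bsub>Ms i\<^esub> x)) 1 - single (m(i := x)) c \<in> {p. tmap p = 0}" for c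
      using coord_scale[OF x, of c] by (simp add: plin_diff[OF plin_tmap]) (simp add: tmap_def upd tens_scale del: fun_upd_apply)
  qed
  then show ?thesis by simp
qed

text \<open>Modulo the relations both terms are multilinear in q, and they coincide on tuples of
  basis vectors.\<close>

lemma single_tsec_tens:
  assumes "\<And>i. keys (q i) \<subseteq> orthant (T i)"
  shows "single (\<lambda>i. coord_inv i (q i)) 1 - tsec (tens q) \<in> tensor_rels Ms"
proof -
  let ?L = "\<lambda>q. single (\<lambda>i. coord_inv i (q i)) 1 - tsec (tens q)"
  have upd: "(\<lambda>j. coord_inv j ((q(i := x)) j)) = (\<lambda>j. coord_inv j (q j))(i := coord_inv i x)" for q i x by auto
  note sub = subspace_tensor_rels
  \<comment> \<open>The alternative \<open>c = 0\<close> also covers a family with a zero entry, for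
    which no induction hypothesis is available.\<close>
  have scale: "?L (q(i := pm_scale c a)) \<in> tensor_rels Ms"
    if q: "\<forall>j. keys (q j) \<subseteq> orthant (T j)" and a: "keys a \<subseteq> orthant (T i)"
      and L: "c = 0 \<or> ?L (q(i := a)) \<in> tensor_rels Ms" for q i a c
  proof -
    have "single ((\<lambda>j. coord_inv j (q j))(i := pm_scale c \<odot>\<^bsub>Ms i\<^esub> coord_inv i a)) 1 -
        single ((\<lambda>j. coord_inv j (q j))(i := coord_inv i a)) c \<in> tensor_rels Ms" (is "?A \<in> _")
      by (rule tensor_rels_scale) (use q a coord_inv_closed in auto)
    moreover have "pm_scale c (?L (q(i := a))) \<in> tensor_rels Ms"
      using L PM.subspace_scale[OF sub] PM.subspace_0[OF sub] by auto
    ultimately have "?A + pm_scale c (?L (q(i := a))) \<in> tensor_rels Ms" by (rule PM.subspace_add[OF sub])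
    moreover have "?A + pm_scale c (?L (q(i := a))) = ?L (q(i := pm_scale c a))"
      by (simp add: upd coord_inv_scale[OF a] tens_scale plin_scale[OF plin_tsec] PM.scale_right_diff_distrib pm_scale_single del: fun_upd_apply)
    ultimately show ?thesis by (simp only:)
  qed
  show ?thesis
  proof (rule multi_induct[of "\<lambda>i. orthant (T i)" "\<lambda>q. ?L q \<in> tensor_rels Ms"])
    fix q :: "'n \<Rightarrow> ((unit \<Rightarrow> int) \<Rightarrow>\<^sub>0 'k)" and i assume q: "\<forall>j. keys (q j) \<subseteq> orthant (T j)" and "q i = 0"
    then have "q = q(i := pm_scale 0 (q i))" by (auto simp: fun_eq_iff)
    then show "?L q \<in> tensor_rels Ms" using scale[OF q, of "q i" i 0] q by simp
  next
    fix q :: "'n \<Rightarrow> ((unit \<Rightarrow> int) \<Rightarrow>\<^sub>0 'k)" and i a b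
    assume q: "\<forall>j. keys (q j) \<subseteq> orthant (T j)" and a: "keys a \<subseteq> orthant (T i)"
      and b: "keys b \<subseteq> orthant (T i)"
      and L: "?L (q(i := a)) \<in> tensor_rels Ms" "?L (q(i := b)) \<in> tensor_rels Ms"
    have "single ((\<lambda>j. coord_inv j (q j))(i := coord_inv i a \<oplus>\<^bsub>Ms i\<^esub> coord_inv i b)) 1 -
        single ((\<lambda>j. coord_inv j (q j))(i := coord_inv i a)) 1 -
        single ((\<lambda>j. coord_inv j (q j))(i := coord_inv i b)) 1 \<in> tensor_rels Ms" (is "?A \<in> _")
      by (rule tensor_rels_add) (use q a b coord_inv_closed in auto)
    then have "?A + (?L (q(i := a)) + ?L (q(i := b))) \<in> tensor_rels Ms"
      by (intro PM.subspace_add[OF sub] L)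
    moreover have "?A + (?L (q(i := a)) + ?L (q(i := b))) = ?L (q(i := a + b))"
      by (simp add: upd coord_inv_add[OF a b] tens_add plin_add[OF plin_tsec] del: fun_upd_apply)
    ultimately show "?L (q(i := a + b)) \<in> tensor_rels Ms" by (simp only:)
  next
    fix \<beta> :: "'n \<Rightarrow> unit \<Rightarrow> int"
    have "(\<lambda>_. \<beta> i ()) = \<beta> i" for i by auto
    then have "?L (\<lambda>j. single (\<beta> j) 1) = 0"
      by (simp add: tens_single tsec_def)
    then show "?L (\<lambda>j. single (\<beta> j) 1) \<in> tensor_rels Ms"
      using PM.subspace_0[OF sub] by simp
  qed (use assms scale in auto)
qed

text \<open>Each tuple in the support of f differs from the section of its image by a relation.
  Hence an element of the free space with zero image is a relation.\<close>

lemma tmap_kernel: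
  assumes "f \<in> tensor_free Ms"
  shows "f - tsec (tmap f) \<in> tensor_rels Ms"
proof -
  have "f - tsec (tmap f) = lin_ext (\<lambda>m. single m 1 - tsec (tens (\<lambda>i. \<phi> i (m i)))) f"
    by (simp add: lin_ext_fun_diff tmap_def plin_lin_ext_comp[OF plin_tsec])
  also have "\<dots> \<in> tensor_rels Ms"
  proof (rule subspace_lin_ext[OF subspace_tensor_rels])
    fix m assume "m \<in> keys f"
    then have m: "m i \<in> carrier (Ms i)" for i using assms by (simp add: tensor_free_iff)
    then have "(\<lambda>i. coord_inv i (\<phi> i (m i))) = m" using inv_coord by auto
    then show "single m 1 - tsec (tens (\<lambda>i. \<phi> i (m i))) \<in> tensor_rels Ms"
      using single_tsec_tens[of "\<lambda>i. \<phi> i (m i)"] coord_keys[OF m] by simp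
  qed
  finally show ?thesis .
qed

lemma tensor_class_eq_tmap:
  assumes "f \<in> tensor_free Ms" "g \<in> tensor_free Ms"
  shows "tensor_class Ms f = tensor_class Ms g \<longleftrightarrow> tmap f = tmap g"
proof
  assume "tensor_class Ms f = tensor_class Ms g"
  then have "tmap (f - g) = 0" by (intro tmap_rels) (simp add: tensor_class_eq_iff)
  then show "tmap f = tmap g" by (simp add: plin_diff[OF plin_tmap])
next
  assume "tmap f = tmap g"
  then have "f - g - tsec (tmap (f - g)) = f - g" by (simp add: plin_diff[OF plin_tmap] plin_zero[OF plin_tsec])
  then show "tensor_class Ms f = tensor_class Ms g"
    using tmap_kernel[OF PM.subspace_diff[OF subspace_tensor_free assms]] by (simp add: tensor_class_eq_iff)
qed

lemma tensor_act_free: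
  assumes "keys r \<subseteq> Pi UNIV (\<lambda>_. carrier intdiff_alg)" "f \<in> tensor_free Ms"
  shows "tensor_act Ms r f \<in> tensor_free Ms"
  unfolding tensor_act_def
proof (intro subspace_lin_ext[OF subspace_tensor_free] single_tensor_free)
  interpret M: left_module intdiff_alg "Ms i" for i by (rule lm)
  fix a m i assume "a \<in> keys r" "m \<in> keys f"
  then show "a i \<odot>\<^bsub>Ms i\<^esub> m i \<in> carrier (Ms i)"
    using assms by (intro M.smult_closed) (auto simp: tensor_free_iff)
qed

text \<open>The right-hand side sees only b and \<open>tmap f\<close>. Hence every representation of
  b and every representative of a class lead to the same element of the model.\<close>

lemma tmap_tensor_act:
  assumes b: "r \<in> tensor_reps b" and f: "f \<in> tensor_free Ms"
  shows "tmap (tensor_act Ms r f) = rep S \<nu> b (tmap f)"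
proof -
  have r: "a i \<in> carrier intdiff_alg" if "a \<in> keys r" for a i
    using b that by (auto simp: tensor_reps_iff)
  have nu: "\<forall>i\<in>S. \<nu> i = 0" using mu by (auto simp: S nu_mu)
  have "tmap (tensor_act Ms r f) = lin_ext (\<lambda>a. lin_ext (\<lambda>m. tens (\<lambda>i. \<phi> i (a i \<odot>\<^bsub>Ms i\<^esub> m i))) f) r"
    unfolding tensor_act_def plin_lin_ext_comp[OF plin_tmap] by (simp add: tmap_def)
  also have "\<dots> = lin_ext (\<lambda>a. rep S \<nu> (tensor_op a) (tmap f)) r"
  proof (rule lin_ext_cong)
    fix a assume a: "a \<in> keys r"
    have "lin_ext (\<lambda>m. tens (\<lambda>i. \<phi> i (a i \<odot>\<^bsub>Ms i\<^esub> m i))) f = lin_ext (\<lambda>m. rep S \<nu> (tensor_op a) (tens (\<lambda>i. \<phi> i (m i)))) f"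
    proof (rule lin_ext_cong)
      fix m assume "m \<in> keys f"
      then have m: "m i \<in> carrier (Ms i)" for i using f by (simp add: tensor_free_iff)
      show "tens (\<lambda>i. \<phi> i (a i \<odot>\<^bsub>Ms i\<^esub> m i)) = rep S \<nu> (tensor_op a) (tens (\<lambda>i. \<phi> i (m i)))"
        by (simp only: rep_tensor_op(2)[OF r[OF a] S mu nu_mu coord_keys[OF m]] coord_smult[OF r[OF a] m])
    qed
    then show "lin_ext (\<lambda>m. tens (\<lambda>i. \<phi> i (a i \<odot>\<^bsub>Ms i\<^esub> m i))) f = rep S \<nu> (tensor_op a) (tmap f)"
      unfolding tmap_def plin_lin_ext_comp[OF plin_rep] .
  qed
  also have "\<dots> = rep S \<nu> b (tmap f)"
  proof -
    have "\<exists>h. symbol S (tensor_op a) h" if "a \<in> keys r" for a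
      by (rule rep_tensor_op(1)[OF r[OF that] S mu nu_mu, of "\<lambda>_. 0"]) simp
    from rep_sum[where f = tensor_op and A = "keys r" and c = "lookup r",
        OF nu tmap_keys[OF f] finite_keys this]
    show ?thesis using b unfolding tensor_reps_iff lin_ext_def by simp
  qed
  finally show ?thesis .
qed

lemma tensor_class_mem: "f' \<in> tensor_class Ms f \<Longrightarrow> f \<in> tensor_free Ms \<Longrightarrow> f' \<in> tensor_free Ms \<and> tmap f' = tmap f"
  unfolding tensor_class_def
  using PM.subspace_add[OF subspace_tensor_free] tensor_rels_free
  by (auto simp: plin_add[OF plin_tmap] tmap_rels)

lemma tensor_class_self: "f \<in> tensor_class Ms f"
  unfolding tensor_class_def using PM.subspace_0[OF subspace_tensor_rels, of Ms] by force

text \<open>Evaluates operations on classes that are unions over all representatives.\<close>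

lemma UN_const: "A \<noteq> {} \<Longrightarrow> (\<And>x. x \<in> A \<Longrightarrow> f x = c) \<Longrightarrow> (\<Union>x\<in>A. f x) = c"
  by auto

lemma tensor_module_add:
  assumes "f \<in> tensor_free Ms" "g \<in> tensor_free Ms"
  shows "tensor_class Ms f \<oplus>\<^bsub>tensor_module Ms\<^esub> tensor_class Ms g = tensor_class Ms (f + g)"
proof -
  have "(\<Union>f'\<in>tensor_class Ms f. \<Union>g'\<in>tensor_class Ms g. tensor_class Ms (f' + g')) = tensor_class Ms (f + g)"
  proof (intro UN_const)
    fix f' g' assume fg: "f' \<in> tensor_class Ms f" "g' \<in> tensor_class Ms g"
    show "tensor_class Ms (f' + g') = tensor_class Ms (f + g)"
      using tensor_class_mem[OF fg(1) assms(1)] tensor_class_mem[OF fg(2) assms(2)] assms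
      by (subst tensor_class_eq_tmap) (auto simp: plin_add[OF plin_tmap] intro: PM.subspace_add[OF subspace_tensor_free])
  qed (use tensor_class_self in blast)+
  then show ?thesis by (simp add: tensor_module_def)
qed

text \<open>The classes in the union all coincide, by \<open>tmap_tensor_act\<close> and because
  \<open>tmap\<close> separates classes.\<close>

lemma tensor_module_smult:
  assumes b: "b \<in> carrier intdiff_alg" and f: "f \<in> tensor_free Ms"
  shows "\<exists>g\<in>tensor_free Ms. b \<odot>\<^bsub>tensor_module Ms\<^esub> tensor_class Ms f = tensor_class Ms g \<and> tmap g = rep S \<nu> b (tmap f)"
proof -
  obtain r0 where r0: "r0 \<in> tensor_reps b" using tensor_reps_nonempty[OF b] by blast
  have free: "tensor_act Ms r f' \<in> tensor_free Ms" if "r \<in> tensor_reps b" "f' \<in> tensor_free Ms" for r f'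
    using that tensor_act_free tensor_reps_iff by blast
  have "(\<Union>r\<in>tensor_reps b. \<Union>f'\<in>tensor_class Ms f. tensor_class Ms (tensor_act Ms r f')) = tensor_class Ms (tensor_act Ms r0 f)"
  proof (intro UN_const)
    fix r f' assume r: "r \<in> tensor_reps b" and "f' \<in> tensor_class Ms f"
    then have "f' \<in> tensor_free Ms" "tmap f' = tmap f" using tensor_class_mem f by blast+
    then show "tensor_class Ms (tensor_act Ms r f') = tensor_class Ms (tensor_act Ms r0 f)"
      using r r0 f free by (subst tensor_class_eq_tmap) (auto simp: tmap_tensor_act)
  qed (use tensor_class_self r0 in blast)+
  then have "b \<odot>\<^bsub>tensor_module Ms\<^esub> tensor_class Ms f = tensor_class Ms (tensor_act Ms r0 f)"
    by (simp add: tensor_module_def)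
  then show ?thesis using free[OF r0 f] tmap_tensor_act[OF r0 f] by blast
qed

lemma tensor_module_std:
  "left_module intdiff_alg (tensor_module Ms)"
  "module_isomorphic intdiff_alg (tensor_module Ms) (std_module S \<nu>)"
proof -
  \<comment> \<open>By \<open>tensor_class_mem\<close> all representatives of a class have the same
    image, so the choice is immaterial.\<close>
  define F where "F c = tmap (SOME f. f \<in> c)" for c
  have nu: "\<forall>i\<in>S. \<nu> i = 0" using mu by (auto simp: S nu_mu)
  have car: "carrier (tensor_module Ms) = tensor_class Ms ` tensor_free Ms"
    by (simp add: tensor_module_def)
  have F: "F (tensor_class Ms f) = tmap f" if "f \<in> tensor_free Ms" for f
    using tensor_class_mem[OF someI[of "\<lambda>g. g \<in> tensor_class Ms f", OF tensor_class_self] that]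
    by (simp add: F_def)
  have zero: "\<zero>\<^bsub>tensor_module Ms\<^esub> = tensor_class Ms 0"
    by (simp add: tensor_module_def tensor_class_def)
  note sub = subspace_tensor_free[of Ms]
  have f: "mod_iso intdiff_alg (tensor_module Ms) (std_module S \<nu>) F"
  proof (rule mod_isoI)
    have "inj_on F (carrier (tensor_module Ms))"
    proof (rule inj_onI)
      fix x y assume "x \<in> carrier (tensor_module Ms)" "y \<in> carrier (tensor_module Ms)" "F x = F y"
      then obtain f g where fg: "f \<in> tensor_free Ms" "x = tensor_class Ms f" "g \<in> tensor_free Ms" "y = tensor_class Ms g"
        "tmap f = tmap g"
        by (auto simp: car F)
      show "x = y" unfolding fg(2,4) using tensor_class_eq_tmap[OF fg(1,3)] fg(5) by blast
    qed
    moreover have "F ` carrier (tensor_module Ms) = carrier (std_module S \<nu>)"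
    proof (intro equalityI subsetI)
      fix p assume "p \<in> F ` carrier (tensor_module Ms)"
      then obtain f where "f \<in> tensor_free Ms" "p = F (tensor_class Ms f)" by (auto simp: car)
      then show "p \<in> carrier (std_module S \<nu>)" using tmap_keys[of f] by (simp add: F)
    next
      fix p assume "p \<in> carrier (std_module S \<nu>)"
      then have "tsec p \<in> tensor_free Ms" "tmap (tsec p) = p" using tsec_free tmap_tsec by auto
      then have "p = F (tensor_class Ms (tsec p))" "tensor_class Ms (tsec p) \<in> carrier (tensor_module Ms)"
        by (auto simp: F car)
      then show "p \<in> F ` carrier (tensor_module Ms)" by blast
    qed
    ultimately show "bij_betw F (carrier (tensor_module Ms)) (carrier (std_module S \<nu>))"
      by (simp add: bij_betw_def)
  next
    fix x y assume "x \<in> carrier (tensor_module Ms)" "y \<in> carrier (tensor_module Ms)"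
    then obtain f g where fg: "f \<in> tensor_free Ms" "x = tensor_class Ms f" "g \<in> tensor_free Ms" "y = tensor_class Ms g"
      by (auto simp: car)
    then show "F (x \<oplus>\<^bsub>tensor_module Ms\<^esub> y) = F x \<oplus>\<^bsub>std_module S \<nu>\<^esub> F y"
      using PM.subspace_add[OF sub fg(1,3)] by (simp add: tensor_module_add F plin_add[OF plin_tmap])
  next
    fix b x assume b: "b \<in> carrier (intdiff_alg :: ('n, 'k) mpol_op ring)" and "x \<in> carrier (tensor_module Ms)"
    then obtain f where f: "f \<in> tensor_free Ms" "x = tensor_class Ms f" by (auto simp: car)
    then show "F (b \<odot>\<^bsub>tensor_module Ms\<^esub> x) = b \<odot>\<^bsub>std_module S \<nu>\<^esub> F x"
      using tensor_module_smult[OF b f(1)] by (auto simp: F)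
  qed
  then show "module_isomorphic intdiff_alg (tensor_module Ms) (std_module S \<nu>)"
    by (auto simp: module_isomorphic_iff)
  show "left_module intdiff_alg (tensor_module Ms)"
  proof (rule left_module_transfer[OF f left_module_std[OF nu]])
    show "\<zero>\<^bsub>tensor_module Ms\<^esub> \<in> carrier (tensor_module Ms)"
      unfolding zero car using PM.subspace_0[OF sub] by blast
    show "F \<zero>\<^bsub>tensor_module Ms\<^esub> = \<zero>\<^bsub>std_module S \<nu>\<^esub>"
      using F[OF PM.subspace_0[OF sub]] by (simp add: zero plin_zero[OF plin_tmap])
    fix x y assume "x \<in> carrier (tensor_module Ms)" "y \<in> carrier (tensor_module Ms)"
    then obtain f g where fg: "f \<in> tensor_free Ms" "x = tensor_class Ms f" "g \<in> tensor_free Ms" "y = tensor_class Ms g"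
      by (auto simp: car)
    then show "x \<oplus>\<^bsub>tensor_module Ms\<^esub> y \<in> carrier (tensor_module Ms)"
      unfolding car fg(2,4) tensor_module_add[OF fg(1,3)] by (intro imageI PM.subspace_add[OF sub])
  next
    show "b \<odot>\<^bsub>tensor_module Ms\<^esub> x \<in> carrier (tensor_module Ms)"
      if "b \<in> carrier intdiff_alg" "x \<in> carrier (tensor_module Ms)" for b x
      using that tensor_module_smult by (auto simp: car) blast
  qed
qed

end

section \<open>The classification theorem\<close>

text \<open>The support determines \<open>S\<close>, and the second model contains a basis vector
  with the weight of index 0 of the first. That vector satisfies all hypotheses of
  \<open>std_iso\<close>.\<close>

lemma std_module_iso_of_Supp:
  fixes S S' :: "'n::finite set" and \<nu> \<nu>' :: "'n \<Rightarrow> 'k::field_char_0"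
  assumes nu: "\<forall>i\<in>S. \<nu> i = 0" and nu': "\<forall>i\<in>S'. \<nu>' i = 0"
    and eq: "Supp (std_module S \<nu>) = Supp (std_module S' \<nu>')"
  shows "module_isomorphic intdiff_alg (std_module S \<nu>) (std_module S' \<nu>')"
proof -
  have wts: "wt \<nu> ` orthant S = wt \<nu>' ` orthant S'"
    using eq by (simp add: Supp_std[OF nu] Supp_std[OF nu'])
  \<comment> \<open>Membership of i in the index set is visible in the support: it holds exactly
    when the support is not stable under lowering the i-th coordinate by 1.\<close>
  have bounded: "i \<in> R \<longleftrightarrow> \<not> (\<forall>w\<in>wt \<kappa> ` orthant R. w(i := w i - 1) \<in> wt \<kappa> ` orthant R)"
    for i and R :: "'n set" and \<kappa> :: "'n \<Rightarrow> 'k"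
  proof -
    have e: "(wt \<kappa> \<alpha>)(i := wt \<kappa> \<alpha> i - 1) = wt \<kappa> (\<alpha>(i := \<alpha> i - 1))" for \<alpha>
      by (auto simp: wt_def fun_eq_iff)
    have "wt \<kappa> \<beta> \<in> wt \<kappa> ` orthant R \<longleftrightarrow> \<beta> \<in> orthant R" for \<beta> by auto
    then have "(\<forall>w\<in>wt \<kappa> ` orthant R. w(i := w i - 1) \<in> wt \<kappa> ` orthant R) \<longleftrightarrow>
        (\<forall>\<alpha>\<in>orthant R. \<alpha>(i := \<alpha> i - 1) \<in> orthant R)"
      by (simp add: e del: image_iff)
    also have "\<dots> \<longleftrightarrow> i \<notin> R"
    proof
      assume "\<forall>\<alpha>\<in>orthant R. \<alpha>(i := \<alpha> i - 1) \<in> orthant R"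
      moreover have "(\<lambda>_. 0) \<in> orthant R" by (simp add: orthant_def)
      ultimately have "(\<lambda>_. 0)(i := 0 - 1) \<in> orthant R" by blast
      then show "i \<notin> R" by (auto simp: orthant_def)
    qed (auto simp: orthant_def)
    finally show ?thesis by blast
  qed
  have S: "S' = S"
    using bounded[of _ S \<nu>] bounded[of _ S' \<nu>'] unfolding wts by blast
  have "wt \<nu> (\<lambda>_. 0) \<in> wt \<nu>' ` orthant S'"
    unfolding wts[symmetric] by (rule imageI) (simp add: orthant_def)
  then obtain \<delta> where \<delta>: "\<delta> \<in> orthant S'" "wt \<nu> (\<lambda>_. 0) = wt \<nu>' \<delta>" by auto
  interpret N: intdiff_module "std_module S' \<nu>'"
    by (rule intdiff_moduleI[OF left_module_std[OF nu']])
  let ?v = "single \<delta> (1 :: 'k)"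
  have kv: "keys ?v \<subseteq> orthant S'" using \<delta>(1) by simp
  \<comment> \<open>On \<open>S\<close> both parameters vanish, so equality of weights forces
    \<open>\<delta> i = 0\<close>; lowering this coordinate leaves the orthant, and \<partial>_i
    kills the vector.\<close>
  have \<delta>0: "\<delta> i = 0" if "i \<in> S" for i
    using fun_cong[OF \<delta>(2), of i] that nu nu' by (auto simp: wt_def S)
  show ?thesis
  proof (rule N.std_iso[OF nu, of ?v])
    fix i
    show "op_H i \<odot>\<^bsub>std_module S' \<nu>'\<^esub> ?v = pm_scale (\<nu> i + 1) \<odot>\<^bsub>std_module S' \<nu>'\<^esub> ?v"
      using fun_cong[OF \<delta>(2), of i] \<delta>(1)
      by (simp add: rep_single[OF nu' symbol_H] rep_single[OF nu' symbol_scale] wt_def add.assoc)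
    show "op_d i \<odot>\<^bsub>std_module S' \<nu>'\<^esub> ?v = \<zero>\<^bsub>std_module S' \<nu>'\<^esub>" if "i \<in> S"
    proof -
      have "\<delta>(i := \<delta> i - 1) \<notin> orthant S'" using that \<delta>0[OF that] by (auto simp: orthant_def S)
      then show ?thesis by (simp add: rep_single[OF nu' symbol_d \<delta>(1)])
    qed
    fix p assume i: "i \<notin> S" and "p \<in> carrier (std_module S' \<nu>')" "op_d i \<odot>\<^bsub>std_module S' \<nu>'\<^esub> p = \<zero>\<^bsub>std_module S' \<nu>'\<^esub>"
    then have p: "keys p \<subseteq> orthant S'" "rep S' \<nu>' (op_d i) p = 0" by simp_all
    have o: "\<alpha>(i := \<alpha> i + c) \<in> orthant S'" if "\<alpha> \<in> orthant S'" for \<alpha> c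
      using that i by (auto simp: orthant_def S)
    \<comment> \<open>Outside \<open>S\<close> integration undoes differentiation on basis vectors,
      which makes \<partial>_i injective.\<close>
    have "rep S' \<nu>' (op_int i) (rep S' \<nu>' (op_d i) p) = p"
    proof (rule plin_eqI[OF plin_comp[OF plin_rep plin_rep] plin_ident])
      fix \<alpha> assume "\<alpha> \<in> keys p"
      then have a: "\<alpha> \<in> orthant S'" using p(1) by blast
      then have "\<alpha>(i := \<alpha> i - 1) \<in> orthant S'" using o[of \<alpha> "-1"] by simp
      then show "rep S' \<nu>' (op_int i) (rep S' \<nu>' (op_d i) (single \<alpha> 1)) = single \<alpha> 1"
        by (simp add: rep_single[OF nu' symbol_d a] rep_single[OF nu' symbol_int])
    qed
    then show "p = \<zero>\<^bsub>std_module S' \<nu>'\<^esub>" using p(2) by (simp add: plin_zero[OF plin_rep])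
  next
    show "simple_module intdiff_alg (std_module S' \<nu>')" by (rule simple_std[OF nu'])
    show "?v \<noteq> \<zero>\<^bsub>std_module S' \<nu>'\<^esub>"
      by (simp add: poly_mapping_eq_iff fun_eq_iff lookup_single) (metis when_simps(1) zero_neq_one)
  qed (use kv in simp)
qed

lemma simple_weight_module_cases:
  fixes M :: "(('n::finite, 'k::field_char_0) mpol_op, 'm) module"
  assumes "simple_weight_module M \<or> simple_gen_weight_module M"
  obtains S \<nu> where "\<forall>i\<in>S. \<nu> i = 0" "left_module intdiff_alg M"
    "module_isomorphic intdiff_alg (std_module S \<nu>) M"
proof -
  have simple: "simple_module intdiff_alg M"
    using assms by (auto simp: simple_weight_module_def simple_gen_weight_module_def)
  then have lm: "left_module intdiff_alg M" and nz: "carrier M \<noteq> {\<zero>\<^bsub>M\<^esub>}" by (auto simp: simple_module_def)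
  interpret M: intdiff_module M by (rule intdiff_moduleI[OF lm])
  \<comment> \<open>If all the subspaces were zero, the decomposition would make every vector an
    empty sum, against simplicity.\<close>
  have nonzero: "\<exists>w. V w \<noteq> {\<zero>\<^bsub>M\<^esub>}" if V: "internal_direct_sum M V" for V :: "('n \<Rightarrow> 'k) \<Rightarrow> 'm set"
  proof (rule ccontr)
    assume "\<nexists>w. V w \<noteq> {\<zero>\<^bsub>M\<^esub>}"
    then have z: "V w = {\<zero>\<^bsub>M\<^esub>}" for w by blast
    have "v = \<zero>\<^bsub>M\<^esub>" if "v \<in> carrier M" for v
    proof -
      obtain f where f: "\<forall>w. f w \<in> V w" "v = (\<Oplus>\<^bsub>M\<^esub>i\<in>{i. f i \<noteq> \<zero>\<^bsub>M\<^esub>}. f i)"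
        using V \<open>v \<in> carrier M\<close> unfolding internal_direct_sum_def by blast
      then have "{i. f i \<noteq> \<zero>\<^bsub>M\<^esub>} = {}" by (auto simp: z)
      with f(2) show ?thesis by simp
    qed
    then show False using nz by auto
  qed
  have "\<exists>w. gen_weight_space M w \<noteq> {\<zero>\<^bsub>M\<^esub>}"
    using assms
  proof
    assume "simple_weight_module M"
    then obtain w where w: "weight_space M w \<noteq> {\<zero>\<^bsub>M\<^esub>}"
      using nonzero[of "weight_space M"] by (auto simp: simple_weight_module_def weight_module_def)
    have "\<zero>\<^bsub>M\<^esub> \<in> weight_space M w" by (simp add: M.weight_space_eq M.smult_r_null)
    then show ?thesis using w M.weight_space_subset_gen[of w] by blast
  next
    assume "simple_gen_weight_module M"
    then show ?thesis
      using nonzero[of "gen_weight_space M"] by (auto simp: simple_gen_weight_module_def gen_weight_module_def)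
  qed
  then show thesis
    using M.simple_module_iso_std[OF simple] lm that by blast
qed

lemma tensor_module_iso_std:
  fixes Ms :: "'n::finite \<Rightarrow> ((unit, 'k::field_char_0) mpol_op, 'm) module"
  assumes mu: "\<And>i. \<forall>u\<in>T i. \<mu> i u = 0" and lm: "\<And>i. left_module intdiff_alg (Ms i)"
    and iso: "\<And>i. module_isomorphic intdiff_alg (std_module (T i) (\<mu> i)) (Ms i)"
  shows "left_module intdiff_alg (tensor_module Ms)"
    and "module_isomorphic intdiff_alg (tensor_module Ms) (std_module {i. () \<in> T i} (\<lambda>i. \<mu> i ()))"
proof -
  have "\<forall>i. \<exists>f. mod_iso intdiff_alg (Ms i) (std_module (T i) (\<mu> i)) f"
    using module_isomorphic_sym[OF iso left_module_std[OF mu]] by (simp add: module_isomorphic_iff)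
  then obtain \<phi> where \<phi>: "\<And>i. mod_iso intdiff_alg (Ms i) (std_module (T i) (\<mu> i)) (\<phi> i)"
    using choice[of "\<lambda>i f. mod_iso intdiff_alg (Ms i) (std_module (T i) (\<mu> i)) f"] by blast
  show "left_module intdiff_alg (tensor_module Ms)"
    "module_isomorphic intdiff_alg (tensor_module Ms) (std_module {i. () \<in> T i} (\<lambda>i. \<mu> i ()))"
    using tensor_module_std[where Ms = Ms and T = T and \<mu> = \<mu>, OF mu lm \<phi> refl refl] by simp_all
qed

lemma Supp_isomorphic:
  "module_isomorphic intdiff_alg M N \<Longrightarrow> left_module intdiff_alg M \<Longrightarrow> left_module intdiff_alg N \<Longrightarrow> Supp N = Supp M"
  unfolding module_isomorphic_iff by (auto dest: Supp_transfer)

lemma Supp_iff_Supp1: "c \<in> Supp M \<longleftrightarrow> c () \<in> Supp1 M"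
proof -
  have "(\<lambda>_. c ()) = c" by auto
  then show ?thesis by (simp add: Supp1_def)
qed

lemma Supp1_std:
  assumes "\<forall>u\<in>T. \<mu> u = 0"
  shows "Supp1 (std_module T \<mu>) = {\<mu> () + of_int (a + 1) | a. () \<in> T \<longrightarrow> 0 \<le> a}"
proof -
  have "(\<lambda>_. c) \<in> wt \<mu> ` orthant T \<longleftrightarrow> (\<exists>a. c = \<mu> () + of_int (a + 1) \<and> (() \<in> T \<longrightarrow> 0 \<le> a))" for c
  proof
    assume "(\<lambda>_. c) \<in> wt \<mu> ` orthant T"
    then obtain \<alpha> where "\<alpha> \<in> orthant T" "(\<lambda>_. c) = wt \<mu> \<alpha>" by blast
    then show "\<exists>a. c = \<mu> () + of_int (a + 1) \<and> (() \<in> T \<longrightarrow> 0 \<le> a)"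
      using fun_cong[of "\<lambda>_. c" "wt \<mu> \<alpha>" "()"] by (intro exI[of _ "\<alpha> ()"]) (auto simp: wt_def orthant_def)
  next
    assume "\<exists>a. c = \<mu> () + of_int (a + 1) \<and> (() \<in> T \<longrightarrow> 0 \<le> a)"
    then obtain a where "c = \<mu> () + of_int (a + 1)" "() \<in> T \<longrightarrow> 0 \<le> a" by blast
    then show "(\<lambda>_. c) \<in> wt \<mu> ` orthant T"
      by (intro image_eqI[of _ _ "\<lambda>_. a"]) (auto simp: wt_def orthant_def)
  qed
  then show ?thesis by (auto simp: Supp1_def Supp_std[OF assms])
qed

lemma Supp_std_prod:
  fixes T :: "'n::finite \<Rightarrow> unit set" and \<mu> :: "'n \<Rightarrow> unit \<Rightarrow> 'k::field_char_0"
  assumes mu: "\<And>i. \<forall>u\<in>T i. \<mu> i u = 0"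
  shows "Supp (std_module {i. () \<in> T i} (\<lambda>i. \<mu> i ())) = Pi UNIV (\<lambda>i. Supp1 (std_module (T i) (\<mu> i)))"
proof -
  have "\<forall>i\<in>{i. () \<in> T i}. \<mu> i () = 0" using mu by blast
  then have "Supp (std_module {i. () \<in> T i} (\<lambda>i. \<mu> i ())) = wt (\<lambda>i. \<mu> i ()) ` orthant {i. () \<in> T i}"
    by (rule Supp_std)
  also have "\<dots> = Pi UNIV (\<lambda>i. {\<mu> i () + of_int (a + 1) | a. () \<in> T i \<longrightarrow> 0 \<le> a})"
  proof (intro equalityI subsetI)
    fix w assume "w \<in> Pi UNIV (\<lambda>i. {\<mu> i () + of_int (a + 1) | a. () \<in> T i \<longrightarrow> 0 \<le> a})"
    then have "\<forall>i. \<exists>a. w i = \<mu> i () + of_int (a + 1) \<and> (() \<in> T i \<longrightarrow> 0 \<le> a)" by (auto simp: Pi_def)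
    then obtain \<alpha> where "\<forall>i. w i = \<mu> i () + of_int (\<alpha> i + 1) \<and> (() \<in> T i \<longrightarrow> 0 \<le> \<alpha> i)"
      using choice[of "\<lambda>i a. w i = \<mu> i () + of_int (a + 1) \<and> (() \<in> T i \<longrightarrow> 0 \<le> a)"] by blast
    then show "w \<in> wt (\<lambda>i. \<mu> i ()) ` orthant {i. () \<in> T i}"
      by (intro image_eqI[of _ _ \<alpha>]) (auto simp: wt_def orthant_def)
  qed (auto simp: wt_def orthant_def)
  finally show ?thesis by (simp only: Supp1_std[OF mu])
qed

lemma Supp1_isomorphic:
  "module_isomorphic intdiff_alg M N \<Longrightarrow> left_module intdiff_alg M \<Longrightarrow> left_module intdiff_alg N \<Longrightarrow> Supp1 N = Supp1 M"
  unfolding Supp1_def using Supp_isomorphic by blast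

text \<open>An element of one factor is completed by arbitrary elements of the other factors, which
  are nonempty.\<close>

lemma Pi_UNIV_eqD:
  assumes "Pi UNIV A = Pi UNIV B" "\<And>i. A i \<noteq> {}" "\<And>i. B i \<noteq> {}"
  shows "A i = B i"
proof -
  have sub: "A i \<subseteq> B i" if eq: "Pi UNIV A = Pi UNIV B" and ne: "\<And>i. A i \<noteq> {}" for A B :: "'a \<Rightarrow> 'b set"
  proof
    fix x assume x: "x \<in> A i"
    define g where "g = (\<lambda>j. SOME y. y \<in> A j)"
    have "g j \<in> A j" for j unfolding g_def using ne[of j] by (simp add: some_in_eq)
    then have "g(i := x) \<in> Pi UNIV A" using x by simp
    then have "g(i := x) \<in> Pi UNIV B" using eq by simp
    then have "(g(i := x)) i \<in> B i" by (rule Pi_mem) simp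
    then show "x \<in> B i" by simp
  qed
  show ?thesis using sub[OF assms(1,2)] sub[OF assms(1)[symmetric] assms(3)] by blast
qed

lemma simple_weight_family_cases:
  fixes Ms :: "'n::finite \<Rightarrow> ((unit, 'k::field_char_0) mpol_op, 'm) module"
  assumes "\<forall>i. simple_weight_module (Ms i)"
  obtains T \<mu> where "\<And>i. \<forall>u\<in>T i. \<mu> i u = 0" "\<And>i. left_module intdiff_alg (Ms i)"
    "\<And>i. module_isomorphic intdiff_alg (std_module (T i) (\<mu> i)) (Ms i)"
proof -
  define P where "P i p \<longleftrightarrow> (\<forall>u\<in>fst p. snd p u = 0) \<and> left_module intdiff_alg (Ms i) \<and>
    module_isomorphic intdiff_alg (std_module (fst p) (snd p)) (Ms i)" for i p
  have "\<forall>i. \<exists>p. P i p"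
  proof
    fix i
    have "simple_weight_module (Ms i) \<or> simple_gen_weight_module (Ms i)" using assms by blast
    then show "\<exists>p. P i p"
    proof (rule simple_weight_module_cases)
      fix S \<nu> assume "\<forall>u\<in>S. \<nu> u = 0" "left_module intdiff_alg (Ms i)"
        "module_isomorphic intdiff_alg (std_module S \<nu>) (Ms i)"
      then show ?thesis by (intro exI[of _ "(S, \<nu>)"]) (simp add: P_def)
    qed
  qed
  then obtain p where p: "\<forall>i. P i (p i)" using choice[of P] by blast
  show thesis
    by (rule that[of "\<lambda>i. fst (p i)" "\<lambda>i. snd (p i)"]) (use p in \<open>simp_all add: P_def\<close>)
qed

lemma simple_weight_of_std:
  assumes "\<forall>i\<in>S. \<nu> i = 0" "left_module intdiff_alg M" "module_isomorphic intdiff_alg (std_module S \<nu>) M"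
  shows "simple_weight_module M" "simple_gen_weight_module M"
proof -
  obtain f where f: "mod_iso intdiff_alg (std_module S \<nu>) M f" using assms(3) by (auto simp: module_isomorphic_iff)
  note lm = left_module_std[OF assms(1)]
  show "simple_weight_module M"
    by (rule simple_weight_module_transfer[OF f lm assms(2) simple_weight_std[OF assms(1)]])
  show "simple_gen_weight_module M"
    by (rule simple_gen_weight_module_transfer[OF f lm assms(2) simple_gen_weight_std[OF assms(1)]])
qed

text \<open>The factors have to live in the type of the elements of \<open>M\<close>. Each
  one-variable model is embedded in the n-variable model along the i-th axis and from there into
  \<open>M\<close>. The embedding serves only to supply enough elements; the module structure is
  transported by \<open>left_module_copy\<close>.\<close>

lemma tensor_factors_exist:
  fixes M :: "(('n::finite, 'k::field_char_0) mpol_op, 'm) module"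
  assumes "simple_weight_module M"
  shows "\<exists>Ms :: 'n \<Rightarrow> ((unit, 'k) mpol_op, 'm) module.
    (\<forall>i. simple_weight_module (Ms i)) \<and> module_isomorphic intdiff_alg M (tensor_module Ms)"
proof -
  obtain S \<nu> where nu: "\<forall>i\<in>S. \<nu> i = 0" and lm: "left_module intdiff_alg M"
    and iso: "module_isomorphic intdiff_alg (std_module S \<nu>) M"
    using simple_weight_module_cases[of M] assms by blast
  obtain f where f: "mod_iso intdiff_alg (std_module S \<nu>) M f" using iso by (auto simp: module_isomorphic_iff)
  define T :: "'n \<Rightarrow> unit set" where "T i = {u. i \<in> S}" for i
  define \<mu> :: "'n \<Rightarrow> unit \<Rightarrow> 'k" where "\<mu> i = (\<lambda>_. \<nu> i)" for i
  have mu: "\<forall>u\<in>T i. \<mu> i u = 0" for i using nu by (simp add: T_def \<mu>_def)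
  have ST: "{i. () \<in> T i} = S" "(\<lambda>i. \<mu> i ()) = \<nu>" by (auto simp: T_def \<mu>_def)
  have "\<exists>N :: ((unit, 'k) mpol_op, 'm) module. left_module intdiff_alg N \<and>
      module_isomorphic intdiff_alg (std_module (T i) (\<mu> i)) N" for i
  proof -
    \<comment> \<open>The exponent goes to coordinate i, and the value 0 elsewhere is admissible in
      every orthant.\<close>
    let ?e = "\<lambda>\<beta> :: unit \<Rightarrow> int. (\<lambda>_. 0)(i := \<beta> ())"
    let ?j = "lin_ext (\<lambda>\<beta>. single (?e \<beta>) (1 :: 'k))"
    have e: "?e \<beta> = ?e \<gamma> \<longleftrightarrow> \<gamma> = \<beta>" for \<beta> \<gamma>
    proof
      assume "?e \<beta> = ?e \<gamma>"
      from fun_cong[OF this, of i] show "\<gamma> = \<beta>" by (auto simp: fun_eq_iff)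
    qed simp
    have look: "lookup (?j p) (?e \<gamma>) = lookup p \<gamma>" for p \<gamma>
    proof -
      have "lookup (?j p) (?e \<gamma>) = (\<Sum>\<beta>\<in>keys p. if \<gamma> = \<beta> then lookup p \<beta> else 0)"
        unfolding lookup_lin_ext by (rule sum.cong) (auto simp: lookup_single when_def e simp del: fun_upd_apply)
      then show ?thesis by (simp add: in_keys_iff)
    qed
    have inj: "inj ?j"
    proof (rule injI)
      fix p q assume "?j p = ?j q"
      then show "p = q" using look by (metis poly_mapping_eqI)
    qed
    have "keys (?j p) \<subseteq> orthant S" if "keys p \<subseteq> orthant (T i)" for p
      using that by (intro keys_lin_ext_subset) (auto simp: orthant_def T_def)
    then have "inj_on (f \<circ> ?j) (carrier (std_module (T i) (\<mu> i)))"
      using mod_isoD(1)[OF f] inj_on_subset[OF inj]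
      by (intro comp_inj_on) (auto simp: bij_betw_def intro: inj_on_subset)
    from left_module_copy[OF left_module_std[OF mu] this] show ?thesis
      by (auto simp: module_isomorphic_iff)
  qed
  then obtain Ms :: "'n \<Rightarrow> ((unit, 'k) mpol_op, 'm) module"
    where Ms: "\<And>i. left_module intdiff_alg (Ms i)" "\<And>i. module_isomorphic intdiff_alg (std_module (T i) (\<mu> i)) (Ms i)"
    by metis
  note tm = tensor_module_iso_std[where Ms = Ms and T = T and \<mu> = \<mu>, OF mu Ms, unfolded ST]
  have "module_isomorphic intdiff_alg M (tensor_module Ms)"
    by (rule module_isomorphic_trans[OF module_isomorphic_sym[OF iso left_module_std[OF nu]]
          module_isomorphic_sym[OF tm(2,1)]])
  moreover have "simple_weight_module (Ms i)" for i
    by (rule simple_weight_of_std[OF mu Ms])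
  ultimately show ?thesis by blast
qed

theorem theorem2p3:
  shows
    "(\<forall>M :: (('n::finite, 'k::field_char_0) mpol_op, 'm) module.
        simple_gen_weight_module M \<longleftrightarrow> simple_weight_module M) \<and>
     (\<forall>M :: (('n, 'k) mpol_op, 'm) module. simple_weight_module M \<longrightarrow>
        (\<exists>Ms :: 'n \<Rightarrow> ((unit, 'k) mpol_op, 'm) module.
           (\<forall>i. simple_weight_module (Ms i)) \<and>
           module_isomorphic intdiff_alg M (tensor_module Ms))) \<and>
     (\<forall>Ms :: 'n \<Rightarrow> ((unit, 'k) mpol_op, 'a) module.
        (\<forall>i. simple_weight_module (Ms i)) \<longrightarrow> simple_weight_module (tensor_module Ms)) \<and>
     (\<forall>(Ms :: 'n \<Rightarrow> ((unit, 'k) mpol_op, 'a) module) (Ns :: 'n \<Rightarrow> ((unit, 'k) mpol_op, 'b) module).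
        (\<forall>i. simple_weight_module (Ms i)) \<longrightarrow> (\<forall>i. simple_weight_module (Ns i)) \<longrightarrow>
        (module_isomorphic intdiff_alg (tensor_module Ms) (tensor_module Ns) \<longleftrightarrow>
           (\<forall>i. module_isomorphic intdiff_alg (Ms i) (Ns i)))) \<and>
     (\<forall>(M :: (('n, 'k) mpol_op, 'm) module) (Ms :: 'n \<Rightarrow> ((unit, 'k) mpol_op, 'a) module).
        simple_weight_module M \<longrightarrow> (\<forall>i. simple_weight_module (Ms i)) \<longrightarrow>
        module_isomorphic intdiff_alg M (tensor_module Ms) \<longrightarrow>
        Supp M = Pi UNIV (\<lambda>i. Supp1 (Ms i)))"
proof (intro conjI allI impI)
  fix M :: "(('n, 'k) mpol_op, 'm) module"
  \<comment> \<open>Either hypothesis yields an isomorphism with a model, and a model has both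
    properties.\<close>
  show "simple_gen_weight_module M \<longleftrightarrow> simple_weight_module M"
    using simple_weight_module_cases[of M] simple_weight_of_std by metis
next
  fix M :: "(('n, 'k) mpol_op, 'm) module"
  assume "simple_weight_module M"
  then show "\<exists>Ms :: 'n \<Rightarrow> ((unit, 'k) mpol_op, 'm) module.
      (\<forall>i. simple_weight_module (Ms i)) \<and> module_isomorphic intdiff_alg M (tensor_module Ms)"
    by (rule tensor_factors_exist)
next
  fix Ms :: "'n \<Rightarrow> ((unit, 'k) mpol_op, 'a) module"
  assume "\<forall>i. simple_weight_module (Ms i)"
  then obtain T \<mu> where M: "\<And>i. \<forall>u\<in>T i. \<mu> i u = 0" "\<And>i. left_module intdiff_alg (Ms i)"
    "\<And>i. module_isomorphic intdiff_alg (std_module (T i) (\<mu> i)) (Ms i)"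
    using simple_weight_family_cases[of Ms] by blast
  note tm = tensor_module_iso_std[OF M]
  show "simple_weight_module (tensor_module Ms)"
    by (rule simple_weight_of_std(1)[OF _ tm(1) module_isomorphic_sym[OF tm(2,1)]]) (use M(1) in blast)
next
  fix Ms :: "'n \<Rightarrow> ((unit, 'k) mpol_op, 'a) module" and Ns :: "'n \<Rightarrow> ((unit, 'k) mpol_op, 'b) module"
  assume "\<forall>i. simple_weight_module (Ms i)" "\<forall>i. simple_weight_module (Ns i)"
  then obtain T \<mu> T' \<mu>' where M: "\<And>i. \<forall>u\<in>T i. \<mu> i u = 0" "\<And>i. left_module intdiff_alg (Ms i)"
    "\<And>i. module_isomorphic intdiff_alg (std_module (T i) (\<mu> i)) (Ms i)"
    and N: "\<And>i. \<forall>u\<in>T' i. \<mu>' i u = 0" "\<And>i. left_module intdiff_alg (Ns i)"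
    "\<And>i. module_isomorphic intdiff_alg (std_module (T' i) (\<mu>' i)) (Ns i)"
    using simple_weight_family_cases[of Ms] simple_weight_family_cases[of Ns] by metis
  note tM = tensor_module_iso_std[OF M] and tN = tensor_module_iso_std[OF N]
  show "module_isomorphic intdiff_alg (tensor_module Ms) (tensor_module Ns) \<longleftrightarrow>
      (\<forall>i. module_isomorphic intdiff_alg (Ms i) (Ns i))"
  proof (intro iffI allI)
    fix i
    assume iso: "module_isomorphic intdiff_alg (tensor_module Ms) (tensor_module Ns)"
    have nu: "\<forall>i\<in>{i. () \<in> T i}. \<mu> i () = 0" "\<forall>i\<in>{i. () \<in> T' i}. \<mu>' i () = 0" using M(1) N(1) by blast+
    \<comment> \<open>Isomorphic modules have equal supports. These are products of nonempty
      factors, so they agree slot by slot, and the support of a model determines it up to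
      isomorphism.\<close>
    have "Supp (std_module {i. () \<in> T i} (\<lambda>i. \<mu> i ())) = Supp (std_module {i. () \<in> T' i} (\<lambda>i. \<mu>' i ()))"
      using Supp_isomorphic[OF tM(2,1) left_module_std[OF nu(1)]] Supp_isomorphic[OF iso tM(1) tN(1)]
        Supp_isomorphic[OF tN(2,1) left_module_std[OF nu(2)]] by simp
    then have "Pi UNIV (\<lambda>i. Supp1 (std_module (T i) (\<mu> i))) = Pi UNIV (\<lambda>i. Supp1 (std_module (T' i) (\<mu>' i)))"
      by (simp only: Supp_std_prod[OF M(1)] Supp_std_prod[OF N(1)])
    moreover have "Supp1 (std_module (T i) (\<mu> i)) \<noteq> {}" "Supp1 (std_module (T' i) (\<mu>' i)) \<noteq> {}" for i
      by (auto simp: Supp1_std[OF M(1)] Supp1_std[OF N(1)])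
    ultimately have "Supp1 (std_module (T i) (\<mu> i)) = Supp1 (std_module (T' i) (\<mu>' i))"
      by (rule Pi_UNIV_eqD)
    then have "Supp (std_module (T i) (\<mu> i)) = Supp (std_module (T' i) (\<mu>' i))"
      by (simp only: set_eq_iff Supp_iff_Supp1 simp_thms)
    then have std: "module_isomorphic intdiff_alg (std_module (T i) (\<mu> i)) (std_module (T' i) (\<mu>' i))"
      by (rule std_module_iso_of_Supp[OF M(1) N(1)])
    show "module_isomorphic intdiff_alg (Ms i) (Ns i)"
      by (rule module_isomorphic_trans[OF module_isomorphic_trans[OF
            module_isomorphic_sym[OF M(3) left_module_std[OF M(1)]] std] N(3)])
  next
    assume iso: "\<forall>i. module_isomorphic intdiff_alg (Ms i) (Ns i)"
    \<comment> \<open>The models chosen for the \<open>Ms i\<close> also serve for the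
      \<open>Ns i\<close>, so both tensor products are isomorphic to the same model.\<close>
    have "module_isomorphic intdiff_alg (std_module (T i) (\<mu> i)) (Ns i)" for i
      using module_isomorphic_trans[OF M(3)] iso by blast
    note tN' = tensor_module_iso_std[OF M(1) N(2) this]
    show "module_isomorphic intdiff_alg (tensor_module Ms) (tensor_module Ns)"
      by (rule module_isomorphic_trans[OF tM(2) module_isomorphic_sym[OF tN'(2,1)]])
  qed
next
  fix M :: "(('n, 'k) mpol_op, 'm) module" and Ms :: "'n \<Rightarrow> ((unit, 'k) mpol_op, 'a) module"
  assume "simple_weight_module M" and "\<forall>i. simple_weight_module (Ms i)"
    and iso: "module_isomorphic intdiff_alg M (tensor_module Ms)"
  then obtain T \<mu> where Ms: "\<And>i. \<forall>u\<in>T i. \<mu> i u = 0" "\<And>i. left_module intdiff_alg (Ms i)"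
    "\<And>i. module_isomorphic intdiff_alg (std_module (T i) (\<mu> i)) (Ms i)"
    using simple_weight_family_cases[of Ms] by blast
  have lm: "left_module intdiff_alg M"
    using \<open>simple_weight_module M\<close> by (simp add: simple_weight_module_def weight_module_def)
  note tm = tensor_module_iso_std[OF Ms]
  have nu: "\<forall>i\<in>{i. () \<in> T i}. \<mu> i () = 0" using Ms(1) by blast
  have "Supp M = Supp (std_module {i. () \<in> T i} (\<lambda>i. \<mu> i ()))"
    using Supp_isomorphic[OF iso lm tm(1)] Supp_isomorphic[OF tm(2,1) left_module_std[OF nu]] by simp
  also have "\<dots> = Pi UNIV (\<lambda>i. Supp1 (Ms i))"
    using Supp1_isomorphic[OF Ms(3) left_module_std[OF Ms(1)] Ms(2)] by (simp only: Supp_std_prod[OF Ms(1)])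
  finally show "Supp M = Pi UNIV (\<lambda>i. Supp1 (Ms i))" .
qed

end
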